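(* Let $(R,\mathfrak m,k)$ be an Artinian commutative local ring with $\mathfrak m\neq 0$, and let $n\ge1$ be an integer with $\mathfrak m^{n+1}=0$. If $\nu^{n-1}_i=0$ for all $i\gg0$, then $\nu^{n-1}_i=0$ for all $i>0$.
   Context: For integers $s,i\ge 0$, $\nu^s_i\colon \operatorname{Tor}_i^R(k,R/\mathfrak m^{s+1})\to\operatorname{Tor}_i^R(k,R/\mathfrak m^s)$ denotes the map induced by the canonical surjection $R/\mathfrak m^{s+1}\to R/\mathfrak m^s$ (with $\mathfrak m^0=R$). *)

theory Defs
  imports "HOL-Algebra.Algebra"
begin

section \<open>Artinian local rings\<close>

locale artinian_ring = ring +
  assumes dcc: "\<lbrakk>\<And>i::nat. ideal (I i) R; antimono I\<rbrakk> \<Longrightarrow> \<exists>N. \<forall>i\<ge>N. I i = I N"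

locale local_ring = cring R + maximalideal m R for R (structure) and m +
  assumes unique_maximal: "maximalideal J R \<Longrightarrow> J = m"

primrec ideal_power :: "('a, 'b) ring_scheme \<Rightarrow> 'a set \<Rightarrow> nat \<Rightarrow> 'a set" where
  "ideal_power R I 0 = carrier R"
| "ideal_power R I (Suc s) = ideal_prod R I (ideal_power R I s)"


section \<open>Modules, free modules, free resolutions\<close>

definition module_hom ::
    "('a, 'b) ring_scheme \<Rightarrow> ('a, 'm, 'c) module_scheme \<Rightarrow> ('a, 'n, 'd) module_scheme \<Rightarrow> ('m \<Rightarrow> 'n) set" where
  "module_hom R M N = {f \<in> hom (add_monoid M) (add_monoid N).
     \<forall>r\<in>carrier R. \<forall>x\<in>carrier M. f (r \<odot>\<^bsub>M\<^esub> x) = r \<odot>\<^bsub>N\<^esub> f x}"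

definition quotient_module :: "('a, 'b) ring_scheme \<Rightarrow> 'a set \<Rightarrow> ('a, 'a set) module" where
  "quotient_module R I =
     \<lparr>carrier = carrier (R Quot I), monoid.mult = monoid.mult (R Quot I),
      monoid.one = monoid.one (R Quot I),
      ring.zero = ring.zero (R Quot I), ring.add = ring.add (R Quot I),
      smult = (\<lambda>r C. (I +>\<^bsub>R\<^esub> r) \<otimes>\<^bsub>R Quot I\<^esub> C)\<rparr>"

text \<open>For ideals \<open>I \<subseteq> J\<close> the canonical surjection from \<open>R/I\<close> to \<open>R/J\<close>: it sends the coset \<open>I + x\<close>,
  as a set, to \<open>J + (I + x) = J + x\<close>.\<close>
definition quotient_proj :: "('a, 'b) ring_scheme \<Rightarrow> 'a set \<Rightarrow> 'a set \<Rightarrow> 'a set" where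
  "quotient_proj R J C = J <+>\<^bsub>R\<^esub> C"

definition module_basis :: "('a, 'b) ring_scheme \<Rightarrow> ('a, 'm, 'c) module_scheme \<Rightarrow> 'm set \<Rightarrow> bool" where
  "module_basis R M B \<longleftrightarrow> B \<subseteq> carrier M \<and>
     (\<forall>x\<in>carrier M. \<exists>!c. c \<in> B \<rightarrow>\<^sub>E carrier R \<and> finite {b \<in> B. c b \<noteq> \<zero>\<^bsub>R\<^esub>} \<and>
        x = (\<Oplus>\<^bsub>M\<^esub> b \<in> {b \<in> B. c b \<noteq> \<zero>\<^bsub>R\<^esub>}. c b \<odot>\<^bsub>M\<^esub> b))"

definition free_module :: "('a, 'b) ring_scheme \<Rightarrow> ('a, 'm, 'c) module_scheme \<Rightarrow> bool" where
  "free_module R M \<longleftrightarrow> module R M \<and> (\<exists>B. module_basis R M B)"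

text \<open>The differentials are indexed by their target: \<open>d i\<close> maps \<open>F (i + 1)\<close> to \<open>F i\<close>.\<close>
definition free_resolution ::
    "('a, 'b) ring_scheme \<Rightarrow> ('a, 'n, 'c) module_scheme \<Rightarrow>
     (nat \<Rightarrow> ('a, 'p, 'd) module_scheme) \<Rightarrow> (nat \<Rightarrow> 'p \<Rightarrow> 'p) \<Rightarrow> ('p \<Rightarrow> 'n) \<Rightarrow> bool" where
  "free_resolution R N F d \<epsilon> \<longleftrightarrow>
     (\<forall>i. free_module R (F i)) \<and>
     (\<forall>i. d i \<in> module_hom R (F (Suc i)) (F i)) \<and>
     \<epsilon> \<in> module_hom R (F 0) N \<and>
     \<epsilon> ` carrier (F 0) = carrier N \<and>
     d 0 ` carrier (F 1) = {x \<in> carrier (F 0). \<epsilon> x = \<zero>\<^bsub>N\<^esub>} \<and>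
     (\<forall>i. d (Suc i) ` carrier (F (Suc (Suc i))) = {x \<in> carrier (F (Suc i)). d i x = \<zero>\<^bsub>F i\<^esub>})"


section \<open>Tensor products\<close>

text \<open>For a homomorphism \<open>f\<close> into \<open>G\<close> whose composite with \<open>G \<rightarrow> G/K\<close> kills a subgroup \<open>H\<close> of its
  source, \<open>induced_map G K f\<close> is the induced map on cosets of \<open>H\<close>: it sends \<open>H x\<close> to
  \<open>K f(H x) = K f(x)\<close>.\<close>
definition induced_map :: "('g, 'c) monoid_scheme \<Rightarrow> 'g set \<Rightarrow> ('h \<Rightarrow> 'g) \<Rightarrow> 'h set \<Rightarrow> 'g set" where
  "induced_map G K f C = K <#>\<^bsub>G\<^esub> (f ` C)"

definition tensor_relators ::
    "('a, 'b) ring_scheme \<Rightarrow> ('a, 'm, 'c) module_scheme \<Rightarrow> ('a, 'n, 'd) module_scheme \<Rightarrow>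
     (('m \<times> 'n) \<Rightarrow>\<^sub>0 int) set" where
  "tensor_relators R M N =
     {frag_of (x \<oplus>\<^bsub>M\<^esub> x', y) - frag_of (x, y) - frag_of (x', y) | x x' y.
        x \<in> carrier M \<and> x' \<in> carrier M \<and> y \<in> carrier N} \<union>
     {frag_of (x, y \<oplus>\<^bsub>N\<^esub> y') - frag_of (x, y) - frag_of (x, y') | x y y'.
        x \<in> carrier M \<and> y \<in> carrier N \<and> y' \<in> carrier N} \<union>
     {frag_of (r \<odot>\<^bsub>M\<^esub> x, y) - frag_of (x, r \<odot>\<^bsub>N\<^esub> y) | r x y.
        r \<in> carrier R \<and> x \<in> carrier M \<and> y \<in> carrier N}"

definition tensor_subgroup ::
    "('a, 'b) ring_scheme \<Rightarrow> ('a, 'm, 'c) module_scheme \<Rightarrow> ('a, 'n, 'd) module_scheme \<Rightarrow>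
     (('m \<times> 'n) \<Rightarrow>\<^sub>0 int) set" where
  "tensor_subgroup R M N =
     generate (free_Abelian_group (carrier M \<times> carrier N)) (tensor_relators R M N)"

text \<open>Only the underlying abelian group of the tensor product over \<open>R\<close> is recorded. This suffices
  for \<open>Tor\<close>: whether a homomorphism of modules vanishes depends only on the underlying map.\<close>
definition tensor ::
    "('a, 'b) ring_scheme \<Rightarrow> ('a, 'm, 'c) module_scheme \<Rightarrow> ('a, 'n, 'd) module_scheme \<Rightarrow>
     (('m \<times> 'n) \<Rightarrow>\<^sub>0 int) set monoid" where
  "tensor R M N = free_Abelian_group (carrier M \<times> carrier N) Mod tensor_subgroup R M N"

text \<open>The map \<open>f \<otimes> g\<close> into the tensor product of \<open>M\<close> and \<open>N\<close>.\<close>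
definition tensor_map ::
    "('a, 'b) ring_scheme \<Rightarrow> ('a, 'm, 'c) module_scheme \<Rightarrow> ('a, 'n, 'd) module_scheme \<Rightarrow>
     ('m1 \<Rightarrow> 'm) \<Rightarrow> ('n1 \<Rightarrow> 'n) \<Rightarrow> (('m1 \<times> 'n1) \<Rightarrow>\<^sub>0 int) set \<Rightarrow> (('m \<times> 'n) \<Rightarrow>\<^sub>0 int) set" where
  "tensor_map R M N f g =
     induced_map (free_Abelian_group (carrier M \<times> carrier N)) (tensor_subgroup R M N)
       (frag_extend (\<lambda>(x, y). frag_of (f x, g y)))"


section \<open>Homology and Tor\<close>

fun cycles :: "(nat \<Rightarrow> ('c, 'x) monoid_scheme) \<Rightarrow> (nat \<Rightarrow> 'c \<Rightarrow> 'c) \<Rightarrow> nat \<Rightarrow> 'c set" where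
  "cycles C d 0 = carrier (C 0)"
| "cycles C d (Suc i) = kernel (C (Suc i)) (C i) (d i)"

definition boundaries :: "(nat \<Rightarrow> ('c, 'x) monoid_scheme) \<Rightarrow> (nat \<Rightarrow> 'c \<Rightarrow> 'c) \<Rightarrow> nat \<Rightarrow> 'c set" where
  "boundaries C d i = d i ` carrier (C (Suc i))"

definition homology :: "(nat \<Rightarrow> ('c, 'x) monoid_scheme) \<Rightarrow> (nat \<Rightarrow> 'c \<Rightarrow> 'c) \<Rightarrow> nat \<Rightarrow> 'c set monoid" where
  "homology C d i = (C i)\<lparr>carrier := cycles C d i\<rparr> Mod boundaries C d i"

text \<open>The map induced in degree \<open>i\<close> homology by a chain map \<open>f\<close> into the complex \<open>(C, d)\<close>.\<close>
definition homology_map ::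
    "(nat \<Rightarrow> ('c, 'x) monoid_scheme) \<Rightarrow> (nat \<Rightarrow> 'c \<Rightarrow> 'c) \<Rightarrow> (nat \<Rightarrow> 'b \<Rightarrow> 'c) \<Rightarrow> nat \<Rightarrow> 'b set \<Rightarrow> 'c set" where
  "homology_map C d f i = induced_map (C i) (boundaries C d i) (f i)"

text \<open>\<open>Tor R F d M i\<close> is \<open>Tor\<^sub>i(N, M)\<close> over \<open>R\<close>, computed from a free resolution \<open>(F, d)\<close> of the
  first argument \<open>N\<close>; it is the degree \<open>i\<close> homology of the complex \<open>F \<otimes> M\<close>.\<close>
definition Tor_differential ::
    "('a, 'b) ring_scheme \<Rightarrow> (nat \<Rightarrow> ('a, 'p, 'c) module_scheme) \<Rightarrow> (nat \<Rightarrow> 'p \<Rightarrow> 'p) \<Rightarrow>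
     ('a, 'm, 'e) module_scheme \<Rightarrow> nat \<Rightarrow> (('p \<times> 'm) \<Rightarrow>\<^sub>0 int) set \<Rightarrow> (('p \<times> 'm) \<Rightarrow>\<^sub>0 int) set" where
  "Tor_differential R F d M j = tensor_map R (F j) M (d j) (\<lambda>y. y)"

definition Tor ::
    "('a, 'b) ring_scheme \<Rightarrow> (nat \<Rightarrow> ('a, 'p, 'c) module_scheme) \<Rightarrow> (nat \<Rightarrow> 'p \<Rightarrow> 'p) \<Rightarrow>
     ('a, 'm, 'e) module_scheme \<Rightarrow> nat \<Rightarrow> (('p \<times> 'm) \<Rightarrow>\<^sub>0 int) set set monoid" where
  "Tor R F d M i = homology (\<lambda>j. tensor R (F j) M) (Tor_differential R F d M) i"

text \<open>The map \<open>Tor\<^sub>i(N, g)\<close> for a homomorphism \<open>g\<close> with target \<open>M\<close>.\<close>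
definition Tor_map ::
    "('a, 'b) ring_scheme \<Rightarrow> (nat \<Rightarrow> ('a, 'p, 'c) module_scheme) \<Rightarrow> (nat \<Rightarrow> 'p \<Rightarrow> 'p) \<Rightarrow>
     ('a, 'm, 'e) module_scheme \<Rightarrow> ('l \<Rightarrow> 'm) \<Rightarrow> nat \<Rightarrow>
     (('p \<times> 'l) \<Rightarrow>\<^sub>0 int) set set \<Rightarrow> (('p \<times> 'm) \<Rightarrow>\<^sub>0 int) set set" where
  "Tor_map R F d M g i =
     homology_map (\<lambda>j. tensor R (F j) M) (Tor_differential R F d M)
       (\<lambda>j. tensor_map R (F j) M (\<lambda>x. x) g) i"


section \<open>The maps nu\<close>

abbreviation quotient_power :: "('a, 'b) ring_scheme \<Rightarrow> 'a set \<Rightarrow> nat \<Rightarrow> ('a, 'a set) module" where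
  "quotient_power R m s \<equiv> quotient_module R (ideal_power R m s)"

text \<open>\<open>nu R m F d s i\<close> is the map from \<open>Tor\<^sub>i(k, R/m\<^sup>s\<^sup>+\<^sup>1)\<close> to \<open>Tor\<^sub>i(k, R/m\<^sup>s)\<close>, where \<open>(F, d)\<close> is a free
  resolution of \<open>k = R/m\<close>.\<close>
definition nu ::
    "('a, 'b) ring_scheme \<Rightarrow> 'a set \<Rightarrow> (nat \<Rightarrow> ('a, 'p, 'c) module_scheme) \<Rightarrow> (nat \<Rightarrow> 'p \<Rightarrow> 'p) \<Rightarrow>
     nat \<Rightarrow> nat \<Rightarrow> (('p \<times> 'a set) \<Rightarrow>\<^sub>0 int) set set \<Rightarrow> (('p \<times> 'a set) \<Rightarrow>\<^sub>0 int) set set" where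
  "nu R m F d s i =
     Tor_map R F d (quotient_power R m s) (quotient_proj R (ideal_power R m s)) i"

definition nu_zero ::
    "('a, 'b) ring_scheme \<Rightarrow> 'a set \<Rightarrow> (nat \<Rightarrow> ('a, 'p, 'c) module_scheme) \<Rightarrow> (nat \<Rightarrow> 'p \<Rightarrow> 'p) \<Rightarrow>
     nat \<Rightarrow> nat \<Rightarrow> bool" where
  "nu_zero R m F d s i \<longleftrightarrow>
     trivial_homomorphism (Tor R F d (quotient_power R m (Suc s)) i)
       (Tor R F d (quotient_power R m s) i) (nu R m F d s i)"

end

theory Submission
  imports Defs
begin

no_notation Sum_Type.Plus (infixr \<open><+>\<close> 65)

text \<open>Let \<open>G\<close> be a minimal free resolution of \<open>k\<close>. In degree \<open>i + 1\<close> the vanishing of \<open>\<nu>\<^sup>n\<^sup>-\<^sup>1\<close> says that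
  boundaries in \<open>m\<^sup>n G\<^sub>i\<close> are images of elements of \<open>m\<^sup>n\<^sup>-\<^sup>1 G\<^sub>i\<^sub>+\<^sub>1\<close>. Such a property passes along a chain map
  \<open>\<theta>\<close> from \<open>G\<close> to itself lowering degrees: for \<open>t \<in> m\<^sup>n\<close> and \<open>z\<close> of high degree, \<open>t z\<close> is a cycle, because \<open>G\<close> is
  minimal and \<open>m\<^sup>n\<^sup>+\<^sup>1 = 0\<close>, hence a boundary, and \<open>\<theta>\<close> maps a lift of \<open>t z\<close> to a lift of \<open>t \<theta>(z)\<close> up to sign.
  So it suffices that every \<open>v \<in> G\<^sub>i\<close> is a sum of elements \<open>\<theta>(z)\<close> with \<open>\<theta>\<close> lowering degrees arbitrarily much.

  This is a chain level form of the theorem that a graded connected Hopf algebra, here \<open>Ext(k, k)\<close>, with a nonzero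
  integral is finite dimensional. Let \<open>\<mu>\<close> be a multiplication \<open>G \<otimes> G \<rightarrow> G\<close> with unit, \<open>N\<close> large, and
  \<open>h\<close> a chain map from \<open>G\<close> to its \<open>N\<close>-fold shift that maps a basis vector \<open>e\<close> of \<open>G\<^sub>N\<close> to \<open>1\<close>; \<open>h\<close> exists as \<open>G\<close> is
  minimal, and \<open>G\<^sub>N \<noteq> 0\<close> because \<open>R\<close> has a socle inside \<open>m\<close>. Then \<open>c (w, u) = \<mu> (w, h u)\<close> satisfies \<open>c (v, e) = v\<close>.
  Going through the basis vectors \<open>b\<close> of \<open>G\<^sub>0, \<dots>, G\<^sub>i\<close> one subtracts from \<open>c\<close> the pairings \<open>c (b, \<mu> (\<Lambda> w, u))\<close>, where
  the chain map \<open>\<Lambda>\<close> lifts the coordinate of \<open>b\<close>; their values are values of the chain map \<open>\<theta> = c (b, -)\<close>, and what remains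
  of \<open>c\<close> vanishes on \<open>G\<^sub>i\<close> in the first argument.\<close>

section \<open>Homomorphisms from free modules\<close>

text \<open>The subtractions are forced by the Leibniz rule: \<open>c (w, -)\<close> commutes with
  the differentials only up to \<open>c (d w, -)\<close>, so a single value \<open>c (w, u)\<close>
  is not a value of a chain map. A basis vector \<open>b\<close> of the lowest degree on which
  \<open>c\<close> is not zero escapes this, because \<open>c\<close> vanishes at
  \<open>d b\<close>; for it \<open>c (b, -)\<close> is a chain map up to sign. This dictates the
  order of elimination, by degree and then by index. It ends because the modules of the minimal
  resolution have finite rank, and this is where the descending chain condition enters. For
  \<open>b\<close> of degree \<open>q0 \<le> i\<close> the map \<open>c (b, -)\<close> reaches
  degree \<open>i\<close> from degree \<open>N + i - q0\<close>, which is at least \<open>N\<close>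
  and so within the range of the hypothesis. An even \<open>N\<close> lets \<open>h\<close> commute
  with the differentials without a sign. The given resolution of \<open>k\<close> may have infinite
  rank. The elementwise form of the vanishing makes sense for every free resolution and does not
  depend on it, so it can be carried to the minimal one and back.\<close>

lemma module_homD:
  assumes "f \<in> module_hom R M N"
  shows module_hom_closed: "x \<in> carrier M \<Longrightarrow> f x \<in> carrier N"
    and module_hom_add: "\<lbrakk>x \<in> carrier M; y \<in> carrier M\<rbrakk> \<Longrightarrow> f (x \<oplus>\<^bsub>M\<^esub> y) = f x \<oplus>\<^bsub>N\<^esub> f y"
    and module_hom_smult: "\<lbrakk>a \<in> carrier R; x \<in> carrier M\<rbrakk> \<Longrightarrow> f (a \<odot>\<^bsub>M\<^esub> x) = a \<odot>\<^bsub>N\<^esub> f x"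
  using assms by (auto simp: module_hom_def hom_def)

lemma module_homI:
  assumes "\<And>x. x \<in> carrier M \<Longrightarrow> f x \<in> carrier N"
    and "\<And>x y. \<lbrakk>x \<in> carrier M; y \<in> carrier M\<rbrakk> \<Longrightarrow> f (x \<oplus>\<^bsub>M\<^esub> y) = f x \<oplus>\<^bsub>N\<^esub> f y"
    and "\<And>a x. \<lbrakk>a \<in> carrier R; x \<in> carrier M\<rbrakk> \<Longrightarrow> f (a \<odot>\<^bsub>M\<^esub> x) = a \<odot>\<^bsub>N\<^esub> f x"
  shows "f \<in> module_hom R M N"
  using assms by (auto simp: module_hom_def hom_def)

lemma module_hom_comp:
  assumes "f \<in> module_hom R L M" "g \<in> module_hom R M N"
  shows "(\<lambda>x. g (f x)) \<in> module_hom R L N"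
  using module_homD[OF assms(1)] module_homD[OF assms(2)] by (intro module_homI) simp_all

lemma module_hom_ident: "(\<lambda>x. x) \<in> module_hom R M M"
  by (simp add: module_homI)

lemma module_hom_zero:
  assumes "module R M" "module R N" "f \<in> module_hom R M N"
  shows "f \<zero>\<^bsub>M\<^esub> = \<zero>\<^bsub>N\<^esub>"
proof -
  interpret M: module R M by fact
  interpret N: module R N by fact
  have "f \<zero>\<^bsub>M\<^esub> = f (\<zero>\<^bsub>R\<^esub> \<odot>\<^bsub>M\<^esub> \<zero>\<^bsub>M\<^esub>)" by simp
  also have "\<dots> = \<zero>\<^bsub>R\<^esub> \<odot>\<^bsub>N\<^esub> f \<zero>\<^bsub>M\<^esub>" by (rule module_hom_smult[OF assms(3)]) simp_all
  also have "\<dots> = \<zero>\<^bsub>N\<^esub>" by (simp add: module_hom_closed[OF assms(3)])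
  finally show ?thesis .
qed

lemma module_hom_minus:
  assumes "module R M" "module R N" "f \<in> module_hom R M N" "x \<in> carrier M"
  shows "f (\<ominus>\<^bsub>M\<^esub> x) = \<ominus>\<^bsub>N\<^esub> f x"
proof -
  interpret M: module R M by fact
  interpret N: module R N by fact
  have "f x \<oplus>\<^bsub>N\<^esub> f (\<ominus>\<^bsub>M\<^esub> x) = \<zero>\<^bsub>N\<^esub>"
    using assms(4) by (simp add: module_hom_add[OF assms(3), symmetric] M.M.r_neg module_hom_zero[OF assms(1-3)])
  then show ?thesis
    using assms(4) module_hom_closed[OF assms(3)] N.M.minus_equality N.M.a_comm
    by (metis M.M.a_inv_closed)
qed

lemma module_hom_zero_map:
  assumes "module R N"
  shows "(\<lambda>x. \<zero>\<^bsub>N\<^esub>) \<in> module_hom R M N"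
proof -
  interpret N: module R N by fact
  show ?thesis by (intro module_homI) simp_all
qed

lemma module_hom_plus:
  assumes "module R N" "f \<in> module_hom R M N" "g \<in> module_hom R M N"
  shows "(\<lambda>x. f x \<oplus>\<^bsub>N\<^esub> g x) \<in> module_hom R M N"
proof -
  interpret N: module R N by fact
  note f = module_homD[OF assms(2)] and g = module_homD[OF assms(3)]
  show ?thesis
    by (intro module_homI) (simp_all add: f g N.M.a_ac N.smult_r_distr)
qed

lemma module_hom_scale:
  assumes "module R N" "f \<in> module_hom R M N" "a \<in> carrier R"
  shows "(\<lambda>x. a \<odot>\<^bsub>N\<^esub> f x) \<in> module_hom R M N"
proof -
  interpret N: module R N by fact
  note f = module_homD[OF assms(2)]
  have "a \<odot>\<^bsub>N\<^esub> (r \<odot>\<^bsub>N\<^esub> y) = r \<odot>\<^bsub>N\<^esub> (a \<odot>\<^bsub>N\<^esub> y)"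
    if "r \<in> carrier R" "y \<in> carrier N" for r y
    using that assms(3) by (metis N.R.m_comm N.smult_assoc1)
  then show ?thesis
    by (intro module_homI) (simp_all add: f assms N.smult_r_distr)
qed

lemma module_hom_finsum:
  assumes "module R M" "module R N" "f \<in> module_hom R M N" "finite A" "x \<in> A \<rightarrow> carrier M"
  shows "f (\<Oplus>\<^bsub>M\<^esub> i\<in>A. x i) = (\<Oplus>\<^bsub>N\<^esub> i\<in>A. f (x i))"
  using assms(4,5)
proof (induction A rule: finite_induct)
  case empty
  interpret M: module R M by fact
  interpret N: module R N by fact
  show ?case by (simp add: module_hom_zero[OF assms(1-3)])
next
  case (insert a A)
  interpret M: module R M by fact
  interpret N: module R N by fact
  from insert show ?case
    by (simp add: Pi_iff module_homD[OF assms(3)])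
qed

lemma module_basis_ext:
  assumes "module R P" "module R N" "module_basis R P B"
    and "f \<in> module_hom R P N" "g \<in> module_hom R P N"
    and "\<And>b. b \<in> B \<Longrightarrow> f b = g b" "x \<in> carrier P"
  shows "f x = g x"
proof -
  interpret P: module R P by fact
  interpret N: module R N by fact
  have B: "B \<subseteq> carrier P" using assms(3) by (simp add: module_basis_def)
  obtain c where c: "c \<in> B \<rightarrow>\<^sub>E carrier R" "finite {b \<in> B. c b \<noteq> \<zero>\<^bsub>R\<^esub>}"
    "x = (\<Oplus>\<^bsub>P\<^esub> b \<in> {b \<in> B. c b \<noteq> \<zero>\<^bsub>R\<^esub>}. c b \<odot>\<^bsub>P\<^esub> b)"
    using assms(3,7) unfolding module_basis_def by blast
  have cl: "(\<lambda>b. c b \<odot>\<^bsub>P\<^esub> b) \<in> {b \<in> B. c b \<noteq> \<zero>\<^bsub>R\<^esub>} \<rightarrow> carrier P"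
    using c(1) B by (auto simp: PiE_iff)
  show ?thesis
    unfolding c(3) module_hom_finsum[OF assms(1,2,4) c(2) cl] module_hom_finsum[OF assms(1,2,5) c(2) cl]
    using c(1) B module_homD[OF assms(4)] module_homD[OF assms(5)] assms(6)
    by (intro N.M.finsum_cong') (auto simp: PiE_iff subset_iff)
qed

text \<open>The basis may be infinite, so \<open>h x\<close> is a sum over the support of the unique
  coordinates of \<open>x\<close>. Linearity turns on \<open>hS\<close>: any finite expansion of
  \<open>x\<close>, with zero terms allowed, computes \<open>h x\<close>.\<close>

lemma module_basis_extend:
  assumes "module R P" "module R M" "module_basis R P B" "y \<in> B \<rightarrow> carrier M"
  obtains h where "h \<in> module_hom R P M" "\<And>b. b \<in> B \<Longrightarrow> h b = y b"
proof -
  interpret P: module R P by fact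
  interpret M: module R M by fact
  have B: "B \<subseteq> carrier P" using assms(3) by (simp add: module_basis_def)
  define supp where "supp c = {b \<in> B. c b \<noteq> \<zero>\<^bsub>R\<^esub>}" for c
  define isc where "isc x c \<longleftrightarrow> c \<in> B \<rightarrow>\<^sub>E carrier R \<and> finite (supp c) \<and>
     x = (\<Oplus>\<^bsub>P\<^esub> b \<in> supp c. c b \<odot>\<^bsub>P\<^esub> b)" for x c
  define C where "C x = (THE c. isc x c)" for x
  have ex1: "\<exists>!c. isc x c" if "x \<in> carrier P" for x
    using assms(3) that unfolding module_basis_def isc_def supp_def by blast
  have C: "isc x (C x)" if "x \<in> carrier P" for x
    using theI'[OF ex1[OF that]] unfolding C_def .
  have Cu: "C x = c" if "isc x c" "x \<in> carrier P" for x c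
    using ex1[OF that(2)] that C by blast
  have Ccl: "C x b \<in> carrier R" if "x \<in> carrier P" "b \<in> B" for x b
    using C[OF that(1)] that(2) by (auto simp: isc_def PiE_iff)
  have sumP: "(\<Oplus>\<^bsub>P\<^esub> b \<in> supp c. c b \<odot>\<^bsub>P\<^esub> b) = (\<Oplus>\<^bsub>P\<^esub> b \<in> S. c b \<odot>\<^bsub>P\<^esub> b)"
    if "finite S" "supp c \<subseteq> S" "S \<subseteq> B" "\<And>b. b \<in> B \<Longrightarrow> c b \<in> carrier R" for S c
  proof (rule P.M.add.finprod_mono_neutral_cong_left)
    show "c i \<odot>\<^bsub>P\<^esub> i = \<zero>\<^bsub>P\<^esub>" if "i \<in> S - supp c" for i
    proof -
      from that have "c i = \<zero>\<^bsub>R\<^esub>" "i \<in> B" using \<open>supp c \<subseteq> S\<close> \<open>S \<subseteq> B\<close> by (auto simp: supp_def)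
      then show ?thesis using B by auto
    qed
  qed (use that B in \<open>auto simp: subset_iff\<close>)
  have sumM: "(\<Oplus>\<^bsub>M\<^esub> b \<in> supp c. c b \<odot>\<^bsub>M\<^esub> y b) = (\<Oplus>\<^bsub>M\<^esub> b \<in> S. c b \<odot>\<^bsub>M\<^esub> y b)"
    if "finite S" "supp c \<subseteq> S" "S \<subseteq> B" "\<And>b. b \<in> B \<Longrightarrow> c b \<in> carrier R" for S c
  proof (rule M.M.add.finprod_mono_neutral_cong_left)
    show "c i \<odot>\<^bsub>M\<^esub> y i = \<zero>\<^bsub>M\<^esub>" if "i \<in> S - supp c" for i
    proof -
      from that have "c i = \<zero>\<^bsub>R\<^esub>" "i \<in> B" using \<open>supp c \<subseteq> S\<close> \<open>S \<subseteq> B\<close> by (auto simp: supp_def)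
      then show ?thesis using assms(4) by (simp add: Pi_iff)
    qed
  qed (use that assms(4) in \<open>auto simp: subset_iff Pi_iff\<close>)
  define h where "h x = (\<Oplus>\<^bsub>M\<^esub> b \<in> supp (C x). C x b \<odot>\<^bsub>M\<^esub> y b)" for x
  have yc: "y b \<in> carrier M" if "b \<in> B" for b using assms(4) that by auto
  have hS: "h x = (\<Oplus>\<^bsub>M\<^esub> b \<in> S. c b \<odot>\<^bsub>M\<^esub> y b)"
    if "finite S" "supp c \<subseteq> S" "S \<subseteq> B" "\<And>b. b \<in> B \<Longrightarrow> c b \<in> carrier R" 
      "x = (\<Oplus>\<^bsub>P\<^esub> b \<in> S. c b \<odot>\<^bsub>P\<^esub> b)" for x c S
  proof -
    let ?c = "restrict c B"
    have s: "supp ?c = supp c" by (auto simp: supp_def)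
    have x: "x \<in> carrier P" unfolding that(5) by (rule P.M.finsum_closed) (use that B in \<open>auto simp: subset_iff\<close>)
    have "(\<Oplus>\<^bsub>P\<^esub> b \<in> supp c. ?c b \<odot>\<^bsub>P\<^esub> b) = (\<Oplus>\<^bsub>P\<^esub> b \<in> supp c. c b \<odot>\<^bsub>P\<^esub> b)"
      by (rule P.M.finsum_cong') (use that B in \<open>auto simp: supp_def subset_iff\<close>)
    then have "isc x ?c"
      unfolding isc_def s using that sumP[OF that(1-4)] by (auto intro: finite_subset)
    then have Cx: "C x = ?c" using Cu x by blast
    have "(\<Oplus>\<^bsub>M\<^esub> b \<in> supp c. ?c b \<odot>\<^bsub>M\<^esub> y b) = (\<Oplus>\<^bsub>M\<^esub> b \<in> supp c. c b \<odot>\<^bsub>M\<^esub> y b)"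
      by (rule M.M.finsum_cong') (use that yc in \<open>auto simp: supp_def subset_iff\<close>)
    then show ?thesis unfolding h_def Cx s using sumM[OF that(1-4)] by simp
  qed
  show thesis
  proof
    show "h b = y b" if "b \<in> B" for b
    proof -
      have "h b = (\<Oplus>\<^bsub>M\<^esub> b' \<in> {b}. (if b' = b then \<one>\<^bsub>R\<^esub> else \<zero>\<^bsub>R\<^esub>) \<odot>\<^bsub>M\<^esub> y b')"
      proof (rule hS)
        have "(\<Oplus>\<^bsub>P\<^esub> b' \<in> {b}. (if b' = b then \<one>\<^bsub>R\<^esub> else \<zero>\<^bsub>R\<^esub>) \<odot>\<^bsub>P\<^esub> b') = b"
          using that B by (subst P.M.finsum_insert) auto
        then show "b = (\<Oplus>\<^bsub>P\<^esub> b' \<in> {b}. (if b' = b then \<one>\<^bsub>R\<^esub> else \<zero>\<^bsub>R\<^esub>) \<odot>\<^bsub>P\<^esub> b')" by simp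
      qed (use that in \<open>auto simp: supp_def\<close>)
      also have "\<dots> = y b"
        using that yc by (subst M.M.finsum_insert) auto
      finally show ?thesis .
    qed
    show "h \<in> module_hom R P M"
    proof (rule module_homI)
      fix x assume x: "x \<in> carrier P"
      show "h x \<in> carrier M"
        unfolding h_def using x Ccl yc by (intro M.M.finsum_closed) (auto simp: supp_def)
      have fx: "finite (supp (C x))" "x = (\<Oplus>\<^bsub>P\<^esub> b \<in> supp (C x). C x b \<odot>\<^bsub>P\<^esub> b)" using C[OF x] by (auto simp: isc_def)
      {
        fix a assume a: "a \<in> carrier R"
        have "h (a \<odot>\<^bsub>P\<^esub> x) = (\<Oplus>\<^bsub>M\<^esub> b \<in> supp (C x). (a \<otimes>\<^bsub>R\<^esub> C x b) \<odot>\<^bsub>M\<^esub> y b)"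
        proof (rule hS)
          have "a \<odot>\<^bsub>P\<^esub> x = (\<Oplus>\<^bsub>P\<^esub> b \<in> supp (C x). a \<odot>\<^bsub>P\<^esub> (C x b \<odot>\<^bsub>P\<^esub> b))"
            by (subst fx(2), rule P.finsum_smult_ldistr)
              (use a fx x Ccl B in \<open>auto simp: supp_def subset_iff\<close>)
          also have "\<dots> = (\<Oplus>\<^bsub>P\<^esub> b \<in> supp (C x). (a \<otimes>\<^bsub>R\<^esub> C x b) \<odot>\<^bsub>P\<^esub> b)"
            by (rule P.M.finsum_cong')
              (use a x Ccl B in \<open>auto simp: supp_def P.smult_assoc1 subset_iff\<close>)
          finally show "a \<odot>\<^bsub>P\<^esub> x = (\<Oplus>\<^bsub>P\<^esub> b \<in> supp (C x). (a \<otimes>\<^bsub>R\<^esub> C x b) \<odot>\<^bsub>P\<^esub> b)" .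
          show "finite (supp (C x))" by (rule fx)
          show "supp (\<lambda>b. a \<otimes>\<^bsub>R\<^esub> C x b) \<subseteq> supp (C x)" using a by (auto simp: supp_def)
        qed (use a x Ccl in \<open>auto simp: supp_def\<close>)
        also have "\<dots> = (\<Oplus>\<^bsub>M\<^esub> b \<in> supp (C x). a \<odot>\<^bsub>M\<^esub> (C x b \<odot>\<^bsub>M\<^esub> y b))"
          by (rule M.M.finsum_cong')
              (use a x Ccl yc in \<open>auto simp: supp_def M.smult_assoc1\<close>)
        also have "\<dots> = a \<odot>\<^bsub>M\<^esub> h x" unfolding h_def
          by (rule M.finsum_smult_ldistr[symmetric])
            (use a fx x Ccl yc in \<open>auto simp: supp_def\<close>)
        finally show "h (a \<odot>\<^bsub>P\<^esub> x) = a \<odot>\<^bsub>M\<^esub> h x" .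
      }
      fix x' assume x': "x' \<in> carrier P"
      have fx': "finite (supp (C x'))" "x' = (\<Oplus>\<^bsub>P\<^esub> b \<in> supp (C x'). C x' b \<odot>\<^bsub>P\<^esub> b)" using C[OF x'] by (auto simp: isc_def)
      \<comment> \<open>A common index set lets the two expansions be added coefficientwise,
        although the support of the sum may be smaller.\<close>
      let ?S = "supp (C x) \<union> supp (C x')"
      have S: "finite ?S" "?S \<subseteq> B" using fx fx' by (auto simp: supp_def)
      have cl: "C x b \<in> carrier R" "C x' b \<in> carrier R" if "b \<in> B" for b using Ccl x x' that by auto
      have e: "x = (\<Oplus>\<^bsub>P\<^esub> b \<in> ?S. C x b \<odot>\<^bsub>P\<^esub> b)" "x' = (\<Oplus>\<^bsub>P\<^esub> b \<in> ?S. C x' b \<odot>\<^bsub>P\<^esub> b)"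
        using fx(2) fx'(2) sumP[OF S(1), of "C x"] sumP[OF S(1), of "C x'"] S cl by auto
      have "h (x \<oplus>\<^bsub>P\<^esub> x') = (\<Oplus>\<^bsub>M\<^esub> b \<in> ?S. (C x b \<oplus>\<^bsub>R\<^esub> C x' b) \<odot>\<^bsub>M\<^esub> y b)"
      proof (rule hS)
        have "(\<Oplus>\<^bsub>P\<^esub> b \<in> ?S. (C x b \<oplus>\<^bsub>R\<^esub> C x' b) \<odot>\<^bsub>P\<^esub> b)
          = (\<Oplus>\<^bsub>P\<^esub> b \<in> ?S. C x b \<odot>\<^bsub>P\<^esub> b \<oplus>\<^bsub>P\<^esub> C x' b \<odot>\<^bsub>P\<^esub> b)"
          by (rule P.M.finsum_cong') (use S cl B in \<open>auto simp: P.smult_l_distr subset_iff\<close>)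
        also have "\<dots> = x \<oplus>\<^bsub>P\<^esub> x'"
          by (subst P.M.finsum_addf) (use S cl B e in \<open>auto simp: subset_iff\<close>)
        finally show "x \<oplus>\<^bsub>P\<^esub> x' = (\<Oplus>\<^bsub>P\<^esub> b \<in> ?S. (C x b \<oplus>\<^bsub>R\<^esub> C x' b) \<odot>\<^bsub>P\<^esub> b)" by simp
        show "supp (\<lambda>b. C x b \<oplus>\<^bsub>R\<^esub> C x' b) \<subseteq> ?S" by (auto simp: supp_def)
      qed (use S cl in auto)
      also have "\<dots> = (\<Oplus>\<^bsub>M\<^esub> b \<in> ?S. C x b \<odot>\<^bsub>M\<^esub> y b \<oplus>\<^bsub>M\<^esub> C x' b \<odot>\<^bsub>M\<^esub> y b)"
        by (rule M.M.finsum_cong') (use S cl yc in \<open>auto simp: M.smult_l_distr subset_iff\<close>)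
      also have "\<dots> = (\<Oplus>\<^bsub>M\<^esub> b \<in> ?S. C x b \<odot>\<^bsub>M\<^esub> y b) \<oplus>\<^bsub>M\<^esub> (\<Oplus>\<^bsub>M\<^esub> b \<in> ?S. C x' b \<odot>\<^bsub>M\<^esub> y b)"
        by (subst M.M.finsum_addf) (use S cl yc in \<open>auto simp: subset_iff\<close>)
      also have "\<dots> = h x \<oplus>\<^bsub>M\<^esub> h x'"
        using hS[OF S(1) _ S(2) cl(1) e(1)] hS[OF S(1) _ S(2) cl(2) e(2)] by simp
      finally show "h (x \<oplus>\<^bsub>P\<^esub> x') = h x \<oplus>\<^bsub>M\<^esub> h x'" .
    qed
  qed
qed

text \<open>Projectivity of free modules: preimages under \<open>g\<close> are chosen on a basis,
  and the extension is compared with \<open>f\<close> on that basis.\<close>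

lemma free_module_lift:
  assumes "free_module R P" "module R M" "module R N"
    and "f \<in> module_hom R P N" "g \<in> module_hom R M N" "f ` carrier P \<subseteq> g ` carrier M"
  obtains h where "h \<in> module_hom R P M" "\<And>x. x \<in> carrier P \<Longrightarrow> g (h x) = f x"
proof -
  obtain B where P: "module R P" and B: "module_basis R P B" using assms(1) by (auto simp: free_module_def)
  then have Bc: "B \<subseteq> carrier P" by (simp add: module_basis_def)
  have "\<forall>b\<in>B. \<exists>y\<in>carrier M. g y = f b" using assms(6) Bc by force
  then obtain y where y: "y \<in> B \<rightarrow> carrier M" "\<And>b. b \<in> B \<Longrightarrow> g (y b) = f b" by (metis Pi_I)
  obtain h where h: "h \<in> module_hom R P M" "\<And>b. b \<in> B \<Longrightarrow> h b = y b"
    using module_basis_extend[OF P assms(2) B y(1)] by blast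
  have "g (h x) = f x" if "x \<in> carrier P" for x
    using module_basis_ext[OF P assms(3) B module_hom_comp[OF h(1) assms(5)] assms(4) _ that] h(2) y(2) by simp
  with h(1) show thesis by (rule that)
qed

section \<open>Comparison of free resolutions\<close>

text \<open>One recursion serves all later constructions: \<open>\<phi> = 0\<close> gives chain maps
  up to the sign \<open>\<sigma>\<close>, and \<open>\<sigma> = -1\<close> gives null homotopies of
  \<open>\<phi>\<close>. The condition on \<open>\<phi>\<close> makes the right-hand side a cycle.
  Degree 0 asks for a boundary instead, since exactness of \<open>Q\<close> is assumed in positive
  degrees only.\<close>

lemma chain_lift:
  fixes R :: "('a, 'b) ring_scheme"
    and P :: "nat \<Rightarrow> ('a, 'p, 'c) module_scheme" and Q :: "nat \<Rightarrow> ('a, 'q, 'e) module_scheme"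
  assumes P: "\<And>n. free_module R (P n)" "\<And>n. dP n \<in> module_hom R (P (Suc n)) (P n)"
      "\<And>n x. x \<in> carrier (P (Suc (Suc n))) \<Longrightarrow> dP n (dP (Suc n) x) = \<zero>\<^bsub>P n\<^esub>"
    and Q: "\<And>n. module R (Q n)" "\<And>n. dQ n \<in> module_hom R (Q (Suc n)) (Q n)"
      "\<And>n x. \<lbrakk>x \<in> carrier (Q (Suc n)); dQ n x = \<zero>\<^bsub>Q n\<^esub>\<rbrakk> \<Longrightarrow> x \<in> dQ (Suc n) ` carrier (Q (Suc (Suc n)))"
    and \<sigma>: "\<sigma> \<in> carrier R"
    and \<phi>: "\<And>n. \<phi> n \<in> module_hom R (P (Suc n)) (Q n)"
      "\<And>n x. x \<in> carrier (P (Suc (Suc n))) \<Longrightarrow>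
         dQ n (\<phi> (Suc n) x) \<oplus>\<^bsub>Q n\<^esub> \<sigma> \<odot>\<^bsub>Q n\<^esub> \<phi> n (dP (Suc n) x) = \<zero>\<^bsub>Q n\<^esub>"
    and t: "t \<in> module_hom R (P 0) (Q 0)"
      "\<And>x. x \<in> carrier (P (Suc 0)) \<Longrightarrow>
         \<phi> 0 x \<oplus>\<^bsub>Q 0\<^esub> \<sigma> \<odot>\<^bsub>Q 0\<^esub> t (dP 0 x) \<in> dQ 0 ` carrier (Q (Suc 0))"
  obtains s where "s 0 = t" "\<And>n. s n \<in> module_hom R (P n) (Q n)"
    "\<And>n x. x \<in> carrier (P (Suc n)) \<Longrightarrow>
       dQ n (s (Suc n) x) = \<phi> n x \<oplus>\<^bsub>Q n\<^esub> \<sigma> \<odot>\<^bsub>Q n\<^esub> s n (dP n x)"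
proof -
  have mP: "module R (P n)" for n using P(1) by (simp add: free_module_def)
  let ?t = "\<lambda>n f x. \<phi> n x \<oplus>\<^bsub>Q n\<^esub> \<sigma> \<odot>\<^bsub>Q n\<^esub> f (dP n x)"
  \<comment> \<open>The choice of \<open>s n\<close> has to record that the next right-hand side is
    a boundary; otherwise projectivity could not supply \<open>s (n + 1)\<close>.\<close>
  let ?A = "\<lambda>n f. f \<in> module_hom R (P n) (Q n) \<and> (n = 0 \<longrightarrow> f = t) \<and>
    (\<forall>x\<in>carrier (P (Suc n)). ?t n f x \<in> dQ n ` carrier (Q (Suc n)))"
  let ?B = "\<lambda>n f g. \<forall>x\<in>carrier (P (Suc n)). dQ n (g x) = ?t n f x"
  have "\<exists>s. \<forall>n. ?A n (s n) \<and> ?B n (s n) (s (Suc n))"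
  proof (rule dependent_nat_choice)
    show "\<exists>f. ?A 0 f" using t by auto
  next
    fix f n assume f: "?A n f"
    have t: "?t n f \<in> module_hom R (P (Suc n)) (Q n)"
      using f by (intro module_hom_plus module_hom_scale Q(1) \<sigma> \<phi>(1) module_hom_comp[OF P(2)]) auto
    obtain g where g: "g \<in> module_hom R (P (Suc n)) (Q (Suc n))"
      "\<And>x. x \<in> carrier (P (Suc n)) \<Longrightarrow> dQ n (g x) = ?t n f x"
      using free_module_lift[OF P(1) Q(1) Q(1) t Q(2)] f by blast
    have "?t (Suc n) g x \<in> dQ (Suc n) ` carrier (Q (Suc (Suc n)))" if x: "x \<in> carrier (P (Suc (Suc n)))" for x
    proof (rule Q(3))
      interpret Q: module R "Q n" by (rule Q)
      interpret Q': module R "Q (Suc n)" by (rule Q)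
      have dx: "dP (Suc n) x \<in> carrier (P (Suc n))" using module_hom_closed[OF P(2) x] .
      have c: "\<phi> (Suc n) x \<in> carrier (Q (Suc n))" "g (dP (Suc n) x) \<in> carrier (Q (Suc n))"
        "\<phi> n (dP (Suc n) x) \<in> carrier (Q n)"
        using module_hom_closed[OF \<phi>(1)] module_hom_closed[OF g(1)] x dx by auto
      show "?t (Suc n) g x \<in> carrier (Q (Suc n))" using c \<sigma> by simp
      \<comment> \<open>This removes the term with the square of \<open>\<sigma>\<close>; what
        remains is the assumption on \<open>\<phi>\<close>.\<close>
      have f0: "f (dP n (dP (Suc n) x)) = \<zero>\<^bsub>Q n\<^esub>"
        unfolding P(3)[OF x] by (rule module_hom_zero[OF mP Q(1)]) (use f in blast)
      have "dQ n (?t (Suc n) g x) = dQ n (\<phi> (Suc n) x) \<oplus>\<^bsub>Q n\<^esub> \<sigma> \<odot>\<^bsub>Q n\<^esub> dQ n (g (dP (Suc n) x))"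
        using c \<sigma> by (simp add: module_hom_add[OF Q(2)] module_hom_smult[OF Q(2)])
      also have "\<dots> = dQ n (\<phi> (Suc n) x) \<oplus>\<^bsub>Q n\<^esub> \<sigma> \<odot>\<^bsub>Q n\<^esub> \<phi> n (dP (Suc n) x)"
        unfolding g(2)[OF dx] f0 using c \<sigma> by simp
      finally show "dQ n (?t (Suc n) g x) = \<zero>\<^bsub>Q n\<^esub>" unfolding \<phi>(2)[OF x] .
    qed
    then show "\<exists>g. ?A (Suc n) g \<and> ?B n f g" using g by blast
  qed
  then obtain s where s: "\<And>n. ?A n (s n) \<and> ?B n (s n) (s (Suc n))" by blast
  show thesis
    by (rule that[of s]) (use s in auto)
qed

text \<open>The usual submodule \<open>I M\<close>, built one summand at a time so that it supports
  induction. Closure under scalars is not built in; it follows, for any subset \<open>I\<close> of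
  the ring, by moving the scalar onto \<open>x\<close>.\<close>

inductive_set ideal_smult ::
    "'a set \<Rightarrow> ('a, 'm, 'c) module_scheme \<Rightarrow> 'm set"
  for I and M where
    zero: "\<zero>\<^bsub>M\<^esub> \<in> ideal_smult I M"
  | step: "\<lbrakk>a \<in> I; x \<in> carrier M; y \<in> ideal_smult I M\<rbrakk> \<Longrightarrow> y \<oplus>\<^bsub>M\<^esub> a \<odot>\<^bsub>M\<^esub> x \<in> ideal_smult I M"

context module
begin

lemma ideal_smult_closed:
  assumes "I \<subseteq> carrier R" "x \<in> ideal_smult I M"
  shows "x \<in> carrier M"
  using assms(2) by induction (use assms(1) in auto)

lemma ideal_smult_mono:
  assumes "I \<subseteq> J" "x \<in> ideal_smult I M"
  shows "x \<in> ideal_smult J M"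
  using assms(2) by induction (use assms(1) in \<open>auto intro: ideal_smult.intros\<close>)

lemma ideal_smult_add:
  assumes "I \<subseteq> carrier R" "x \<in> ideal_smult I M" "y \<in> ideal_smult I M"
  shows "x \<oplus>\<^bsub>M\<^esub> y \<in> ideal_smult I M"
  using assms(3)
proof induction
  case zero
  then show ?case using assms ideal_smult_closed by auto
next
  case (step a z y)
  have "x \<oplus>\<^bsub>M\<^esub> (y \<oplus>\<^bsub>M\<^esub> a \<odot>\<^bsub>M\<^esub> z) = (x \<oplus>\<^bsub>M\<^esub> y) \<oplus>\<^bsub>M\<^esub> a \<odot>\<^bsub>M\<^esub> z"
    using step assms ideal_smult_closed by (subst M.a_assoc) auto
  with step show ?case by (simp add: ideal_smult.step)
qed

lemma ideal_smultI:
  assumes "I \<subseteq> carrier R" "a \<in> I" "x \<in> carrier M"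
  shows "a \<odot>\<^bsub>M\<^esub> x \<in> ideal_smult I M"
  using ideal_smult.step[OF assms(2,3) ideal_smult.zero] assms by auto

lemma ideal_smult_smult:
  assumes "I \<subseteq> carrier R" "a \<in> carrier R" "x \<in> ideal_smult I M"
  shows "a \<odot>\<^bsub>M\<^esub> x \<in> ideal_smult I M"
  using assms(3)
proof induction
  case zero
  then show ?case using assms by (auto intro: ideal_smult.intros)
next
  case (step b z y)
  have "a \<odot>\<^bsub>M\<^esub> (y \<oplus>\<^bsub>M\<^esub> b \<odot>\<^bsub>M\<^esub> z) = a \<odot>\<^bsub>M\<^esub> y \<oplus>\<^bsub>M\<^esub> b \<odot>\<^bsub>M\<^esub> (a \<odot>\<^bsub>M\<^esub> z)"
    using step assms ideal_smult_closed
    by (simp add: smult_r_distr subset_iff smult_assoc1[symmetric] R.m_comm)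
  with step assms show ?case by (simp add: ideal_smult.step)
qed

lemma ideal_smult_uminus:
  assumes "I \<subseteq> carrier R" "x \<in> ideal_smult I M"
  shows "\<ominus>\<^bsub>M\<^esub> x \<in> ideal_smult I M"
proof -
  have "\<ominus>\<^bsub>M\<^esub> x = (\<ominus> \<one>) \<odot>\<^bsub>M\<^esub> x"
    using ideal_smult_closed[OF assms] by (simp add: smult_l_minus)
  then show ?thesis using assms ideal_smult_smult by simp
qed

lemma ideal_smult_minus:
  assumes "I \<subseteq> carrier R" "x \<in> ideal_smult I M" "y \<in> ideal_smult I M"
  shows "x \<ominus>\<^bsub>M\<^esub> y \<in> ideal_smult I M"
  unfolding a_minus_def using assms by (intro ideal_smult_add ideal_smult_uminus)

lemma ideal_smult_subgroup:
  assumes "I \<subseteq> carrier R"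
  shows "subgroup (ideal_smult I M) (add_monoid M)"
  using assms ideal_smult_closed ideal_smult_add ideal_smult_uminus ideal_smult.zero
  by (intro subgroup.intro) (auto simp: a_inv_def[symmetric])

end

lemma module_hom_ideal_smult:
  assumes "module R M" "module R N" "f \<in> module_hom R M N" "I \<subseteq> carrier R" "x \<in> ideal_smult I M"
  shows "f x \<in> ideal_smult I N"
  using assms(5)
proof induction
  case zero
  then show ?case using module_hom_zero[OF assms(1-3)] by (simp add: ideal_smult.zero)
next
  case (step a x y)
  interpret M: module R M by fact
  interpret N: module R N by fact
  have "f (y \<oplus>\<^bsub>M\<^esub> a \<odot>\<^bsub>M\<^esub> x) = f y \<oplus>\<^bsub>N\<^esub> a \<odot>\<^bsub>N\<^esub> f x"
    using step assms(4) M.ideal_smult_closed by (simp add: module_homD[OF assms(3)] subset_iff)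
  with step module_hom_closed[OF assms(3)] show ?case by (simp add: ideal_smult.step)
qed

text \<open>For a free resolution \<open>F\<close> of the residue field, \<open>I = m\<^sup>s\<^sup>+\<^sup>1\<close> and \<open>J = m\<^sup>s\<close>, this is the elementwise form of the
  vanishing of \<open>\<nu>\<^sup>s\<close> in degree \<open>i + 1\<close>.\<close>

definition boundary_lift ::
    "'a set \<Rightarrow> 'a set \<Rightarrow> (nat \<Rightarrow> ('a, 'p, 'c) module_scheme) \<Rightarrow>
     (nat \<Rightarrow> 'p \<Rightarrow> 'p) \<Rightarrow> nat \<Rightarrow> bool" where
  "boundary_lift I J F d i \<longleftrightarrow>
     (\<forall>x\<in>carrier (F (Suc i)). d i x \<in> ideal_smult I (F i) \<longrightarrow>
        (\<exists>y\<in>ideal_smult J (F (Suc i)). d i y = d i x))"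

lemma free_resolutionD:
  assumes "free_resolution R N F d \<epsilon>"
  shows "free_module R (F i)" "module R (F i)" "d i \<in> module_hom R (F (Suc i)) (F i)"
    "\<epsilon> \<in> module_hom R (F 0) N" "\<epsilon> ` carrier (F 0) = carrier N"
    "d 0 ` carrier (F (Suc 0)) = {x \<in> carrier (F 0). \<epsilon> x = \<zero>\<^bsub>N\<^esub>}"
    "\<lbrakk>x \<in> carrier (F (Suc i)); d i x = \<zero>\<^bsub>F i\<^esub>\<rbrakk> \<Longrightarrow> x \<in> d (Suc i) ` carrier (F (Suc (Suc i)))"
    "x \<in> carrier (F (Suc (Suc i))) \<Longrightarrow> d i (d (Suc i) x) = \<zero>\<^bsub>F i\<^esub>"
    "x \<in> carrier (F (Suc 0)) \<Longrightarrow> \<epsilon> (d 0 x) = \<zero>\<^bsub>N\<^esub>"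
proof -
  note r = assms[unfolded free_resolution_def free_module_def One_nat_def]
  show "free_module R (F i)" "module R (F i)" "d i \<in> module_hom R (F (Suc i)) (F i)"
    "\<epsilon> \<in> module_hom R (F 0) N" "\<epsilon> ` carrier (F 0) = carrier N"
    "d 0 ` carrier (F (Suc 0)) = {x \<in> carrier (F 0). \<epsilon> x = \<zero>\<^bsub>N\<^esub>}"
    "\<lbrakk>x \<in> carrier (F (Suc i)); d i x = \<zero>\<^bsub>F i\<^esub>\<rbrakk> \<Longrightarrow> x \<in> d (Suc i) ` carrier (F (Suc (Suc i)))"
    using r unfolding free_module_def by auto
  have "d (Suc i) ` carrier (F (Suc (Suc i))) \<subseteq> {x \<in> carrier (F (Suc i)). d i x = \<zero>\<^bsub>F i\<^esub>}"
    using r by blast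
  then show "x \<in> carrier (F (Suc (Suc i))) \<Longrightarrow> d i (d (Suc i) x) = \<zero>\<^bsub>F i\<^esub>" by blast
  have "d 0 ` carrier (F (Suc 0)) \<subseteq> {x \<in> carrier (F 0). \<epsilon> x = \<zero>\<^bsub>N\<^esub>}" using r by blast
  then show "x \<in> carrier (F (Suc 0)) \<Longrightarrow> \<epsilon> (d 0 x) = \<zero>\<^bsub>N\<^esub>" by blast
qed

text \<open>After a lift of the augmentation in degree 0 this is \<open>chain_lift\<close> with
  \<open>\<phi> = 0\<close> and \<open>\<sigma> = 1\<close>. Its boundary condition in degree 0 is
  exactness at \<open>G 0\<close>, as \<open>\<eta>\<close> composed with \<open>f0\<close> and
  \<open>d 0\<close> is \<open>\<epsilon>\<close> composed with \<open>d 0\<close>, hence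
  zero.\<close>

lemma free_resolution_comparison:
  assumes N: "module R N" and F: "free_resolution R N F d \<epsilon>" and G: "free_resolution R N G d' \<eta>"
  obtains f where "\<And>n. f n \<in> module_hom R (F n) (G n)"
    "\<And>n x. x \<in> carrier (F (Suc n)) \<Longrightarrow> d' n (f (Suc n) x) = f n (d n x)"
    "\<And>x. x \<in> carrier (F 0) \<Longrightarrow> \<eta> (f 0 x) = \<epsilon> x"
proof -
  note FD = free_resolutionD[OF F] and GD = free_resolutionD[OF G]
  interpret N: module R N by fact
  obtain f0 where f0: "f0 \<in> module_hom R (F 0) (G 0)" "\<And>x. x \<in> carrier (F 0) \<Longrightarrow> \<eta> (f0 x) = \<epsilon> x"
    using free_module_lift[OF FD(1) GD(2) N FD(4) GD(4)] FD(5) GD(5) by auto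
  have m: "module R (G n)" for n by (rule GD(2))
  have z: "\<zero>\<^bsub>G n\<^esub> \<oplus>\<^bsub>G n\<^esub> \<one>\<^bsub>R\<^esub> \<odot>\<^bsub>G n\<^esub> x = x" if "x \<in> carrier (G n)" for n x
  proof -
    interpret G: module R "G n" by (rule m)
    show ?thesis using that by simp
  qed
  have z': "d' n \<zero>\<^bsub>G (Suc n)\<^esub> \<oplus>\<^bsub>G n\<^esub> \<one>\<^bsub>R\<^esub> \<odot>\<^bsub>G n\<^esub> \<zero>\<^bsub>G n\<^esub> = \<zero>\<^bsub>G n\<^esub>" for n
  proof -
    interpret G: module R "G n" by (rule m)
    show ?thesis using module_hom_zero[OF m m GD(3)] by simp
  qed
  obtain f where f: "f 0 = f0" "\<And>n. f n \<in> module_hom R (F n) (G n)"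
    "\<And>n x. x \<in> carrier (F (Suc n)) \<Longrightarrow>
      d' n (f (Suc n) x) = \<zero>\<^bsub>G n\<^esub> \<oplus>\<^bsub>G n\<^esub> \<one>\<^bsub>R\<^esub> \<odot>\<^bsub>G n\<^esub> f n (d n x)"
  proof (rule chain_lift[where \<phi> = "\<lambda>n x. \<zero>\<^bsub>G n\<^esub>" and \<sigma> = "\<one>\<^bsub>R\<^esub>" and P = F and Q = G and dP = d and dQ = d' and t = f0 and R = R])
    show "\<zero>\<^bsub>G 0\<^esub> \<oplus>\<^bsub>G 0\<^esub> \<one>\<^bsub>R\<^esub> \<odot>\<^bsub>G 0\<^esub> f0 (d 0 x) \<in> d' 0 ` carrier (G (Suc 0))"
      if x: "x \<in> carrier (F (Suc 0))" for x
    proof -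
      have dx: "d 0 x \<in> carrier (F 0)" using module_hom_closed[OF FD(3) x] .
      show ?thesis
        unfolding z[OF module_hom_closed[OF f0(1) dx]] GD(6)
        using module_hom_closed[OF f0(1) dx] f0(2)[OF dx] FD(9)[OF x] by simp
    qed
  qed (use FD GD f0(1) z' in \<open>auto intro: module_hom_zero_map\<close>)
  show thesis
  proof
    show "d' n (f (Suc n) x) = f n (d n x)" if "x \<in> carrier (F (Suc n))" for n x
      unfolding f(3)[OF that]
      by (rule z) (rule module_hom_closed[OF f(2) module_hom_closed[OF FD(3) that]])
    show "\<eta> (f 0 x) = \<epsilon> x" if "x \<in> carrier (F 0)" for x
      using f0(2)[OF that] f(1) by simp
  qed (rule f(2))
qed

text \<open>The difference of \<open>f\<close> and the identity vanishes under the augmentation,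
  hence is null homotopic: \<open>chain_lift\<close> is applied to it with the target shifted by one
  degree and \<open>\<sigma> = -1\<close>.\<close>

lemma free_resolution_homotopy:
  assumes N: "module R N" and F: "free_resolution R N F d \<epsilon>"
    and f: "\<And>n. f n \<in> module_hom R (F n) (F n)"
    "\<And>n x. x \<in> carrier (F (Suc n)) \<Longrightarrow> d n (f (Suc n) x) = f n (d n x)"
    "\<And>x. x \<in> carrier (F 0) \<Longrightarrow> \<epsilon> (f 0 x) = \<epsilon> x"
  obtains s where "\<And>n. s n \<in> module_hom R (F n) (F (Suc n))"
    "\<And>x. x \<in> carrier (F 0) \<Longrightarrow> f 0 x = x \<oplus>\<^bsub>F 0\<^esub> d 0 (s 0 x)"
    "\<And>n x. x \<in> carrier (F (Suc n)) \<Longrightarrow>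
       f (Suc n) x = x \<oplus>\<^bsub>F (Suc n)\<^esub> (d (Suc n) (s (Suc n) x) \<oplus>\<^bsub>F (Suc n)\<^esub> s n (d n x))"
proof -
  note FD = free_resolutionD[OF F]
  interpret N: module R N by fact
  have m: "module R (F n)" for n by (rule FD(2))
  let ?m = "\<ominus>\<^bsub>R\<^esub> \<one>\<^bsub>R\<^esub>"
  let ?g = "\<lambda>n x. f n x \<oplus>\<^bsub>F n\<^esub> ?m \<odot>\<^bsub>F n\<^esub> x"
  have g: "?g n \<in> module_hom R (F n) (F n)" for n
    by (intro module_hom_plus m f module_hom_scale module_hom_ident) simp
  have gd: "d n (?g (Suc n) x) = ?g n (d n x)" if x: "x \<in> carrier (F (Suc n))" for n x
  proof -
    interpret F: module R "F n" by (rule m)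
    interpret F': module R "F (Suc n)" by (rule m)
    show ?thesis using x
      by (simp add: module_homD[OF FD(3)] module_hom_closed[OF f(1)] f(2))
  qed
  have ge: "\<epsilon> (?g 0 x) = \<zero>\<^bsub>N\<^esub>" if x: "x \<in> carrier (F 0)" for x
  proof -
    interpret F: module R "F 0" by (rule m)
    show ?thesis using x
      by (simp add: module_homD[OF FD(4)] module_hom_closed[OF f(1)] f(3) N.smult_l_minus N.M.r_neg)
  qed
  have "?g 0 ` carrier (F 0) \<subseteq> d 0 ` carrier (F (Suc 0))"
    unfolding FD(6) using ge module_hom_closed[OF g] by auto
  then obtain s0 where s0: "s0 \<in> module_hom R (F 0) (F (Suc 0))"
    "\<And>x. x \<in> carrier (F 0) \<Longrightarrow> d 0 (s0 x) = ?g 0 x"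
    using free_module_lift[OF FD(1) m m g FD(3)] by blast
  obtain s where s: "s 0 = s0" "\<And>n. s n \<in> module_hom R (F n) (F (Suc n))"
    "\<And>n x. x \<in> carrier (F (Suc n)) \<Longrightarrow>
      d (Suc n) (s (Suc n) x) = ?g (Suc n) x \<oplus>\<^bsub>F (Suc n)\<^esub> ?m \<odot>\<^bsub>F (Suc n)\<^esub> s n (d n x)"
  proof (rule chain_lift[where \<phi> = "\<lambda>n. ?g (Suc n)" and \<sigma> = "?m" and P = F and Q = "\<lambda>n. F (Suc n)" 
        and dP = d and dQ = "\<lambda>n. d (Suc n)" and t = s0 and R = R])
    fix n x assume x: "x \<in> carrier (F (Suc (Suc n)))"
    interpret F: module R "F (Suc n)" by (rule m)
    have dx: "d (Suc n) x \<in> carrier (F (Suc n))" using module_hom_closed[OF FD(3) x] .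
    show "d (Suc n) (?g (Suc (Suc n)) x) \<oplus>\<^bsub>F (Suc n)\<^esub> ?m \<odot>\<^bsub>F (Suc n)\<^esub> ?g (Suc n) (d (Suc n) x) = \<zero>\<^bsub>F (Suc n)\<^esub>"
      unfolding gd[OF x] using module_hom_closed[OF g dx] by (simp add: F.smult_l_minus F.M.r_neg)
  next
    fix x assume x: "x \<in> carrier (F (Suc 0))"
    interpret F: module R "F (Suc 0)" by (rule m)
    interpret F0: module R "F 0" by (rule m)
    have dx: "d 0 x \<in> carrier (F 0)" using module_hom_closed[OF FD(3) x] .
    note c = module_hom_closed[OF g x] module_hom_closed[OF s0(1) dx]
    show "?g (Suc 0) x \<oplus>\<^bsub>F (Suc 0)\<^esub> ?m \<odot>\<^bsub>F (Suc 0)\<^esub> s0 (d 0 x) \<in> d (Suc 0) ` carrier (F (Suc (Suc 0)))"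
    proof (rule FD(7))
      show "?g (Suc 0) x \<oplus>\<^bsub>F (Suc 0)\<^esub> ?m \<odot>\<^bsub>F (Suc 0)\<^esub> s0 (d 0 x) \<in> carrier (F (Suc 0))"
        using c by simp
      have "d 0 (?g (Suc 0) x \<oplus>\<^bsub>F (Suc 0)\<^esub> ?m \<odot>\<^bsub>F (Suc 0)\<^esub> s0 (d 0 x)) = 
          d 0 (?g (Suc 0) x) \<oplus>\<^bsub>F 0\<^esub> ?m \<odot>\<^bsub>F 0\<^esub> d 0 (s0 (d 0 x))"
        using c by (simp add: module_homD[OF FD(3)])
      also have "\<dots> = \<zero>\<^bsub>F 0\<^esub>"
        unfolding gd[OF x] s0(2)[OF dx] using module_hom_closed[OF g dx] by (simp add: F0.smult_l_minus F0.M.r_neg)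
      finally show "d 0 (?g (Suc 0) x \<oplus>\<^bsub>F (Suc 0)\<^esub> ?m \<odot>\<^bsub>F (Suc 0)\<^esub> s0 (d 0 x)) = \<zero>\<^bsub>F 0\<^esub>" .
    qed
  next
    show "?m \<in> carrier R" by simp
  qed (use FD s0(1) g in auto)
  show thesis
  proof
    fix x assume x: "x \<in> carrier (F 0)"
    interpret F: module R "F 0" by (rule m)
    show "f 0 x = x \<oplus>\<^bsub>F 0\<^esub> d 0 (s 0 x)"
      using x module_hom_closed[OF f(1) x]
      by (simp add: s(1) s0(2) F.smult_l_minus F.M.a_lcomm[of x] F.M.r_neg)
  next
    fix n x assume x: "x \<in> carrier (F (Suc n))"
    interpret F: module R "F (Suc n)" by (rule m)
    have "s n (d n x) \<in> carrier (F (Suc n))" using module_hom_closed[OF s(2) module_hom_closed[OF FD(3) x]] .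
    then show "f (Suc n) x = x \<oplus>\<^bsub>F (Suc n)\<^esub> (d (Suc n) (s (Suc n) x) \<oplus>\<^bsub>F (Suc n)\<^esub> s n (d n x))"
      using x module_hom_closed[OF f(1) x] by (simp add: s(3) F.smult_l_minus F.M.a_assoc F.M.l_neg F.M.a_lcomm[of x] F.M.r_neg)
  qed (rule s(2))
qed

text \<open>Take comparison maps \<open>f\<close>, \<open>g\<close> and a homotopy \<open>s\<close>
  from \<open>g f\<close> to the identity. A lift \<open>y\<close> of \<open>f (d x)\<close> gives
  \<open>d (g y) = d x + d (s (d x))\<close>. Since \<open>d x\<close> lies in \<open>I F\<close>,
  so does \<open>s (d x)\<close>, and \<open>I \<subseteq> J\<close> allows it to be subtracted from
  \<open>g y\<close>.\<close>

lemma boundary_lift_transfer: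
  assumes N: "module R N" and F: "free_resolution R N F d \<epsilon>" and G: "free_resolution R N G d' \<eta>"
    and IJ: "I \<subseteq> J" "J \<subseteq> carrier R" and bl: "boundary_lift I J G d' i"
  shows "boundary_lift I J F d i"
proof -
  note FD = free_resolutionD[OF F] and GD = free_resolutionD[OF G]
  have I: "I \<subseteq> carrier R" using IJ by simp
  obtain f where f: "\<And>n. f n \<in> module_hom R (F n) (G n)"
    "\<And>n x. x \<in> carrier (F (Suc n)) \<Longrightarrow> d' n (f (Suc n) x) = f n (d n x)"
    "\<And>x. x \<in> carrier (F 0) \<Longrightarrow> \<eta> (f 0 x) = \<epsilon> x"
    using free_resolution_comparison[OF N F G] by blast
  obtain g where g: "\<And>n. g n \<in> module_hom R (G n) (F n)"
    "\<And>n x. x \<in> carrier (G (Suc n)) \<Longrightarrow> d n (g (Suc n) x) = g n (d' n x)"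
    "\<And>x. x \<in> carrier (G 0) \<Longrightarrow> \<epsilon> (g 0 x) = \<eta> x"
    using free_resolution_comparison[OF N G F] by blast
  obtain s where s: "\<And>n. s n \<in> module_hom R (F n) (F (Suc n))"
    "\<And>x. x \<in> carrier (F 0) \<Longrightarrow> g 0 (f 0 x) = x \<oplus>\<^bsub>F 0\<^esub> d 0 (s 0 x)"
    "\<And>n x. x \<in> carrier (F (Suc n)) \<Longrightarrow>
       g (Suc n) (f (Suc n) x) = x \<oplus>\<^bsub>F (Suc n)\<^esub> (d (Suc n) (s (Suc n) x) \<oplus>\<^bsub>F (Suc n)\<^esub> s n (d n x))"
  proof (rule free_resolution_homotopy[OF N F, where f = "\<lambda>n x. g n (f n x)"])
    show "(\<lambda>x. g n (f n x)) \<in> module_hom R (F n) (F n)" for n by (rule module_hom_comp[OF f(1) g(1)])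
  qed (use f(2,3) g(2,3) module_hom_closed[OF f(1)] in auto)
  show ?thesis
    unfolding boundary_lift_def
  proof (intro ballI impI)
    fix x assume x: "x \<in> carrier (F (Suc i))" and dx: "d i x \<in> ideal_smult I (F i)"
    interpret F: module R "F i" by (rule FD)
    interpret F': module R "F (Suc i)" by (rule FD)
    have dxc: "d i x \<in> carrier (F i)" using module_hom_closed[OF FD(3) x] .
    have fx: "f (Suc i) x \<in> carrier (G (Suc i))" using module_hom_closed[OF f(1) x] .
    have "d' i (f (Suc i) x) \<in> ideal_smult I (G i)"
      unfolding f(2)[OF x] by (rule module_hom_ideal_smult[OF FD(2) GD(2) f(1) I dx])
    then obtain y where y: "y \<in> ideal_smult J (G (Suc i))" "d' i y = f i (d i x)"
      using bl fx f(2)[OF x] unfolding boundary_lift_def by metis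
    have yc: "y \<in> carrier (G (Suc i))" by (rule module.ideal_smult_closed[OF GD(2) IJ(2) y(1)])
    \<comment> \<open>On boundaries the homotopy formula loses its term \<open>s d\<close>; in
      degree 0 it has none.\<close>
    have gf: "g i (f i (d i x)) = d i x \<oplus>\<^bsub>F i\<^esub> d i (s i (d i x))"
    proof (cases i)
      case 0
      then show ?thesis using s(2)[of "d i x"] dxc by simp
    next
      case (Suc k)
      have "s k (d k (d i x)) = \<zero>\<^bsub>F i\<^esub>"
        using FD(8)[of x k] x module_hom_zero[OF FD(2) FD(2) s(1), of k] Suc by simp
      moreover have "d i (s i (d i x)) \<in> carrier (F i)"
        using module_hom_closed[OF FD(3) module_hom_closed[OF s(1) dxc]] .
      moreover have "g i (f i (d i x)) = d i x \<oplus>\<^bsub>F i\<^esub> (d i (s i (d i x)) \<oplus>\<^bsub>F i\<^esub> s k (d k (d i x)))"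
        using s(3)[of "d i x" k] dxc Suc by simp
      ultimately show ?thesis by simp
    qed
    have gy: "g (Suc i) y \<in> ideal_smult J (F (Suc i))"
      by (rule module_hom_ideal_smult[OF GD(2) FD(2) g(1) IJ(2) y(1)])
    have sdx: "s i (d i x) \<in> ideal_smult J (F (Suc i))"
      by (rule F'.ideal_smult_mono[OF IJ(1) module_hom_ideal_smult[OF FD(2) FD(2) s(1) I dx]])
    have c: "g (Suc i) y \<in> carrier (F (Suc i))" "s i (d i x) \<in> carrier (F (Suc i))"
      "d i (s i (d i x)) \<in> carrier (F i)"
      using module_hom_closed[OF g(1) yc] module_hom_closed[OF s(1) dxc]
        module_hom_closed[OF FD(3) module_hom_closed[OF s(1) dxc]] .
    have "d i (g (Suc i) y \<ominus>\<^bsub>F (Suc i)\<^esub> s i (d i x)) = d i (g (Suc i) y) \<ominus>\<^bsub>F i\<^esub> d i (s i (d i x))"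
      unfolding a_minus_def using c by (simp add: module_hom_add[OF FD(3)] module_hom_minus[OF FD(2) FD(2) FD(3)])
    also have "d i (g (Suc i) y) = d i x \<oplus>\<^bsub>F i\<^esub> d i (s i (d i x))"
      unfolding g(2)[OF yc] y(2) gf ..
    also have "\<dots> \<ominus>\<^bsub>F i\<^esub> d i (s i (d i x)) = d i x"
      using dxc c by (simp add: a_minus_def F.M.a_assoc F.M.r_neg)
    finally show "\<exists>y\<in>ideal_smult J (F (Suc i)). d i y = d i x"
      using F'.ideal_smult_minus[OF IJ(2) gy sdx] by blast
  qed
qed

section \<open>Finite free modules\<close>

text \<open>Coordinates outside \<open>S\<close> are zero rather than absent. Free modules of all
  finite ranks thus share one element type and are submodules of \<open>vec_module R UNIV\<close>,
  so a resolution can be a function of the degree.\<close>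

definition vec_module :: "('a, 'b) ring_scheme \<Rightarrow> nat set \<Rightarrow> ('a, nat \<Rightarrow> 'a) module" where
  "vec_module R S =
     \<lparr>carrier = {x. (\<forall>k. x k \<in> carrier R) \<and> (\<forall>k. k \<notin> S \<longrightarrow> x k = \<zero>\<^bsub>R\<^esub>)},
      monoid.mult = (\<lambda>x y k. x k \<otimes>\<^bsub>R\<^esub> y k), monoid.one = (\<lambda>k. \<one>\<^bsub>R\<^esub>),
      ring.zero = (\<lambda>k. \<zero>\<^bsub>R\<^esub>), ring.add = (\<lambda>x y k. x k \<oplus>\<^bsub>R\<^esub> y k),
      smult = (\<lambda>a x k. a \<otimes>\<^bsub>R\<^esub> x k)\<rparr>"

definition unit_vec :: "('a, 'b) ring_scheme \<Rightarrow> nat \<Rightarrow> nat \<Rightarrow> 'a" where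
  "unit_vec R k = (\<lambda>j. if j = k then \<one>\<^bsub>R\<^esub> else \<zero>\<^bsub>R\<^esub>)"

lemma vec_module_simps [simp]:
  "x \<oplus>\<^bsub>vec_module R S\<^esub> y = (\<lambda>k. x k \<oplus>\<^bsub>R\<^esub> y k)"
  "\<zero>\<^bsub>vec_module R S\<^esub> = (\<lambda>k. \<zero>\<^bsub>R\<^esub>)"
  "a \<odot>\<^bsub>vec_module R S\<^esub> x = (\<lambda>k. a \<otimes>\<^bsub>R\<^esub> x k)"
  by (simp_all add: vec_module_def)

lemma vec_module_carrier:
  "x \<in> carrier (vec_module R S) \<longleftrightarrow> (\<forall>k. x k \<in> carrier R) \<and> (\<forall>k. k \<notin> S \<longrightarrow> x k = \<zero>\<^bsub>R\<^esub>)"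
  by (simp add: vec_module_def)

lemma (in cring) vec_module: "module R (vec_module R S)"
proof (rule moduleI)
  show "abelian_group (vec_module R S)"
  proof (rule abelian_groupI)
    show "\<exists>y\<in>carrier (vec_module R S). y \<oplus>\<^bsub>vec_module R S\<^esub> x = \<zero>\<^bsub>vec_module R S\<^esub>"
      if "x \<in> carrier (vec_module R S)" for x
      using that by (intro bexI[of _ "\<lambda>k. \<ominus> x k"]) (auto simp: vec_module_carrier l_neg)
  qed (auto simp: vec_module_carrier a_ac)
qed (auto simp: vec_module_carrier cring_axioms l_distr r_distr m_assoc)

context cring
begin

lemma vec_module_uminus:
  assumes "x \<in> carrier (vec_module R S)"
  shows "\<ominus>\<^bsub>vec_module R S\<^esub> x = (\<lambda>k. \<ominus> x k)"
proof -
  interpret V: module R "vec_module R S" by (rule vec_module)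
  show ?thesis
    by (rule V.M.minus_equality) (use assms in \<open>auto simp: vec_module_carrier l_neg\<close>)
qed

lemma vec_module_finsum:
  assumes "finite A" "f \<in> A \<rightarrow> carrier (vec_module R S)"
  shows "(\<Oplus>\<^bsub>vec_module R S\<^esub> i\<in>A. f i) k = (\<Oplus> i\<in>A. f i k)"
  using assms
proof (induction A rule: finite_induct)
  case empty
  interpret V: module R "vec_module R S" by (rule vec_module)
  show ?case by simp
next
  case (insert a A)
  interpret V: module R "vec_module R S" by (rule vec_module)
  have "(\<Oplus>\<^bsub>vec_module R S\<^esub> i\<in>insert a A. f i) = f a \<oplus>\<^bsub>vec_module R S\<^esub> (\<Oplus>\<^bsub>vec_module R S\<^esub> i\<in>A. f i)"
    using insert by (intro V.M.finsum_insert) auto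
  moreover have "(\<Oplus> i\<in>insert a A. f i k) = f a k \<oplus> (\<Oplus> i\<in>A. f i k)"
    using insert by (intro finsum_insert) (auto simp: vec_module_carrier Pi_iff)
  ultimately show ?case using insert by simp
qed

lemma unit_vec_closed: "k \<in> S \<Longrightarrow> unit_vec R k \<in> carrier (vec_module R S)"
  by (auto simp: vec_module_carrier unit_vec_def)

lemma unit_vec_combination:
  assumes "finite S" "y \<in> S \<rightarrow> carrier R"
  shows "(\<Oplus>\<^bsub>vec_module R S\<^esub> k\<in>S. y k \<odot>\<^bsub>vec_module R S\<^esub> unit_vec R k) = (\<lambda>j. if j \<in> S then y j else \<zero>)"
proof
  fix j
  have "(\<Oplus>\<^bsub>vec_module R S\<^esub> k\<in>S. y k \<odot>\<^bsub>vec_module R S\<^esub> unit_vec R k) j = (\<Oplus> k\<in>S. y k \<otimes> unit_vec R k j)"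
    using assms by (subst vec_module_finsum) (auto simp: vec_module_carrier unit_vec_def Pi_iff)
  also have "\<dots> = (\<Oplus> k\<in>S. if j = k then y k else \<zero>)"
    using assms by (intro finsum_cong') (auto simp: unit_vec_def Pi_iff)
  also have "\<dots> = (if j \<in> S then y j else \<zero>)"
  proof (cases "j \<in> S")
    case True
    then show ?thesis using assms by (simp add: finsum_singleton)
  next
    case False
    then have "(\<Oplus> k\<in>S. if j = k then y k else \<zero>) = (\<Oplus> k\<in>S. \<zero>)"
      by (intro finsum_cong') auto
    then show ?thesis using False by simp
  qed
  finally show "(\<Oplus>\<^bsub>vec_module R S\<^esub> k\<in>S. y k \<odot>\<^bsub>vec_module R S\<^esub> unit_vec R k) j = (if j \<in> S then y j else \<zero>)" .
qed

lemma vec_expansion: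
  assumes "finite S" "x \<in> carrier (vec_module R S)"
  shows "x = (\<Oplus>\<^bsub>vec_module R S\<^esub> k\<in>S. x k \<odot>\<^bsub>vec_module R S\<^esub> unit_vec R k)"
  using assms by (subst unit_vec_combination) (auto simp: vec_module_carrier)

lemma vec_module_basis:
  assumes "finite S" "\<one> \<noteq> \<zero>"
  shows "module_basis R (vec_module R S) (unit_vec R ` S)"
  unfolding module_basis_def
proof (intro conjI ballI)
  interpret V: module R "vec_module R S" by (rule vec_module)
  let ?e = "unit_vec R" and ?V = "vec_module R S"
  have inj: "inj_on ?e S"
    using assms(2) by (auto simp: inj_on_def unit_vec_def fun_eq_iff split: if_splits)
  show "?e ` S \<subseteq> carrier ?V" using unit_vec_closed by blast
  have sum: "(\<Oplus>\<^bsub>?V\<^esub> b \<in> {b \<in> ?e ` S. c b \<noteq> \<zero>}. c b \<odot>\<^bsub>?V\<^esub> b) = (\<lambda>j. if j \<in> S then c (?e j) else \<zero>)"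
    if c: "c \<in> ?e ` S \<rightarrow>\<^sub>E carrier R" for c
  proof -
    have cl: "c b \<in> carrier R" if "b \<in> ?e ` S" for b using c that by (auto simp: PiE_iff)
    have "(\<Oplus>\<^bsub>?V\<^esub> b \<in> {b \<in> ?e ` S. c b \<noteq> \<zero>}. c b \<odot>\<^bsub>?V\<^esub> b) = (\<Oplus>\<^bsub>?V\<^esub> b \<in> ?e ` S. c b \<odot>\<^bsub>?V\<^esub> b)"
    proof (rule V.M.add.finprod_mono_neutral_cong_left)
      show "(\<lambda>b. c b \<odot>\<^bsub>?V\<^esub> b) \<in> ?e ` S \<rightarrow> carrier ?V"
        using cl unit_vec_closed by (intro Pi_I V.smult_closed) auto
      show "c b \<odot>\<^bsub>?V\<^esub> b = \<zero>\<^bsub>?V\<^esub>" if "b \<in> ?e ` S - {b \<in> ?e ` S. c b \<noteq> \<zero>}" for b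
      proof -
        have "c b = \<zero>" "b \<in> carrier ?V" using that unit_vec_closed by auto
        then show ?thesis using V.smult_l_null by simp
      qed
    qed (use assms in auto)
    also have "\<dots> = (\<Oplus>\<^bsub>?V\<^esub> k\<in>S. c (?e k) \<odot>\<^bsub>?V\<^esub> ?e k)"
    proof (rule V.M.add.finprod_reindex[OF _ inj])
      show "(\<lambda>b. c b \<odot>\<^bsub>?V\<^esub> b) \<in> ?e ` S \<rightarrow> carrier ?V"
        using cl unit_vec_closed by (intro Pi_I V.smult_closed) auto
    qed
    also have "\<dots> = (\<lambda>j. if j \<in> S then c (?e j) else \<zero>)"
      using assms cl by (intro unit_vec_combination) auto
    finally show ?thesis .
  qed
  fix x assume x: "x \<in> carrier ?V"
  \<comment> \<open>\<open>module_basis\<close> indexes coefficients by the basis vectors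
    themselves, so the position of a vector is recovered with \<open>inv_into\<close>.\<close>
  let ?c = "restrict (\<lambda>b. x (inv_into S ?e b)) (?e ` S)"
  have c: "?c \<in> ?e ` S \<rightarrow>\<^sub>E carrier R" using x by (auto simp: vec_module_carrier)
  show "\<exists>!c. c \<in> ?e ` S \<rightarrow>\<^sub>E carrier R \<and> finite {b \<in> ?e ` S. c b \<noteq> \<zero>} \<and>
      x = (\<Oplus>\<^bsub>?V\<^esub> b \<in> {b \<in> ?e ` S. c b \<noteq> \<zero>}. c b \<odot>\<^bsub>?V\<^esub> b)"
  proof (rule ex1I[of _ ?c], intro conjI)
    show "?c \<in> ?e ` S \<rightarrow>\<^sub>E carrier R" by (rule c)
    show "finite {b \<in> ?e ` S. ?c b \<noteq> \<zero>}" using assms by simp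
    show "x = (\<Oplus>\<^bsub>?V\<^esub> b \<in> {b \<in> ?e ` S. ?c b \<noteq> \<zero>}. ?c b \<odot>\<^bsub>?V\<^esub> b)"
      unfolding sum[OF c] using x inj by (auto simp: vec_module_carrier fun_eq_iff)
  next
    fix c assume c': "c \<in> ?e ` S \<rightarrow>\<^sub>E carrier R \<and> finite {b \<in> ?e ` S. c b \<noteq> \<zero>} \<and>
      x = (\<Oplus>\<^bsub>?V\<^esub> b \<in> {b \<in> ?e ` S. c b \<noteq> \<zero>}. c b \<odot>\<^bsub>?V\<^esub> b)"
    then have "x = (\<lambda>j. if j \<in> S then c (?e j) else \<zero>)" using sum[of c] by simp
    then have "x j = c (?e j)" if "j \<in> S" for j using that by simp
    then show "c = ?c" using c' inj by (intro PiE_ext[of c "?e ` S" "\<lambda>_. carrier R" ?c] c) auto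
  qed
qed

lemma vec_free_module:
  assumes "finite S" "\<one> \<noteq> \<zero>"
  shows "free_module R (vec_module R S)"
  unfolding free_module_def using vec_module vec_module_basis[OF assms] by blast

lemma vec_hom_ext:
  assumes "finite S" "module R N" "f \<in> module_hom R (vec_module R S) N" "g \<in> module_hom R (vec_module R S) N"
    and "\<And>k. k \<in> S \<Longrightarrow> f (unit_vec R k) = g (unit_vec R k)" "x \<in> carrier (vec_module R S)"
  shows "f x = g x"
proof -
  interpret V: module R "vec_module R S" by (rule vec_module)
  interpret N: module R N by fact
  have c: "(\<lambda>k. x k \<odot>\<^bsub>vec_module R S\<^esub> unit_vec R k) \<in> S \<rightarrow> carrier (vec_module R S)"
    using assms(6) unit_vec_closed by (intro Pi_I V.smult_closed) (auto simp: vec_module_carrier)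
  have e: "h x = (\<Oplus>\<^bsub>N\<^esub> k\<in>S. x k \<odot>\<^bsub>N\<^esub> h (unit_vec R k))" if "h \<in> module_hom R (vec_module R S) N" for h
  proof -
    have "h x = (\<Oplus>\<^bsub>N\<^esub> k\<in>S. h (x k \<odot>\<^bsub>vec_module R S\<^esub> unit_vec R k))"
      by (subst vec_expansion[OF assms(1,6)], rule module_hom_finsum[OF vec_module assms(2) that assms(1) c])
    also have "\<dots> = (\<Oplus>\<^bsub>N\<^esub> k\<in>S. x k \<odot>\<^bsub>N\<^esub> h (unit_vec R k))"
      using assms(6) unit_vec_closed module_hom_closed[OF that]
      by (intro N.M.finsum_cong') (auto simp: vec_module_carrier module_hom_smult[OF that, symmetric])
    finally show ?thesis .
  qed
  show ?thesis
    unfolding e[OF assms(3)] e[OF assms(4)] using assms(5,6) module_hom_closed[OF assms(4)] unit_vec_closed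
    by (intro N.M.finsum_cong') (auto simp: vec_module_carrier)
qed

lemma vec_hom_extend:
  assumes "finite S" "\<one> \<noteq> \<zero>" "module R N" "y \<in> S \<rightarrow> carrier N"
  obtains h where "h \<in> module_hom R (vec_module R S) N" "\<And>k. k \<in> S \<Longrightarrow> h (unit_vec R k) = y k"
proof -
  have inj: "inj_on (unit_vec R) S"
    using assms(2) by (auto simp: inj_on_def unit_vec_def fun_eq_iff split: if_splits)
  have y: "(\<lambda>b. y (inv_into S (unit_vec R) b)) \<in> unit_vec R ` S \<rightarrow> carrier N"
    using assms(4) inj by auto
  obtain h where "h \<in> module_hom R (vec_module R S) N"
     "\<And>b. b \<in> unit_vec R ` S \<Longrightarrow> h b = y (inv_into S (unit_vec R) b)"
    using module_basis_extend[OF vec_module assms(3) vec_module_basis[OF assms(1,2)] y] by blast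
  then show thesis using inj by (intro that[of h]) auto
qed

end

section \<open>Finite generation over an Artinian local ring\<close>

lemma (in ring) ideal_prod_mono:
  assumes "J \<subseteq> J'"
  shows "I \<cdot> J \<subseteq> I \<cdot> J'"
proof
  fix x assume "x \<in> I \<cdot> J"
  then show "x \<in> I \<cdot> J'"
    by induction (use assms in \<open>auto intro: ideal_prod.intros\<close>)
qed

lemma (in ring) ideal_power_ideal:
  assumes "ideal I R"
  shows "ideal (ideal_power R I t) R"
  by (induction t) (auto intro: ideal_prod_is_ideal assms oneideal)

lemma (in ring) ideal_power_Suc_subset:
  assumes "ideal I R"
  shows "ideal_power R I (Suc t) \<subseteq> ideal_power R I t"
  using ideal_prod_inter[OF assms ideal_power_ideal[OF assms, of t]] by simp

lemma (in ring) set_addI: "\<lbrakk>x \<in> A; y \<in> B\<rbrakk> \<Longrightarrow> x \<oplus> y \<in> A <+> B"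
  by (auto simp: set_add_def')

lemma (in ring) set_addE:
  assumes "z \<in> A <+> B"
  obtains x y where "x \<in> A" "y \<in> B" "z = x \<oplus> y"
  using assms by (auto simp: set_add_def')

lemma (in ring) set_add_subset_ideal:
  assumes "ideal I R" "A \<subseteq> I" "B \<subseteq> I"
  shows "A <+> B \<subseteq> I"
proof -
  interpret ideal I R by fact
  show ?thesis using assms by (auto elim!: set_addE)
qed

lemma (in cring) Idl_insert:
  assumes "a \<in> carrier R" "A \<subseteq> carrier R" "x \<in> Idl (insert a A)"
  obtains w r where "w \<in> Idl A" "r \<in> carrier R" "x = w \<oplus> r \<otimes> a"
proof -
  have iA: "ideal (Idl A) R" and ia: "ideal (PIdl a) R"
    using genideal_ideal[OF assms(2)] cgenideal_ideal[OF assms(1)] by auto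
  interpret A: ideal "Idl A" R by (rule iA)
  interpret a: ideal "PIdl a" R by (rule ia)
  have "insert a A \<subseteq> Idl A <+> PIdl a"
  proof -
    have "a \<in> Idl A <+> PIdl a"
      using set_addI[OF A.zero_closed cgenideal_self[OF assms(1)]] assms(1) by simp
    moreover have "y \<in> Idl A <+> PIdl a" if "y \<in> A" for y
    proof -
      have "y \<in> Idl A" using genideal_self[OF assms(2)] that by blast
      then show ?thesis using set_addI[OF _ a.zero_closed, of y "Idl A"] A.Icarr by simp
    qed
    ultimately show ?thesis by auto
  qed
  then have "Idl (insert a A) \<subseteq> Idl A <+> PIdl a"
    by (intro genideal_minimal add_ideals iA ia)
  then have "x \<in> Idl A <+> PIdl a" using assms(3) by blast
  then obtain w y where w: "w \<in> Idl A" "y \<in> PIdl a" "x = w \<oplus> y" by (rule set_addE)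
  obtain r where r: "r \<in> carrier R" "y = r \<otimes> a" using w(2) unfolding cgenideal_def by auto
  show thesis by (rule that[OF w(1) r(1)]) (simp add: w(3) r(2))
qed

locale nilpotent_local_ring = local_ring R m for R (structure) and m +
  fixes l :: nat
  assumes nilpotent: "ideal_power R m l = {\<zero>}" and m_nonzero: "m \<noteq> {\<zero>}"
begin

lemma one_not_zero: "\<one> \<noteq> \<zero>"
proof
  assume "\<one> = \<zero>"
  then have "carrier R = {\<zero>}" using one_zeroD by blast
  then show False using I_notcarr a_subset zero_closed by auto
qed

text \<open>Iteration gives \<open>I \<subseteq> K + m^t I\<close> for every \<open>t\<close>, and a
  power of \<open>m\<close> is zero. Nilpotency makes this valid before \<open>I\<close> is known to
  be finitely generated, which is how finite generation can be derived from it.\<close>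

lemma nakayama:
  assumes "ideal K R" "ideal I R" "I \<subseteq> K <+> (m \<cdot> I)"
  shows "I \<subseteq> K"
proof -
  have mI: "ideal m R" by (rule is_ideal)
  let ?p = "ideal_power R m"
  have p: "ideal (?p t) R" for t by (rule ideal_power_ideal[OF mI])
  interpret K: ideal K R by fact
  have "I \<subseteq> K <+> (?p t \<cdot> I)" for t
  proof (induction t)
    case 0
    have "ideal_prod R (carrier R) I = I" using ideal_prod_one[OF assms(2)] ideal_prod_commute[OF oneideal assms(2)] by simp
    moreover have "x \<in> K <+> I" if "x \<in> I" for x
      using set_addI[OF K.zero_closed that] ideal.Icarr[OF assms(2) that] by simp
    ultimately show ?case by auto
  next
    case (Suc t)
    have "?p t \<cdot> I \<subseteq> ?p t \<cdot> (K <+> (m \<cdot> I))" by (rule ideal_prod_mono[OF assms(3)])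
    also have "\<dots> = (?p t \<cdot> K) <+> (?p t \<cdot> (m \<cdot> I))"
      by (rule ideal_prod_r_distr[OF p assms(1) ideal_prod_is_ideal[OF mI assms(2)]])
    also have "?p t \<cdot> (m \<cdot> I) = ?p (Suc t) \<cdot> I"
      using ideal_prod_assoc[OF p mI assms(2)] ideal_prod_commute[OF p mI] by simp
    also have "(?p t \<cdot> K) <+> (?p (Suc t) \<cdot> I) \<subseteq> K <+> (?p (Suc t) \<cdot> I)"
      using ideal_prod_inter[OF p assms(1), of t] by (auto simp: set_add_def')
    finally have "?p t \<cdot> I \<subseteq> K <+> (?p (Suc t) \<cdot> I)" .
    moreover have "ideal (K <+> (?p (Suc t) \<cdot> I)) R"
      by (rule add_ideals[OF assms(1) ideal_prod_is_ideal[OF p assms(2)]])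
    moreover have "K \<subseteq> K <+> (?p (Suc t) \<cdot> I)"
    proof
      fix x assume x: "x \<in> K"
      have "\<zero> \<in> ?p (Suc t) \<cdot> I"
        using additive_subgroup.zero_closed[OF ideal.axioms(1)[OF ideal_prod_is_ideal[OF p assms(2)]]] .
      from set_addI[OF x this] show "x \<in> K <+> (?p (Suc t) \<cdot> I)" using x K.Icarr by simp
    qed
    ultimately have "K <+> (?p t \<cdot> I) \<subseteq> K <+> (?p (Suc t) \<cdot> I)" using set_add_subset_ideal by blast
    with Suc show ?case by blast
  qed
  from this[of l] have "I \<subseteq> K <+> ({\<zero>} \<cdot> I)" by (simp add: nilpotent)
  also have "{\<zero>} \<cdot> I = {\<zero>}"
    using ideal_prod_zero[OF assms(2)] ideal_prod_commute[OF zeroideal assms(2)] by simp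
  also have "K <+> {\<zero>} \<subseteq> K" using K.Icarr by (auto elim!: set_addE)
  finally show ?thesis .
qed

text \<open>Maximality gives \<open>(a) + m = R\<close>, and Nakayama's lemma for the ideal
  \<open>R\<close> itself removes \<open>m\<close>.\<close>

lemma Units_if_notin_m:
  assumes "a \<in> carrier R" "a \<notin> m"
  shows "a \<in> Units R"
proof -
  have iP: "ideal (PIdl a) R" using cgenideal_ideal[OF assms(1)] .
  interpret P: ideal "PIdl a" R by (rule iP)
  have i: "ideal (PIdl a <+> m) R" by (rule add_ideals[OF iP is_ideal])
  have sub: "m \<subseteq> PIdl a <+> m"
  proof
    fix x assume "x \<in> m"
    then show "x \<in> PIdl a <+> m" using set_addI[OF P.zero_closed, of x m] a_subset by auto
  qed
  have "a \<in> PIdl a <+> m"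
    using set_addI[OF cgenideal_self[OF assms(1)] zero_closed] assms(1) by simp
  then have "PIdl a <+> m = carrier R"
    using I_maximal[OF i sub] ideal.Icarr[OF i] assms(2) by blast
  moreover have "m \<cdot> carrier R = m" by (rule ideal_prod_one[OF is_ideal])
  ultimately have "carrier R \<subseteq> PIdl a"
    by (intro nakayama[OF iP oneideal]) simp
  then obtain r where "r \<in> carrier R" "r \<otimes> a = \<one>" unfolding cgenideal_def by (smt (verit) mem_Collect_eq one_closed subsetD)
  then show ?thesis unfolding Units_def using assms(1) m_comm[of r a] by auto
qed

text \<open>Any nonzero element of the last nonzero power of \<open>m\<close> will do. It shows
  later that the minimal resolution never stops.\<close>

lemma socle_element:
  obtains s where "s \<in> carrier R" "s \<noteq> \<zero>" "\<And>a. a \<in> m \<Longrightarrow> a \<otimes> s = \<zero>"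
proof -
  let ?p = "ideal_power R m"
  define t where "t = (LEAST t. ?p t = {\<zero>})"
  have t: "?p t = {\<zero>}" unfolding t_def by (rule LeastI[of _ l]) (rule nilpotent)
  have "t \<noteq> 0"
    using t one_not_zero by (metis ideal_power.simps(1) one_closed singletonD)
  then obtain u where u: "t = Suc u" by (cases t) auto
  have "?p u \<noteq> {\<zero>}" using not_less_Least[of u "\<lambda>t. ?p t = {\<zero>}"] u unfolding t_def[symmetric] by simp
  moreover have "\<zero> \<in> ?p u" 
    using additive_subgroup.zero_closed[OF ideal.axioms(1)[OF ideal_power_ideal[OF is_ideal]]] .
  ultimately obtain s where s: "s \<in> ?p u" "s \<noteq> \<zero>" by blast
  have "a \<otimes> s = \<zero>" if "a \<in> m" for a
    using ideal_prod.prod[OF that s(1), of R] t u by simp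
  then show thesis using that[of s] s ideal.Icarr[OF ideal_power_ideal[OF is_ideal] s(1)] by blast
qed

end

text \<open>The chain condition makes \<open>I / m I\<close> finite dimensional: for an infinite
  sequence independent modulo \<open>m I\<close>, the spans of the tails would descend forever.
  Nakayama's lemma lifts generators of \<open>I / m I\<close> to generators of
  \<open>I\<close>.\<close>

lemma nilpotent_local_ring_fin_gen_ideal:
  fixes R (structure)
  assumes "nilpotent_local_ring R m l" "artinian_ring R" "ideal I R"
  obtains A where "finite A" "A \<subseteq> I" "I = Idl A"
proof -
  interpret nilpotent_local_ring R m l by fact
  interpret artinian_ring R by fact
  interpret I: ideal I R by fact
  have mi: "ideal (m \<cdot> I) R" by (rule ideal_prod_is_ideal[OF is_ideal assms(3)])
  have mI: "m \<cdot> I \<subseteq> I" using ideal_prod_inter[OF is_ideal assms(3)] by simp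
  \<comment> \<open>For \<open>A\<close> inside \<open>I\<close> this is the preimage of the span of
    \<open>A\<close> in the vector space \<open>I / m I\<close>.\<close>
  define W where "W A = Idl (A \<union> (m \<cdot> I))" for A
  have Wsub: "A \<union> (m \<cdot> I) \<subseteq> carrier R" if "A \<subseteq> I" for A using that mI I.a_subset by blast
  have Wi: "ideal (W A) R" if "A \<subseteq> I" for A unfolding W_def by (rule genideal_ideal[OF Wsub[OF that]])
  have Wself: "A \<subseteq> W A" "m \<cdot> I \<subseteq> W A" if "A \<subseteq> I" for A
    using genideal_self[OF Wsub[OF that]] unfolding W_def by auto
  have Wmono: "W A \<subseteq> W B" if "A \<subseteq> B" "B \<subseteq> I" for A B
    unfolding W_def using that by (intro subset_Idl_subset Wsub) auto
  have Wins: "\<exists>w\<in>W A. \<exists>r\<in>carrier R. x = w \<oplus> r \<otimes> a"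
    if a: "a \<in> I" and A: "A \<subseteq> I" and x: "x \<in> W (insert a A)" for a A x
  proof -
    have "x \<in> Idl (insert a (A \<union> (m \<cdot> I)))" using x unfolding W_def by simp
    then obtain w r where "w \<in> Idl (A \<union> (m \<cdot> I))" "r \<in> carrier R" "x = w \<oplus> r \<otimes> a"
      by (rule Idl_insert[OF I.Icarr[OF a] Wsub[OF A]])
    then show ?thesis unfolding W_def by blast
  qed
  have "\<exists>A. finite A \<and> A \<subseteq> I \<and> I \<subseteq> W A"
  proof (rule ccontr)
    assume "\<not> ?thesis"
    then have "\<exists>x. x \<in> I - W A" if "finite A" "A \<subseteq> I" for A using that by blast
    then obtain f where f: "\<And>A. \<lbrakk>finite A; A \<subseteq> I\<rbrakk> \<Longrightarrow> f A \<in> I - W A" by metis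
    \<comment> \<open>The recursion collects the terms chosen so far; \<open>f\<close> always picks
      a term outside their span.\<close>
    define S where "S = rec_nat {} (\<lambda>_ A. insert (f A) A)"
    have S: "S 0 = {}" "\<And>k. S (Suc k) = insert (f (S k)) (S k)" by (simp_all add: S_def)
    define x where "x k = f (S k)" for k
    have Sx: "S k = x ` {..<k}" for k
      by (induction k) (auto simp: S x_def lessThan_Suc)
    have Sf: "finite (S k) \<and> S k \<subseteq> I" for k
    proof (induction k)
      case 0
      then show ?case by (simp add: S)
    next
      case (Suc k)
      then show ?case using f[of "S k"] by (simp add: S)
    qed
    have x: "x k \<in> I" "x k \<notin> W (x ` {..<k})" for k
      using f[of "S k"] Sf[of k] unfolding x_def[symmetric] Sx[symmetric] by (auto simp: Sx)
    have xI: "x ` T \<subseteq> I" for T using x by auto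
    have Wx: "W (x ` S) \<subseteq> W (x ` T)" if "S \<subseteq> T" for S T
      using that by (intro Wmono xI image_mono)
    \<comment> \<open>The spans of the tails stabilise, so some \<open>x N\<close> lies in the span
      of the terms after it.\<close>
    have "\<exists>N. \<forall>i\<ge>N. W (x ` {i..}) = W (x ` {N..})"
    proof (rule dcc)
      show "ideal (W (x ` {i..})) R" for i by (rule Wi[OF xI])
      show "antimono (\<lambda>i. W (x ` {i..}))" by (intro antimonoI Wx) auto
    qed
    then obtain N where "W (x ` {Suc N..}) = W (x ` {N..})" by (meson le_SucI order_refl)
    then have xN: "x N \<in> W (x ` {Suc N..})" using Wself(1)[OF xI, of "{N..}"] by auto
    \<comment> \<open>A combination of the tail uses finitely many terms: the union of the
      increasing spans of finite segments is an ideal and hence contains the span of the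
      tail.\<close>
    let ?C = "(\<lambda>M. W (x ` {Suc N..<M})) ` UNIV"
    have "ideal (if ?C = {} then {\<zero>} else \<Union>?C) R"
    proof (rule chain_Union_is_ideal)
      show "subset.chain {I. ideal I R} ?C"
      proof (rule subset_chain_def[THEN iffD2], intro conjI ballI)
        show "?C \<subseteq> {I. ideal I R}" using Wi[OF xI] by auto
        fix U V assume "U \<in> ?C" "V \<in> ?C"
        then obtain a b where ab: "U = W (x ` {Suc N..<a})" "V = W (x ` {Suc N..<b})" by auto
        show "U \<subseteq> V \<or> V \<subseteq> U"
          unfolding ab using nat_le_linear[of a b]
          by (metis Wx atLeastLessThan_subset_iff ivl_subset order_refl)
      qed
    qed
    then have iU: "ideal (\<Union>?C) R" by simp
    have "W (x ` {Suc N..}) \<subseteq> \<Union>?C"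
      unfolding W_def[of "x ` {Suc N..}"]
    proof (rule genideal_minimal[OF iU], rule Un_least)
      show "m \<cdot> I \<subseteq> \<Union>?C" using Wself(2)[OF xI] by blast
      show "x ` {Suc N..} \<subseteq> \<Union>?C"
      proof (rule image_subsetI)
        fix i assume "i \<in> {Suc N..}"
        then have "x i \<in> W (x ` {Suc N..<Suc i})" using Wself(1)[OF xI, of "{Suc N..<Suc i}"] by auto
        then show "x i \<in> \<Union>?C" by blast
      qed
    qed
    then have ex: "\<exists>M. x N \<in> W (x ` {Suc N..<M})" using xN by blast
    \<comment> \<open>In the shortest segment the last term \<open>x K\<close> is indispensable. A
      coefficient in \<open>m\<close> would make it redundant modulo \<open>m I\<close>; a unit
      coefficient would put \<open>x K\<close> into the span of its predecessors, among which is
      \<open>x N\<close>.\<close>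
    define M where "M = (LEAST M. x N \<in> W (x ` {Suc N..<M}))"
    have M: "x N \<in> W (x ` {Suc N..<M})" unfolding M_def by (rule LeastI_ex[OF ex])
    have Mmin: "x N \<notin> W (x ` {Suc N..<M'})" if "M' < M" for M'
      using not_less_Least that unfolding M_def by blast
    show False
    proof (cases "M \<le> Suc N")
      case True
      then have "x N \<in> W {}" using M by simp
      then show False using x(2)[of N] Wx[of "{}" "{..<N}"] by auto
    next
      case False
      then obtain K where K: "M = Suc K" "Suc N \<le> K" by (cases M) auto
      have "x N \<in> W (insert (x K) (x ` {Suc N..<K}))"
        using M K atLeastLessThanSuc[of "Suc N" K] by simp
      then obtain w r where w: "w \<in> W (x ` {Suc N..<K})" "r \<in> carrier R" "x N = w \<oplus> r \<otimes> x K"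
        using Wins[OF x(1) xI] by blast
      have wc: "w \<in> carrier R" using ideal.Icarr[OF Wi[OF xI] w(1)] .
      have xc: "x j \<in> carrier R" for j using x(1) I.Icarr by blast
      show False
      proof (cases "r \<in> m")
        case True
        then have "r \<otimes> x K \<in> W (x ` {Suc N..<K})"
          using ideal_prod.prod[OF True x(1), of R K] Wself(2)[OF xI] by blast
        then have "x N \<in> W (x ` {Suc N..<K})"
          unfolding w(3) using w(1) additive_subgroup.a_closed[OF ideal.axioms(1)[OF Wi[OF xI]]] by blast
        then show False using Mmin[of K] K by simp
      next
        case False
        then have u: "r \<in> Units R" using Units_if_notin_m w(2) by blast
        interpret W: ideal "W (x ` {..<K})" R by (rule Wi[OF xI])
        have "W (x ` {Suc N..<K}) \<subseteq> W (x ` {..<K})" by (rule Wx) auto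
        then have "w \<in> W (x ` {..<K})" "x N \<in> W (x ` {..<K})"
          using w(1) Wself(1)[OF xI, of "{..<K}"] K by auto
        then have "inv r \<otimes> (x N \<ominus> w) \<in> W (x ` {..<K})"
          using u unfolding a_minus_def by (intro W.I_l_closed W.a_closed W.a_inv_closed) auto
        moreover have "x N \<ominus> w = r \<otimes> x K"
          unfolding w(3) a_minus_def using wc w(2) xc by (simp add: a_comm[of w] a_assoc r_neg)
        then have "inv r \<otimes> (x N \<ominus> w) = x K" using u xc by (metis Units_closed Units_inv_closed Units_l_inv l_one m_assoc)
        ultimately show False using x(2)[of K] by simp
      qed
    qed
  qed
  then obtain A where A: "finite A" "A \<subseteq> I" "I \<subseteq> W A" by blast
  have Ac: "A \<subseteq> carrier R" using A(2) I.a_subset by blast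
  have iA: "ideal (Idl A) R" by (rule genideal_ideal[OF Ac])
  have "W A \<subseteq> Idl A <+> (m \<cdot> I)"
    unfolding W_def
  proof (rule genideal_minimal[OF add_ideals[OF iA mi]], rule Un_least)
    show "A \<subseteq> Idl A <+> (m \<cdot> I)"
    proof
      fix a assume "a \<in> A"
      then have "a \<in> Idl A" "a \<in> carrier R" using genideal_self[OF Ac] Ac by auto
      moreover have "\<zero> \<in> m \<cdot> I" by (rule additive_subgroup.zero_closed[OF ideal.axioms(1)[OF mi]])
      ultimately show "a \<in> Idl A <+> (m \<cdot> I)" by (metis set_addI l_zero r_zero)
    qed
    show "m \<cdot> I \<subseteq> Idl A <+> (m \<cdot> I)"
    proof
      fix a assume "a \<in> m \<cdot> I"
      moreover from this have "a \<in> carrier R" by (rule ideal.Icarr[OF mi])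
      moreover have "\<zero> \<in> Idl A" by (rule additive_subgroup.zero_closed[OF ideal.axioms(1)[OF iA]])
      ultimately show "a \<in> Idl A <+> (m \<cdot> I)" by (metis set_addI l_zero r_zero)
    qed
  qed
  with A(3) have "I \<subseteq> Idl A" by (intro nakayama[OF iA assms(3)]) blast
  moreover have "Idl A \<subseteq> I" by (rule genideal_minimal[OF assms(3) A(2)])
  ultimately show thesis using A(1,2) that by blast
qed

section \<open>Finite generation and minimal presentation of submodules of finite free
  modules\<close>

lemma (in module) submodule_zero:
  assumes "submodule W R M"
  shows "\<zero>\<^bsub>M\<^esub> \<in> W"
  using subgroup.one_closed[OF submodule.axioms(1)[OF assms]] by simp

lemma (in module) submodule_Int:
  assumes "submodule P R M" "submodule Q R M"
  shows "submodule (P \<inter> Q) R M"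
proof -
  note P = submoduleE[OF assms(1)] and Q = submoduleE[OF assms(2)]
  show ?thesis
  proof (rule submoduleI)
    show "P \<inter> Q \<subseteq> carrier M" using P(1) by auto
    show "\<zero>\<^bsub>M\<^esub> \<in> P \<inter> Q" using assms by (simp add: submodule_zero)
  qed (use P Q in simp_all)
qed

lemma (in module) submodule_preimage:
  assumes "module R N" "f \<in> module_hom R N M" "submodule W R M"
  shows "submodule {x \<in> carrier N. f x \<in> W} R N"
proof -
  interpret N: module R N by fact
  note f = module_homD[OF assms(2)]
  note W = submoduleE[OF assms(3)]
  have "\<zero>\<^bsub>M\<^esub> \<in> W" by (rule submodule_zero[OF assms(3)])
  then show ?thesis
    using W by (intro N.submoduleI) (auto simp: f module_hom_zero[OF assms(1) module_axioms assms(2)]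
      module_hom_minus[OF assms(1) module_axioms assms(2)])
qed

lemma (in module) submodule_image:
  assumes "module R N" "f \<in> module_hom R N M"
  shows "submodule (f ` carrier N) R M"
proof -
  interpret N: module R N by fact
  note f = module_homD[OF assms(2)]
  show ?thesis
  proof (rule submoduleI)
    show "\<zero>\<^bsub>M\<^esub> \<in> f ` carrier N"
      using module_hom_zero[OF assms(1) module_axioms assms(2)] by (metis N.M.zero_closed imageI)
    show "\<ominus>\<^bsub>M\<^esub> y \<in> f ` carrier N" if y: "y \<in> f ` carrier N" for y
    proof -
      obtain x where "x \<in> carrier N" "y = f x" using y by blast
      then show ?thesis
        using module_hom_minus[OF assms(1) module_axioms assms(2)] by (metis N.M.a_inv_closed imageI)
    qed
    show "y \<oplus>\<^bsub>M\<^esub> z \<in> f ` carrier N" if "y \<in> f ` carrier N" "z \<in> f ` carrier N" for y z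
      using that f(2) by (smt (verit) N.M.a_closed image_iff)
    show "a \<odot>\<^bsub>M\<^esub> z \<in> f ` carrier N" if "a \<in> carrier R" "z \<in> f ` carrier N" for a z
      using that f(3) by (smt (verit) N.smult_closed image_iff)
  qed (use f in auto)
qed

lemma (in cring) vec_in_submodule:
  assumes "finite S" "x \<in> carrier (vec_module R S)" "submodule W R (vec_module R S)"
    and "\<And>k. k \<in> S \<Longrightarrow> x k = \<zero> \<or> unit_vec R k \<in> W"
  shows "x \<in> W"
proof -
  interpret V: module R "vec_module R S" by (rule vec_module)
  note W = V.submoduleE[OF assms(3)]
  have z: "\<zero>\<^bsub>vec_module R S\<^esub> \<in> W" by (rule V.submodule_zero[OF assms(3)])
  have *: "(\<Oplus>\<^bsub>vec_module R S\<^esub> k\<in>A. x k \<odot>\<^bsub>vec_module R S\<^esub> unit_vec R k) \<in> W" if "finite A" "A \<subseteq> S" for A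
    using that
  proof (induction A rule: finite_induct)
    case empty
    then show ?case using z by (metis V.M.finsum_empty)
  next
    case (insert a A)
    have xc: "x k \<in> carrier R" for k using assms(2) by (simp add: vec_module_carrier)
    have eq: "(\<Oplus>\<^bsub>vec_module R S\<^esub> k\<in>insert a A. x k \<odot>\<^bsub>vec_module R S\<^esub> unit_vec R k)
       = x a \<odot>\<^bsub>vec_module R S\<^esub> unit_vec R a \<oplus>\<^bsub>vec_module R S\<^esub> (\<Oplus>\<^bsub>vec_module R S\<^esub> k\<in>A. x k \<odot>\<^bsub>vec_module R S\<^esub> unit_vec R k)"
      using insert assms(2) unit_vec_closed
      by (intro V.M.finsum_insert Pi_I V.smult_closed) (auto simp: vec_module_carrier)
    have "x a \<odot>\<^bsub>vec_module R S\<^esub> unit_vec R a \<in> W"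
    proof (cases "x a = \<zero>")
      case True
      then have "x a \<odot>\<^bsub>vec_module R S\<^esub> unit_vec R a = \<zero>\<^bsub>vec_module R S\<^esub>"
        using insert unit_vec_closed[of a S] V.smult_l_null by (metis insert_subset)
      then show ?thesis using z by simp
    next
      case False
      then show ?thesis using W(4)[OF xc] assms(4) insert by auto
    qed
    moreover have "(\<Oplus>\<^bsub>vec_module R S\<^esub> k\<in>A. x k \<odot>\<^bsub>vec_module R S\<^esub> unit_vec R k) \<in> W"
      using insert by auto
    ultimately show ?case unfolding eq by (rule W(5))
  qed
  show ?thesis
    by (subst vec_expansion[OF assms(1,2)], rule *[OF assms(1)]) simp
qed

lemma (in cring) vec_module_submodule: "submodule (carrier (vec_module R S)) R (vec_module R UNIV)"
proof -
  interpret V: module R "vec_module R UNIV" by (rule vec_module)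
  show ?thesis
    by (rule V.submoduleI) (auto simp: vec_module_carrier vec_module_uminus)
qed

text \<open>Induction on the rank: the last coordinates of \<open>Z\<close> form a finitely
  generated ideal, whose generators are lifted to \<open>Z\<close>, and the elements with last
  coordinate zero fall under the induction hypothesis. Generation is phrased through the submodules
  that contain \<open>Y\<close>, which avoids linear combinations.\<close>

lemma vec_submodule_fin_gen:
  fixes R (structure)
  assumes "nilpotent_local_ring R m l" "artinian_ring R"
    and "submodule Z R (vec_module R UNIV)" "Z \<subseteq> carrier (vec_module R {..<r})"
  shows "\<exists>Y. finite Y \<and> Y \<subseteq> Z \<and> (\<forall>W. submodule W R (vec_module R UNIV) \<longrightarrow> Y \<subseteq> W \<longrightarrow> Z \<subseteq> W)"
  using assms(3,4)
proof (induction r arbitrary: Z)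
  interpret nilpotent_local_ring R m l by fact
  interpret V: module R "vec_module R UNIV" by (rule vec_module)
  {
    case 0
    have "Z \<subseteq> {\<zero>\<^bsub>vec_module R UNIV\<^esub>}" using 0(2) by (auto simp: vec_module_carrier subset_iff fun_eq_iff)
    moreover have "\<zero>\<^bsub>vec_module R UNIV\<^esub> \<in> W" if "submodule W R (vec_module R UNIV)" for W
      by (rule V.submodule_zero[OF that])
    ultimately have "\<forall>W. submodule W R (vec_module R UNIV) \<longrightarrow> {} \<subseteq> W \<longrightarrow> Z \<subseteq> W" by blast
    then show ?case by blast
  next
    case (Suc r)
    note Z = V.submoduleE[OF Suc.prems(1)]
    have ci: "ideal ((\<lambda>x. x r) ` Q) R" if "submodule Q R (vec_module R UNIV)" for Q
    proof -
      note Q = V.submoduleE[OF that]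
      have Qc: "x k \<in> carrier R" if "x \<in> Q" for x k using Q(1) that by (auto simp: vec_module_carrier)
      have neg: "(\<lambda>k. \<ominus> x k) \<in> Q" if "x \<in> Q" for x
        using Q(3)[OF that] Q(1) that by (auto simp: vec_module_uminus)
      show ?thesis
      proof (rule idealI[OF ring_axioms])
        show "subgroup ((\<lambda>x. x r) ` Q) (add_monoid R)"
        proof (rule add.subgroupI)
          show "(\<lambda>x. x r) ` Q \<subseteq> carrier R" using Qc by auto
          show "(\<lambda>x. x r) ` Q \<noteq> {}" using Q(2) by auto
          show "\<ominus> a \<in> (\<lambda>x. x r) ` Q" if "a \<in> (\<lambda>x. x r) ` Q" for a
          proof -
            from that obtain x where x: "x \<in> Q" "a = x r" by blast
            show ?thesis unfolding x(2) by (rule image_eqI[OF _ neg[OF x(1)]]) simp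
          qed
          show "a \<oplus> b \<in> (\<lambda>x. x r) ` Q" if "a \<in> (\<lambda>x. x r) ` Q" "b \<in> (\<lambda>x. x r) ` Q" for a b
          proof -
            from that obtain x y where x: "x \<in> Q" "a = x r" "y \<in> Q" "b = y r" by blast
            show ?thesis unfolding x(2,4) by (rule image_eqI[OF _ Q(5)[OF x(1,3)]]) simp
          qed
        qed
      next
        fix a c assume "a \<in> (\<lambda>x. x r) ` Q" and c: "c \<in> carrier R"
        then obtain x where x: "x \<in> Q" "a = x r" by blast
        show "c \<otimes> a \<in> (\<lambda>x. x r) ` Q" unfolding x(2) by (rule image_eqI[OF _ Q(4)[OF c x(1)]]) simp
        then show "a \<otimes> c \<in> (\<lambda>x. x r) ` Q" using c Qc[OF x(1)] x(2) m_comm by auto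
      qed
    qed
    obtain A where A: "finite A" "A \<subseteq> (\<lambda>x. x r) ` Z" "(\<lambda>x. x r) ` Z = Idl A"
      by (rule nilpotent_local_ring_fin_gen_ideal[OF assms(1,2) ci[OF Suc.prems(1)]])
    have "\<forall>a\<in>A. \<exists>x. x \<in> Z \<and> x r = a" using A(2) by blast
    from bchoice[OF this] obtain z where z: "\<And>a. a \<in> A \<Longrightarrow> z a \<in> Z" "\<And>a. a \<in> A \<Longrightarrow> z a r = a"
      by blast
    let ?Z = "Z \<inter> carrier (vec_module R {..<r})"
    obtain Y where Y: "finite Y" "Y \<subseteq> ?Z"
      "\<And>W. \<lbrakk>submodule W R (vec_module R UNIV); Y \<subseteq> W\<rbrakk> \<Longrightarrow> ?Z \<subseteq> W"
      using Suc.IH[OF V.submodule_Int[OF Suc.prems(1) vec_module_submodule[of "{..<r}"]] Int_lower2] by blast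
    have "Z \<subseteq> W" if W: "submodule W R (vec_module R UNIV)" and sub: "Y \<union> z ` A \<subseteq> W" for W
    proof
      fix x assume x: "x \<in> Z"
      note W' = V.submoduleE[OF W]
      \<comment> \<open>Working in \<open>W \<inter> Z\<close> instead of \<open>W\<close> yields a
        \<open>w\<close> with the last coordinate of \<open>x\<close> that also lies in
        \<open>Z\<close>, so that \<open>x - w\<close> is covered by the induction
        hypothesis.\<close>
      have "A \<subseteq> (\<lambda>x. x r) ` (W \<inter> Z)"
      proof
        fix a assume a: "a \<in> A"
        then have "z a \<in> W \<inter> Z" using sub z by auto
        then show "a \<in> (\<lambda>x. x r) ` (W \<inter> Z)" by (rule image_eqI[rotated]) (simp add: z(2)[OF a])
      qed
      then have "Idl A \<subseteq> (\<lambda>x. x r) ` (W \<inter> Z)"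
        by (intro genideal_minimal ci V.submodule_Int W Suc.prems(1))
      moreover have "x r \<in> Idl A" unfolding A(3)[symmetric] using x by (rule imageI)
      ultimately have "x r \<in> (\<lambda>x. x r) ` (W \<inter> Z)" by (rule subsetD)
      then obtain w where w: "w \<in> W" "w \<in> Z" "w r = x r" by auto
      have xc: "x \<in> carrier (vec_module R UNIV)" and wc: "w \<in> carrier (vec_module R UNIV)"
        using Z(1) x w(2) by auto
      define y where "y = x \<oplus>\<^bsub>vec_module R UNIV\<^esub> (\<ominus>\<^bsub>vec_module R UNIV\<^esub> w)"
      have yZ: "y \<in> Z" unfolding y_def by (intro Z(3,5) x w(2))
      have y0: "y k = \<zero>" if "k \<ge> r" for k
      proof (cases "k = r")
        case True
        then show ?thesis using w(3) xc by (simp add: y_def vec_module_uminus[OF wc] vec_module_carrier r_neg)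
      next
        case False
        then have "x k = \<zero>" "w k = \<zero>" using Suc.prems(2) x w(2) that by (auto simp: vec_module_carrier)
        then show ?thesis by (simp add: y_def vec_module_uminus[OF wc])
      qed
      have "y \<in> carrier (vec_module R UNIV)" using yZ Z(1) by (rule subsetD[rotated])
      then have "y \<in> carrier (vec_module R {..<r})"
        using y0 by (simp add: vec_module_carrier)
      then have "y \<in> W" using Y(3)[OF W] yZ sub by blast
      then have "y \<oplus>\<^bsub>vec_module R UNIV\<^esub> w \<in> W" using W'(5) w(1) by blast
      also have "y \<oplus>\<^bsub>vec_module R UNIV\<^esub> w = x"
        unfolding y_def using xc wc by (simp only: V.M.a_assoc V.M.a_inv_closed V.M.l_neg V.M.r_zero)
      finally show "x \<in> W" .
    qed
    moreover have "finite (Y \<union> z ` A)" "Y \<union> z ` A \<subseteq> Z" using Y(1,2) A(1) z(1) by auto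
    ultimately show ?case by blast
  }
qed

text \<open>A generating set of least cardinality has no relation with a unit coefficient.\<close>

lemma minimal_presentation:
  fixes R (structure)
  assumes "nilpotent_local_ring R m l" "artinian_ring R"
    and Z: "submodule Z R (vec_module R UNIV)" "Z \<subseteq> carrier (vec_module R {..<r})"
  obtains p h where "h \<in> module_hom R (vec_module R {..<p}) (vec_module R {..<r})"
    "h ` carrier (vec_module R {..<p}) = Z"
    "\<And>x k. \<lbrakk>x \<in> carrier (vec_module R {..<p}); h x = \<zero>\<^bsub>vec_module R {..<r}\<^esub>\<rbrakk> \<Longrightarrow> x k \<in> m"
proof -
  interpret nilpotent_local_ring R m l by fact
  interpret V: module R "vec_module R UNIV" by (rule vec_module)
  let ?V = "vec_module R UNIV"
  define gen where "gen Y \<longleftrightarrow> finite Y \<and> Y \<subseteq> Z \<and> (\<forall>W. submodule W R ?V \<longrightarrow> Y \<subseteq> W \<longrightarrow> Z \<subseteq> W)" for Y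
  obtain Y0 where "gen Y0" using vec_submodule_fin_gen[OF assms] unfolding gen_def by blast
  then obtain Y where Y: "gen Y" and Ymin: "\<And>Y'. gen Y' \<Longrightarrow> card Y \<le> card Y'"
    using ex_has_least_nat[of gen Y0 card] by blast
  have fY: "finite Y" "Y \<subseteq> Z" and genY: "\<And>W. \<lbrakk>submodule W R ?V; Y \<subseteq> W\<rbrakk> \<Longrightarrow> Z \<subseteq> W"
    using Y by (auto simp: gen_def)
  define p where "p = card Y"
  obtain y where y: "bij_betw y {..<p} Y"
    using ex_bij_betw_nat_finite[OF fY(1)] unfolding p_def atLeast0LessThan by blast
  let ?P = "vec_module R {..<p}"
  let ?Z = "?V\<lparr>carrier := Z\<rparr>"
  have mZ: "module R ?Z" using submodule.submodule_is_module[OF Z(1) V.module_axioms] .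
  have "y \<in> {..<p} \<rightarrow> carrier ?Z" using y fY(2) by (auto simp: bij_betw_def)
  then obtain h where h: "h \<in> module_hom R ?P ?Z" "\<And>k. k \<in> {..<p} \<Longrightarrow> h (unit_vec R k) = y k"
    using vec_hom_extend[OF finite_lessThan one_not_zero mZ] by blast
  have hr: "h \<in> module_hom R ?P (vec_module R {..<r})"
    using module_homD[OF h(1)] Z(2) by (intro module_homI) auto
  have hV: "h \<in> module_hom R ?P ?V"
    using module_homD[OF h(1)] V.submoduleE(1)[OF Z(1)] by (intro module_homI) auto
  show thesis
  proof
    show "h \<in> module_hom R ?P (vec_module R {..<r})" by (rule hr)
    show "h ` carrier ?P = Z"
    proof
      show "h ` carrier ?P \<subseteq> Z" using module_hom_closed[OF h(1)] by auto
      have "Y \<subseteq> h ` carrier ?P"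
      proof
        fix b assume "b \<in> Y"
        then obtain k where "k \<in> {..<p}" "b = y k" using y by (auto simp: bij_betw_def)
        then show "b \<in> h ` carrier ?P" using h(2) unit_vec_closed by (metis imageI)
      qed
      then show "Z \<subseteq> h ` carrier ?P"
        by (intro genY V.submodule_image[OF vec_module hV])
    qed
    fix x j assume x: "x \<in> carrier ?P" and hx: "h x = \<zero>\<^bsub>vec_module R {..<r}\<^esub>"
    show "x j \<in> m"
    proof (rule ccontr)
      assume xj: "x j \<notin> m"
      then have j: "j \<in> {..<p}" using x zero_closed by (auto simp: vec_module_carrier)
      have u: "x j \<in> Units R" using Units_if_notin_m xj x by (simp add: vec_module_carrier)
      \<comment> \<open>The relation splits into \<open>?x\<close>, with the coefficient at
        \<open>j\<close> erased, and a unit multiple of \<open>y j\<close>. As \<open>h ?x\<close>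
        involves only the other generators, \<open>y j\<close> is redundant.\<close>
      have "gen (Y - {y j})"
        unfolding gen_def
      proof (intro conjI allI impI)
        fix W assume W: "submodule W R ?V" and sub: "Y - {y j} \<subseteq> W"
        let ?T = "{x \<in> carrier ?P. h x \<in> W}"
        let ?x = "x(j := \<zero>)"
        interpret P: module R ?P by (rule vec_module)
        have xP: "?x \<in> carrier ?P" using x by (auto simp: vec_module_carrier)
        have "?x \<in> ?T"
        proof (rule vec_in_submodule[OF finite_lessThan xP V.submodule_preimage[OF vec_module hV W]])
          fix k assume k: "k \<in> {..<p}"
          show "?x k = \<zero> \<or> unit_vec R k \<in> ?T"
          proof (cases "k = j")
            case False
            then have "y k \<in> Y - {y j}" using y k j by (auto simp: bij_betw_def inj_on_def)
            then show ?thesis using h(2)[OF k] sub unit_vec_closed[OF k] by auto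
          qed simp
        qed
        then have "h ?x \<in> W" by simp
        have ej: "unit_vec R j \<in> carrier ?P" by (rule unit_vec_closed[OF j])
        have xs: "x = ?x \<oplus>\<^bsub>?P\<^esub> x j \<odot>\<^bsub>?P\<^esub> unit_vec R j"
          using x by (auto simp: fun_eq_iff unit_vec_def vec_module_carrier)
        have hc: "h ?x \<in> carrier ?V" "y j \<in> carrier ?V"
          using module_hom_closed[OF hV xP] module_hom_closed[OF hV ej] h(2)[OF j] by auto
        have xjc: "x j \<in> carrier R" by (rule Units_closed[OF u])
        have "h x = h (?x \<oplus>\<^bsub>?P\<^esub> x j \<odot>\<^bsub>?P\<^esub> unit_vec R j)" by (rule arg_cong[OF xs])
        also have "\<dots> = h ?x \<oplus>\<^bsub>?V\<^esub> h (x j \<odot>\<^bsub>?P\<^esub> unit_vec R j)"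
          by (rule module_hom_add[OF hV xP P.smult_closed[OF xjc ej]])
        also have "h (x j \<odot>\<^bsub>?P\<^esub> unit_vec R j) = x j \<odot>\<^bsub>?V\<^esub> y j"
          using module_hom_smult[OF hV xjc ej] unfolding h(2)[OF j] .
        finally have "h x = h ?x \<oplus>\<^bsub>?V\<^esub> x j \<odot>\<^bsub>?V\<^esub> y j" .
        then have "x j \<odot>\<^bsub>?V\<^esub> y j \<oplus>\<^bsub>?V\<^esub> h ?x = \<zero>\<^bsub>?V\<^esub>"
          using hx hc xjc V.M.a_comm[OF hc(1) V.smult_closed[OF xjc hc(2)]] by simp
        then have "x j \<odot>\<^bsub>?V\<^esub> y j = \<ominus>\<^bsub>?V\<^esub> h ?x"
          using V.M.minus_equality[OF _ hc(1) V.smult_closed[OF xjc hc(2)]] by simp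
        then have xy: "x j \<odot>\<^bsub>?V\<^esub> y j \<in> W"
          using V.submoduleE(3)[OF W \<open>h ?x \<in> W\<close>] by simp
        have "inv (x j) \<odot>\<^bsub>?V\<^esub> (x j \<odot>\<^bsub>?V\<^esub> y j) = y j"
          using V.smult_assoc1[OF _ xjc hc(2), of "inv (x j)"] u V.smult_one[OF hc(2)] Units_l_inv[OF u] by simp
        then have "y j \<in> W" using V.submoduleE(4)[OF W _ xy] u by (metis Units_inv_closed)
        with sub have "Y \<subseteq> W" by blast
        then show "Z \<subseteq> W" by (rule genY[OF W])
      qed (use fY in auto)
      then have "card Y \<le> card (Y - {y j})" by (rule Ymin)
      moreover have "y j \<in> Y" using y j by (auto simp: bij_betw_def)
      ultimately show False using card_Diff1_less[OF fY(1)] by (meson not_le)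
    qed
  qed
qed

section \<open>The minimal free resolution of the residue field\<close>

lemma quotient_module_simps:
  "carrier (quotient_module R I) = carrier (R Quot I)"
  "x \<oplus>\<^bsub>quotient_module R I\<^esub> y = x \<oplus>\<^bsub>R Quot I\<^esub> y"
  "\<zero>\<^bsub>quotient_module R I\<^esub> = \<zero>\<^bsub>R Quot I\<^esub>"
  "a \<odot>\<^bsub>quotient_module R I\<^esub> x = (I +>\<^bsub>R\<^esub> a) \<otimes>\<^bsub>R Quot I\<^esub> x"
  by (simp_all add: quotient_module_def)

context cring
begin

lemma quotient_module_carrier:
  assumes "ideal I R"
  shows "carrier (quotient_module R I) = (\<lambda>x. I +> x) ` carrier R"
  unfolding quotient_module_simps FactRing_def A_RCOSETS_def' by auto

lemma quotient_module_coset: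
  assumes "ideal I R"
  shows "x \<in> carrier R \<Longrightarrow> I +> x \<in> carrier (quotient_module R I)"
    and "\<lbrakk>x \<in> carrier R; y \<in> carrier R\<rbrakk> \<Longrightarrow>
      (I +> x) \<oplus>\<^bsub>quotient_module R I\<^esub> (I +> y) = I +> (x \<oplus> y)"
    and "\<lbrakk>a \<in> carrier R; x \<in> carrier R\<rbrakk> \<Longrightarrow> a \<odot>\<^bsub>quotient_module R I\<^esub> (I +> x) = I +> (a \<otimes> x)"
    and "\<lbrakk>x \<in> carrier R\<rbrakk> \<Longrightarrow> I +> x = \<zero>\<^bsub>quotient_module R I\<^esub> \<longleftrightarrow> x \<in> I"
proof -
  interpret I: ideal I R by fact
  note h = I.rcos_ring_hom
  show "x \<in> carrier R \<Longrightarrow> I +> x \<in> carrier (quotient_module R I)"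
    using quotient_module_carrier[OF assms] by auto
  show "\<lbrakk>x \<in> carrier R; y \<in> carrier R\<rbrakk> \<Longrightarrow>
      (I +> x) \<oplus>\<^bsub>quotient_module R I\<^esub> (I +> y) = I +> (x \<oplus> y)"
    unfolding quotient_module_simps using ring_hom_add[OF h] by simp
  show "\<lbrakk>a \<in> carrier R; x \<in> carrier R\<rbrakk> \<Longrightarrow> a \<odot>\<^bsub>quotient_module R I\<^esub> (I +> x) = I +> (a \<otimes> x)"
    unfolding quotient_module_simps using ring_hom_mult[OF h] by simp
  show "\<lbrakk>x \<in> carrier R\<rbrakk> \<Longrightarrow> I +> x = \<zero>\<^bsub>quotient_module R I\<^esub> \<longleftrightarrow> x \<in> I"
    unfolding quotient_module_simps FactRing_def
    using I.a_rcos_self I.a_rcos_const by auto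
qed

lemma quotient_module:
  assumes "ideal I R"
  shows "module R (quotient_module R I)"
proof -
  interpret I: ideal I R by fact
  interpret Q: cring "R Quot I" by (rule I.quotient_is_cring[OF cring_axioms])
  let ?Q = "quotient_module R I"
  note q = quotient_module_coset[OF assms] and c = quotient_module_carrier[OF assms]
  have "abelian_group ?Q"
    by (rule abelian_groupI) (unfold quotient_module_simps, auto simp: Q.a_ac intro: Q.l_neg)
  then show ?thesis
    by (rule moduleI[OF cring_axioms]) (auto simp: c q l_distr r_distr m_assoc)
qed

end

text \<open>Each differential is a minimal presentation of the kernel of the preceding one, starting
  with \<open>m\<close> inside \<open>R\<close>. A minimal presentation has its kernel, the image of
  the next differential, in vectors with entries from \<open>m\<close>.\<close>

lemma minimal_free_resolution_exists:
  fixes R (structure)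
  assumes "nilpotent_local_ring R m l" "artinian_ring R"
  obtains r :: "nat \<Rightarrow> nat" and d and \<epsilon> where "r 0 = 1" "\<And>i. r i > 0"
    "d 0 ` carrier (vec_module R {..<r 1}) = {x \<in> carrier (vec_module R {..<r 0}). x 0 \<in> m}"
    "free_resolution R (quotient_module R m) (\<lambda>i. vec_module R {..<r i}) d \<epsilon>"
    "\<And>i x k. x \<in> carrier (vec_module R {..<r (Suc i)}) \<Longrightarrow> d i x k \<in> m"
proof -
  interpret nilpotent_local_ring R m l by fact
  let ?V = "vec_module R UNIV"
  let ?G = "\<lambda>r. vec_module R {..<r::nat}"
  interpret V: module R ?V by (rule vec_module)
  let ?Z = "{x \<in> carrier (?G 1). x 0 \<in> m}"
  have Z: "submodule ?Z R ?V"
    by (rule V.submoduleI) (auto simp: vec_module_carrier vec_module_uminus I_l_closed)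
  have ker: "submodule {x \<in> carrier (?G p). h x = \<zero>\<^bsub>?G q\<^esub>} R ?V" if h: "h \<in> module_hom R (?G p) (?G q)" for h p q
  proof -
    interpret P: module R "?G p" by (rule vec_module)
    interpret Q: module R "?G q" by (rule vec_module)
    have "submodule {x \<in> carrier (?G p). h x \<in> {\<zero>\<^bsub>?G q\<^esub>}} R (?G p)"
      by (rule Q.submodule_preimage[OF vec_module h]) (rule Q.submoduleI, auto simp: vec_module_carrier vec_module_uminus)
    note s = P.submoduleE[OF this]
    show ?thesis
    proof (rule V.submoduleI)
      fix a assume a: "a \<in> {x \<in> carrier (?G p). h x = \<zero>\<^bsub>?G q\<^esub>}"
      then have "a \<in> carrier ?V" by (auto simp: vec_module_carrier)
      then have "\<ominus>\<^bsub>?V\<^esub> a = \<ominus>\<^bsub>?G p\<^esub> a" using a vec_module_uminus by (metis (no_types, lifting) mem_Collect_eq)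
      then show "\<ominus>\<^bsub>?V\<^esub> a \<in> {x \<in> carrier (?G p). h x = \<zero>\<^bsub>?G q\<^esub>}" using s(3)[of a] a by simp
    next
      have "h \<zero>\<^bsub>?G p\<^esub> = \<zero>\<^bsub>?G q\<^esub>" by (rule module_hom_zero[OF vec_module vec_module h])
      then show "\<zero>\<^bsub>?V\<^esub> \<in> {x \<in> carrier (?G p). h x = \<zero>\<^bsub>?G q\<^esub>}" by (simp add: vec_module_carrier)
    qed (use s(4,5) in \<open>auto simp: vec_module_carrier\<close>)
  qed
  \<comment> \<open>A stage consists of the target rank, the source rank and the map. It remembers
    that the kernel has entries in \<open>m\<close>, because the bound on the entries of the next
    differential comes from there.\<close>
  define A where "A = (\<lambda>i (q, p, h). h \<in> module_hom R (?G p) (?G q) \<and>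
    (\<forall>x k. x \<in> carrier (?G p) \<longrightarrow> h x = \<zero>\<^bsub>?G q\<^esub> \<longrightarrow> x k \<in> m) \<and>
    (i = (0::nat) \<longrightarrow> q = (1::nat) \<and> h ` carrier (?G p) = ?Z))"
  define B where "B = (\<lambda>(i::nat) (q::nat, p, h) (q', p', h'). q' = p \<and>
     h' ` carrier (?G p') = {x \<in> carrier (?G p). h x = \<zero>\<^bsub>?G q\<^esub>})"
  have "\<exists>f. \<forall>i. A i (f i) \<and> B i (f i) (f (Suc i))"
  proof (rule dependent_nat_choice)
    obtain p h where "h \<in> module_hom R (?G p) (?G 1)" "h ` carrier (?G p) = ?Z"
      "\<And>x k. \<lbrakk>x \<in> carrier (?G p); h x = \<zero>\<^bsub>?G 1\<^esub>\<rbrakk> \<Longrightarrow> x k \<in> m"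
      by (rule minimal_presentation[OF assms Z, of 1]) auto
    then have "A 0 (1, p, h)" unfolding A_def by auto
    then show "\<exists>s. A 0 s" by blast
  next
    fix s i assume s: "A i s"
    obtain q p h where sq: "s = (q, p, h)" by (cases s)
    then have h: "h \<in> module_hom R (?G p) (?G q)" using s by (simp add: A_def)
    obtain p' h' where "h' \<in> module_hom R (?G p') (?G p)" "h' ` carrier (?G p') = {x \<in> carrier (?G p). h x = \<zero>\<^bsub>?G q\<^esub>}"
      "\<And>x k. \<lbrakk>x \<in> carrier (?G p'); h' x = \<zero>\<^bsub>?G p\<^esub>\<rbrakk> \<Longrightarrow> x k \<in> m"
      by (rule minimal_presentation[OF assms ker[OF h], of p]) auto
    then have "A (Suc i) (p, p', h') \<and> B i s (p, p', h')" unfolding A_def B_def sq by auto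
    then show "\<exists>s'. A (Suc i) s' \<and> B i s s'" by blast
  qed
  then obtain f where f: "\<And>i. A i (f i)" "\<And>i. B i (f i) (f (Suc i))" by blast
  define r where "r i = fst (f i)" for i
  define d where "d i = snd (snd (f i))" for i
  have fs: "f i = (r i, r (Suc i), d i)" for i
    using f(2)[of i] by (cases "f i", cases "f (Suc i)") (simp add: r_def d_def B_def)
  have d: "d i \<in> module_hom R (?G (r (Suc i))) (?G (r i))" for i
    using f(1)[of i] by (simp add: A_def fs)
  have kerm: "x k \<in> m" if "x \<in> carrier (?G (r (Suc i)))" "d i x = \<zero>\<^bsub>?G (r i)\<^esub>" for i x k
    using f(1)[of i] that by (simp add: A_def fs)
  have r0: "r 0 = 1" and d0: "d 0 ` carrier (?G (r (Suc 0))) = ?Z"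
    using f(1)[of 0] by (simp_all add: A_def fs)
  have dS: "d (Suc i) ` carrier (?G (r (Suc (Suc i)))) = {x \<in> carrier (?G (r (Suc i))). d i x = \<zero>\<^bsub>?G (r i)\<^esub>}" for i
    using f(2)[of i] by (simp add: B_def fs)
  have dm: "d i x k \<in> m" if x: "x \<in> carrier (?G (r (Suc i)))" for i x k
  proof (cases i)
    case 0
    then have "d i x \<in> ?Z" using d0 x by blast
    then show ?thesis by (cases "k = 0") (auto simp: vec_module_carrier)
  next
    case (Suc j)
    then have "d i x \<in> {x \<in> carrier (?G (r (Suc j))). d j x = \<zero>\<^bsub>?G (r j)\<^esub>}" using dS[of j] x by blast
    then show ?thesis using kerm by auto
  qed
  \<comment> \<open>Rank 0 in degree 1 would force \<open>m = 0\<close>. In a higher degree it would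
    make the preceding differential injective, but that one has entries in \<open>m\<close> and
    kills the socle multiples of a basis vector.\<close>
  have rpos: "r i > 0" for i
  proof (induction i)
    case 0
    then show ?case by (simp add: r0)
  next
    case (Suc i)
    show ?case
    proof (rule ccontr)
      assume "\<not> r (Suc i) > 0"
      then have triv: "x = \<zero>\<^bsub>?V\<^esub>" if "x \<in> carrier (?G (r (Suc i)))" for x
        using that by (auto simp: vec_module_carrier)
      have z: "d i x = \<zero>\<^bsub>?V\<^esub>" if "x \<in> carrier (?G (r (Suc i)))" for x
        using module_hom_zero[OF vec_module vec_module d, of i] triv[OF that] by simp
      show False
      proof (cases i)
        case 0
        obtain a where a: "a \<in> m" "a \<noteq> \<zero>" using m_nonzero zero_closed by blast
        have "(\<lambda>k. if k = 0 then a else \<zero>) \<in> ?Z" using a a_subset by (auto simp: vec_module_carrier)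
        then obtain x where x: "x \<in> carrier (?G (r (Suc i)))" "d i x = (\<lambda>k. if k = 0 then a else \<zero>)"
          using d0 0 by (metis (no_types, lifting) image_iff)
        then have "a = \<zero>" using z[OF x(1)] by (metis (no_types, lifting) vec_module_simps(2))
        then show False using a by simp
      next
        case (Suc j)
        obtain s where s: "s \<in> carrier R" "s \<noteq> \<zero>" "\<And>a. a \<in> m \<Longrightarrow> a \<otimes> s = \<zero>" by (rule socle_element) blast
        have e: "unit_vec R 0 \<in> carrier (?G (r (Suc j)))"
          using Suc.IH Suc by (intro unit_vec_closed) simp
        interpret P: module R "?G (r (Suc j))" by (rule vec_module)
        define y where "y = s \<odot>\<^bsub>?G (r (Suc j))\<^esub> unit_vec R 0"
        have y: "y \<in> carrier (?G (r (Suc j)))" unfolding y_def by (rule P.smult_closed[OF s(1) e])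
        have "d j y = s \<odot>\<^bsub>?G (r j)\<^esub> d j (unit_vec R 0)" unfolding y_def by (rule module_hom_smult[OF d s(1) e])
        also have "\<dots> = \<zero>\<^bsub>?G (r j)\<^esub>"
          using s(3)[OF dm[OF e]] s(1) m_comm[OF s(1) Icarr[OF dm[OF e]]] by simp
        finally have "y \<in> d (Suc j) ` carrier (?G (r (Suc (Suc j))))" unfolding dS using y by blast
        then obtain x where "y = d (Suc j) x" "x \<in> carrier (?G (r (Suc (Suc j))))" by (rule imageE)
        then have "y = \<zero>\<^bsub>?V\<^esub>" using z[of x] Suc by simp
        then have "y 0 = \<zero>" by simp
        then show False using s by (simp add: y_def unit_vec_def)
      qed
    qed
  qed
  let ?k = "quotient_module R m"
  let ?e = "\<lambda>x. m +> x 0"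
  note q = quotient_module_coset[OF is_ideal] and qc = quotient_module_carrier[OF is_ideal]
  have "free_resolution R ?k (\<lambda>i. ?G (r i)) d ?e"
    unfolding free_resolution_def
  proof (intro conjI allI)
    show "free_module R (?G (r i))" for i by (rule vec_free_module[OF finite_lessThan one_not_zero])
    show "d i \<in> module_hom R (?G (r (Suc i))) (?G (r i))" for i by (rule d)
    show "?e \<in> module_hom R (?G (r 0)) ?k" by (intro module_homI) (auto simp: q vec_module_carrier)
    show "?e ` carrier (?G (r 0)) = carrier ?k"
    proof
      show "?e ` carrier (?G (r 0)) \<subseteq> carrier ?k" by (auto simp: q vec_module_carrier)
      show "carrier ?k \<subseteq> ?e ` carrier (?G (r 0))"
      proof
        fix c assume "c \<in> carrier ?k"
        then obtain a where a: "a \<in> carrier R" "c = m +> a" using qc by blast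
        then have "(\<lambda>k. if k = 0 then a else \<zero>) \<in> carrier (?G (r 0))" by (auto simp: vec_module_carrier r0)
        then show "c \<in> ?e ` carrier (?G (r 0))" unfolding a(2) by (rule rev_image_eqI) simp
      qed
    qed
    have "?Z = {x \<in> carrier (?G (r 0)). ?e x = \<zero>\<^bsub>?k\<^esub>}"
      unfolding r0 by (rule Collect_cong, rule conj_cong) (simp_all add: q vec_module_carrier)
    then show "d 0 ` carrier (?G (r 1)) = {x \<in> carrier (?G (r 0)). ?e x = \<zero>\<^bsub>?k\<^esub>}" using d0 by simp
    show "d (Suc i) ` carrier (?G (r (Suc (Suc i)))) = {x \<in> carrier (?G (r (Suc i))). d i x = \<zero>\<^bsub>?G (r i)\<^esub>}" for i
      by (rule dS)
  qed
  moreover have "d 0 ` carrier (?G (r 1)) = {x \<in> carrier (?G (r 0)). x 0 \<in> m}" using d0 by (simp add: r0)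
  ultimately show thesis using that[of r d ?e] r0 rpos dm by blast
qed

text \<open>Linearity in \<open>u\<close> holds because both sides of each identity are linear in
  \<open>w\<close> and agree on unit vectors.\<close>

lemma (in cring) vec_bilinear_extend:
  assumes "\<one> \<noteq> \<zero>" "\<And>k. k < p \<Longrightarrow> s k \<in> module_hom R (vec_module R {..<a}) (vec_module R {..<b})"
  obtains M where "\<And>w. w \<in> carrier (vec_module R {..<p}) \<Longrightarrow> M w \<in> module_hom R (vec_module R {..<a}) (vec_module R {..<b})"
    "\<And>u. u \<in> carrier (vec_module R {..<a}) \<Longrightarrow> (\<lambda>w. M w u) \<in> module_hom R (vec_module R {..<p}) (vec_module R {..<b})"
    "\<And>k u. \<lbrakk>k < p; u \<in> carrier (vec_module R {..<a})\<rbrakk> \<Longrightarrow> M (unit_vec R k) u = s k u"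
proof -
  let ?P = "vec_module R {..<p}" and ?A = "vec_module R {..<a}" and ?B = "vec_module R {..<b}"
  interpret A: module R ?A by (rule vec_module)
  interpret B: module R ?B by (rule vec_module)
  have "\<exists>h. u \<in> carrier ?A \<longrightarrow> h \<in> module_hom R ?P ?B \<and> (\<forall>k<p. h (unit_vec R k) = s k u)" for u
  proof (cases "u \<in> carrier ?A")
    case True
    then have "(\<lambda>k. s k u) \<in> {..<p} \<rightarrow> carrier ?B" using module_hom_closed[OF assms(2)] by auto
    then obtain h where "h \<in> module_hom R ?P ?B" "\<And>k. k \<in> {..<p} \<Longrightarrow> h (unit_vec R k) = s k u"
      using vec_hom_extend[OF finite_lessThan assms(1) vec_module] by blast
    then show ?thesis by auto
  qed auto
  then obtain H where H: "\<And>u. u \<in> carrier ?A \<Longrightarrow> H u \<in> module_hom R ?P ?B"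
    "\<And>u k. \<lbrakk>u \<in> carrier ?A; k < p\<rbrakk> \<Longrightarrow> H u (unit_vec R k) = s k u" by metis
  show thesis
  proof (rule that[of "\<lambda>w u. H u w"])
    fix w assume w: "w \<in> carrier ?P"
    show "(\<lambda>u. H u w) \<in> module_hom R ?A ?B"
    proof (rule module_homI)
      show "H u w \<in> carrier ?B" if "u \<in> carrier ?A" for u using module_hom_closed[OF H(1)[OF that] w] .
      show "H (u \<oplus>\<^bsub>?A\<^esub> u') w = H u w \<oplus>\<^bsub>?B\<^esub> H u' w" if u: "u \<in> carrier ?A" "u' \<in> carrier ?A" for u u'
      proof (rule vec_hom_ext[OF finite_lessThan vec_module H(1)[OF A.M.a_closed[OF u]] module_hom_plus[OF vec_module H(1)[OF u(1)] H(1)[OF u(2)]] _ w])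
        fix k assume "k \<in> {..<p}"
        then show "H (u \<oplus>\<^bsub>?A\<^esub> u') (unit_vec R k) = H u (unit_vec R k) \<oplus>\<^bsub>?B\<^esub> H u' (unit_vec R k)"
          using module_hom_add[OF assms(2) u] H(2)[OF A.M.a_closed[OF u]] H(2)[OF u(1)] H(2)[OF u(2)] by (metis lessThan_iff)
      qed
      show "H (c \<odot>\<^bsub>?A\<^esub> u) w = c \<odot>\<^bsub>?B\<^esub> H u w" if c: "c \<in> carrier R" and u: "u \<in> carrier ?A" for c u
      proof (rule vec_hom_ext[OF finite_lessThan vec_module H(1)[OF A.smult_closed[OF c u]] module_hom_scale[OF vec_module H(1)[OF u] c] _ w])
        fix k assume "k \<in> {..<p}"
        then show "H (c \<odot>\<^bsub>?A\<^esub> u) (unit_vec R k) = c \<odot>\<^bsub>?B\<^esub> H u (unit_vec R k)"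
          using module_hom_smult[OF assms(2) c u] H(2)[OF A.smult_closed[OF c u]] H(2)[OF u] by (metis lessThan_iff)
      qed
    qed
  qed (use H in auto)
qed

section \<open>Products and pairings on a minimal resolution\<close>

locale minimal_free_resolution = nilpotent_local_ring R m l for R (structure) and m l +
  fixes r :: "nat \<Rightarrow> nat" and d :: "nat \<Rightarrow> (nat \<Rightarrow> 'a) \<Rightarrow> nat \<Rightarrow> 'a" and \<epsilon> :: "(nat \<Rightarrow> 'a) \<Rightarrow> 'a set"
  assumes r0: "r 0 = 1" and rpos: "r i > 0"
    and resolution: "free_resolution R (quotient_module R m) (\<lambda>i. vec_module R {..<r i}) d \<epsilon>"
    and d0_image: "d 0 ` carrier (vec_module R {..<r 1}) = {x \<in> carrier (vec_module R {..<r 0}). x 0 \<in> m}"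
    and minimal: "x \<in> carrier (vec_module R {..<r (Suc i)}) \<Longrightarrow> d i x k \<in> m"
begin

abbreviation "V \<equiv> vec_module R UNIV"
abbreviation "G i \<equiv> vec_module R {..<r i}"
text \<open>The rank 0 below \<open>N\<close> is essential: the truncated difference
  \<open>t - N\<close> alone would produce copies of \<open>G 0\<close> there.\<close>

abbreviation "shift N t \<equiv> vec_module R {..<if t < N then 0 else r (t - N)}"

text \<open>Unlike \<open>d\<close> it is indexed by its source, and it is zero in degree 0, so that
  the Leibniz rule can be stated without cases.\<close>

definition D :: "nat \<Rightarrow> (nat \<Rightarrow> 'a) \<Rightarrow> nat \<Rightarrow> 'a" where
  "D j x = (if j = 0 then \<zero>\<^bsub>V\<^esub> else d (j - 1) x)"

definition sgn :: "nat \<Rightarrow> 'a" where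
  "sgn q = (if even q then \<one> else \<ominus> \<one>)"

text \<open>All the modules \<open>vec_module R {..<k}\<close> share the operations of \<open>V\<close>. Rewriting everything to \<open>V\<close> makes sums of
  elements of different degrees a matter of membership only.\<close>

declare vec_module_simps [simp del]

lemma vec_ops [simp]:
  "x \<oplus>\<^bsub>vec_module R {..<k::nat}\<^esub> y = x \<oplus>\<^bsub>V\<^esub> y"
  "\<zero>\<^bsub>vec_module R {..<k}\<^esub> = \<zero>\<^bsub>V\<^esub>"
  "a \<odot>\<^bsub>vec_module R {..<k}\<^esub> x = a \<odot>\<^bsub>V\<^esub> x"
  by (simp_all add: vec_module_simps)

sublocale V: module R V by (rule vec_module)

lemma in_V: "x \<in> carrier (vec_module R {..<k::nat}) \<Longrightarrow> x \<in> carrier V"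
  by (simp add: vec_module_carrier)

lemma vec_closed [simp]:
  "\<lbrakk>x \<in> carrier (vec_module R {..<k::nat}); y \<in> carrier (vec_module R {..<k})\<rbrakk> \<Longrightarrow> x \<oplus>\<^bsub>V\<^esub> y \<in> carrier (vec_module R {..<k})"
  "\<zero>\<^bsub>V\<^esub> \<in> carrier (vec_module R {..<k})"
  "\<lbrakk>a \<in> carrier R; x \<in> carrier (vec_module R {..<k})\<rbrakk> \<Longrightarrow> a \<odot>\<^bsub>V\<^esub> x \<in> carrier (vec_module R {..<k})"
  using V.submoduleE(4,5)[OF vec_module_submodule] V.submodule_zero[OF vec_module_submodule] by auto

lemma hom_add:
  assumes "f \<in> module_hom R (vec_module R {..<j::nat}) (vec_module R {..<k::nat})"
    "x \<in> carrier (vec_module R {..<j})" "y \<in> carrier (vec_module R {..<j})"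
  shows "f (x \<oplus>\<^bsub>V\<^esub> y) = f x \<oplus>\<^bsub>V\<^esub> f y"
  using module_hom_add[OF assms] by simp

lemma hom_smult:
  assumes "f \<in> module_hom R (vec_module R {..<j::nat}) (vec_module R {..<k::nat})"
    "a \<in> carrier R" "x \<in> carrier (vec_module R {..<j})"
  shows "f (a \<odot>\<^bsub>V\<^esub> x) = a \<odot>\<^bsub>V\<^esub> f x"
  using module_hom_smult[OF assms] by simp

lemma hom_zero:
  assumes "f \<in> module_hom R (vec_module R {..<j::nat}) (vec_module R {..<k::nat})"
  shows "f \<zero>\<^bsub>V\<^esub> = \<zero>\<^bsub>V\<^esub>"
  using module_hom_zero[OF vec_module vec_module assms] by simp

lemma zero_hom: "(\<lambda>x. \<zero>\<^bsub>V\<^esub>) \<in> module_hom R M (vec_module R {..<k::nat})"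
  using module_hom_zero_map[OF vec_module[of "{..<k}"]] by simp

lemma sgn_closed [simp]: "sgn q \<in> carrier R"
  by (simp add: sgn_def)

lemma sgn_0 [simp]: "sgn 0 = \<one>"
  by (simp add: sgn_def)

lemma sgn_mult: "sgn p \<otimes> sgn q = sgn (p + q)"
  by (auto simp: sgn_def l_minus)

lemma sgn_sgn: "x \<in> carrier V \<Longrightarrow> sgn q \<odot>\<^bsub>V\<^esub> (sgn q \<odot>\<^bsub>V\<^esub> x) = x"
  by (simp add: V.smult_assoc1[symmetric] sgn_mult) (simp add: sgn_def)

lemma sgn_Suc_cancel: "x \<in> carrier V \<Longrightarrow> sgn q \<odot>\<^bsub>V\<^esub> x \<oplus>\<^bsub>V\<^esub> sgn (Suc q) \<odot>\<^bsub>V\<^esub> x = \<zero>\<^bsub>V\<^esub>"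
  by (auto simp: sgn_def V.smult_l_minus V.M.r_neg V.M.l_neg)

lemma d_hom: "d i \<in> module_hom R (G (Suc i)) (G i)"
  using free_resolutionD(3)[OF resolution] .

lemma d_d: "x \<in> carrier (G (Suc (Suc i))) \<Longrightarrow> d i (d (Suc i) x) = \<zero>\<^bsub>V\<^esub>"
  using free_resolutionD(8)[OF resolution] by simp

lemma exact: "\<lbrakk>x \<in> carrier (G (Suc i)); d i x = \<zero>\<^bsub>V\<^esub>\<rbrakk> \<Longrightarrow> x \<in> d (Suc i) ` carrier (G (Suc (Suc i)))"
  using free_resolutionD(7)[OF resolution] by simp

lemma D_simps [simp]: "D 0 x = \<zero>\<^bsub>V\<^esub>" "D (Suc j) x = d j x"
  by (simp_all add: D_def)

lemma D_hom: "D j \<in> module_hom R (G j) (G (j - 1))"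
  using d_hom zero_hom by (cases j) (simp_all add: D_def[abs_def])

lemma D_closed [simp]: "x \<in> carrier (G j) \<Longrightarrow> D j x \<in> carrier (G (j - 1))"
  using module_hom_closed[OF D_hom] .

lemma G_free: "free_module R (G i)"
  by (rule vec_free_module[OF finite_lessThan one_not_zero])

lemma e0_closed [simp]: "unit_vec R 0 \<in> carrier (G i)"
  using rpos[of i] by (intro unit_vec_closed) simp

lemma e_closed: "k < r i \<Longrightarrow> unit_vec R k \<in> carrier (G i)"
  by (intro unit_vec_closed) simp

lemma G0_eq: "x \<in> carrier (G 0) \<Longrightarrow> x = x 0 \<odot>\<^bsub>V\<^esub> unit_vec R 0"
  by (auto simp: vec_module_carrier r0 unit_vec_def vec_module_simps fun_eq_iff)

lemma coord_closed: "x \<in> carrier (vec_module R S) \<Longrightarrow> x k \<in> carrier R"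
  by (simp add: vec_module_carrier)

lemma coord_hom:
  assumes "b \<in> carrier (vec_module R {..<p::nat})"
  shows "(\<lambda>x. x k \<odot>\<^bsub>V\<^esub> b) \<in> module_hom R (G i) (vec_module R {..<p})"
proof (rule module_homI)
  note b = in_V[OF assms]
  fix x assume x: "x \<in> carrier (G i)"
  show "x k \<odot>\<^bsub>V\<^esub> b \<in> carrier (vec_module R {..<p})" using x assms by (simp add: coord_closed)
  show "(x \<oplus>\<^bsub>G i\<^esub> y) k \<odot>\<^bsub>V\<^esub> b = x k \<odot>\<^bsub>V\<^esub> b \<oplus>\<^bsub>vec_module R {..<p}\<^esub> y k \<odot>\<^bsub>V\<^esub> b"
    if y: "y \<in> carrier (G i)" for y
    using V.smult_l_distr[OF coord_closed[OF x] coord_closed[OF y] b, of k k] by (simp add: vec_module_simps)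
  show "(a \<odot>\<^bsub>G i\<^esub> x) k \<odot>\<^bsub>V\<^esub> b = a \<odot>\<^bsub>vec_module R {..<p}\<^esub> (x k \<odot>\<^bsub>V\<^esub> b)" if a: "a \<in> carrier R" for a
    using V.smult_assoc1[OF a coord_closed[OF x] b, of k] by (simp add: vec_module_simps)
qed

text \<open>A pairing of degree \<open>N\<close> is a chain map from \<open>G \<otimes> G\<close> to the \<open>N\<close>-fold shift of \<open>G\<close>; the component
  \<open>c q j\<close> takes a first argument of degree \<open>q\<close> and a second one of degree \<open>j\<close>, and the last clause is
  the Leibniz rule. The differential of the shift carries no sign. The truncated
  subtractions are harmless because \<open>D 0 = 0\<close>.\<close>

definition pairing :: "nat \<Rightarrow> (nat \<Rightarrow> nat \<Rightarrow> (nat \<Rightarrow> 'a) \<Rightarrow> (nat \<Rightarrow> 'a) \<Rightarrow> nat \<Rightarrow> 'a) \<Rightarrow> bool" where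
  "pairing N c \<longleftrightarrow>
     (\<forall>q j w. w \<in> carrier (G q) \<longrightarrow> c q j w \<in> module_hom R (G j) (shift N (j + q))) \<and>
     (\<forall>q j u. u \<in> carrier (G j) \<longrightarrow> (\<lambda>w. c q j w u) \<in> module_hom R (G q) (shift N (j + q))) \<and>
     (\<forall>q j w u. w \<in> carrier (G q) \<longrightarrow> u \<in> carrier (G j) \<longrightarrow>
        D (j + q - N) (c q j w u) = c (q - 1) j (D q w) u \<oplus>\<^bsub>V\<^esub> sgn q \<odot>\<^bsub>V\<^esub> c q (j - 1) w (D j u))"

lemma pairingD:
  assumes "pairing N c"
  shows "w \<in> carrier (G q) \<Longrightarrow> c q j w \<in> module_hom R (G j) (shift N (j + q))"
    "u \<in> carrier (G j) \<Longrightarrow> (\<lambda>w. c q j w u) \<in> module_hom R (G q) (shift N (j + q))"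
    "\<lbrakk>w \<in> carrier (G q); u \<in> carrier (G j)\<rbrakk> \<Longrightarrow>
        D (j + q - N) (c q j w u) = c (q - 1) j (D q w) u \<oplus>\<^bsub>V\<^esub> sgn q \<odot>\<^bsub>V\<^esub> c q (j - 1) w (D j u)"
    "\<lbrakk>w \<in> carrier (G q); u \<in> carrier (G j)\<rbrakk> \<Longrightarrow> c q j w u \<in> carrier (shift N (j + q))"
    "\<lbrakk>w \<in> carrier (G q); u \<in> carrier (G j)\<rbrakk> \<Longrightarrow> c q j w u \<in> carrier V"
    "w \<in> carrier (G q) \<Longrightarrow> c q j w \<zero>\<^bsub>V\<^esub> = \<zero>\<^bsub>V\<^esub>"
    "u \<in> carrier (G j) \<Longrightarrow> c q j \<zero>\<^bsub>V\<^esub> u = \<zero>\<^bsub>V\<^esub>"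
proof -
  show 1: "w \<in> carrier (G q) \<Longrightarrow> c q j w \<in> module_hom R (G j) (shift N (j + q))"
    and 2: "u \<in> carrier (G j) \<Longrightarrow> (\<lambda>w. c q j w u) \<in> module_hom R (G q) (shift N (j + q))"
    and "\<lbrakk>w \<in> carrier (G q); u \<in> carrier (G j)\<rbrakk> \<Longrightarrow>
        D (j + q - N) (c q j w u) = c (q - 1) j (D q w) u \<oplus>\<^bsub>V\<^esub> sgn q \<odot>\<^bsub>V\<^esub> c q (j - 1) w (D j u)"
    using assms unfolding pairing_def by blast+
  show 3: "\<lbrakk>w \<in> carrier (G q); u \<in> carrier (G j)\<rbrakk> \<Longrightarrow> c q j w u \<in> carrier (shift N (j + q))"
    using module_hom_closed[OF 1] .
  show "\<lbrakk>w \<in> carrier (G q); u \<in> carrier (G j)\<rbrakk> \<Longrightarrow> c q j w u \<in> carrier V"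
    using in_V[OF 3] .
  show "w \<in> carrier (G q) \<Longrightarrow> c q j w \<zero>\<^bsub>V\<^esub> = \<zero>\<^bsub>V\<^esub>" using hom_zero[OF 1] .
  show "u \<in> carrier (G j) \<Longrightarrow> c q j \<zero>\<^bsub>V\<^esub> u = \<zero>\<^bsub>V\<^esub>" using hom_zero[OF 2] .
qed

text \<open>Minimality starts the lift: a coordinate of a boundary lies in \<open>m\<close>, which
  is the image of \<open>d 0\<close> in \<open>G 0 = R\<close>. The sign is chosen to cancel the
  sign with which \<open>c (b, -)\<close> commutes with the differentials when \<open>b\<close> has
  degree \<open>q\<close>.\<close>

lemma coordinate_lift:
  assumes k: "k < r q"
  obtains \<Lambda> where "\<And>j. \<Lambda> j \<in> module_hom R (G (j + q)) (G j)" "\<And>w. w \<in> carrier (G q) \<Longrightarrow> \<Lambda> 0 w = w k \<odot>\<^bsub>V\<^esub> unit_vec R 0"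
    "\<And>j w. w \<in> carrier (G (j + q)) \<Longrightarrow> D j (\<Lambda> j w) = sgn q \<odot>\<^bsub>V\<^esub> (if j = 0 then \<zero>\<^bsub>V\<^esub> else \<Lambda> (j - 1) (D (j + q) w))"
proof -
  let ?s = "\<lambda>x. x k \<odot>\<^bsub>V\<^esub> unit_vec R 0"
  obtain \<Lambda> where L: "\<Lambda> 0 = ?s" "\<And>n. \<Lambda> n \<in> module_hom R (G (n + q)) (G n)"
    "\<And>n x. x \<in> carrier (G (Suc n + q)) \<Longrightarrow>
       d n (\<Lambda> (Suc n) x) = \<zero>\<^bsub>V\<^esub> \<oplus>\<^bsub>G n\<^esub> sgn q \<odot>\<^bsub>G n\<^esub> \<Lambda> n (d (n + q) x)"
  proof (rule chain_lift[where P = "\<lambda>n. G (n + q)" and dP = "\<lambda>n. d (n + q)" and Q = G and dQ = d and \<sigma> = "sgn q"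
        and \<phi> = "\<lambda>n x. \<zero>\<^bsub>V\<^esub>" and t = ?s and R = R])
    fix n
    show "free_module R (G (n + q))" by (rule G_free)
    show "d (n + q) \<in> module_hom R (G (Suc n + q)) (G (n + q))" using d_hom by simp
    show "d (n + q) (d (Suc n + q) x) = \<zero>\<^bsub>G (n + q)\<^esub>" if "x \<in> carrier (G (Suc (Suc n) + q))" for x using that d_d by simp
    show "module R (G n)" by (rule vec_module)
    show "d n \<in> module_hom R (G (Suc n)) (G n)" by (rule d_hom)
    show "x \<in> d (Suc n) ` carrier (G (Suc (Suc n)))" if "x \<in> carrier (G (Suc n))" "d n x = \<zero>\<^bsub>G n\<^esub>" for x
      using exact that by simp
    show "(\<lambda>x. \<zero>\<^bsub>V\<^esub>) \<in> module_hom R (G (Suc n + q)) (G n)"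
      by (rule zero_hom)
    show "d n \<zero>\<^bsub>V\<^esub> \<oplus>\<^bsub>G n\<^esub> sgn q \<odot>\<^bsub>G n\<^esub> \<zero>\<^bsub>V\<^esub> = \<zero>\<^bsub>G n\<^esub>" using hom_zero[OF d_hom] by simp
    show "?s \<in> module_hom R (G (0 + q)) (G 0)" by (rule coord_hom) simp
    show "\<zero>\<^bsub>V\<^esub> \<oplus>\<^bsub>G 0\<^esub> sgn q \<odot>\<^bsub>G 0\<^esub> (d (0 + q) x k \<odot>\<^bsub>V\<^esub> unit_vec R 0) \<in> d 0 ` carrier (G (Suc 0))"
      if x: "x \<in> carrier (G (Suc 0 + q))" for x
    proof -
      have "d q x k \<in> m" using minimal x by simp
      then have "sgn q \<otimes> d q x k \<in> m" by (rule I_l_closed) simp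
      moreover have "sgn q \<odot>\<^bsub>V\<^esub> (d q x k \<odot>\<^bsub>V\<^esub> unit_vec R 0) \<in> carrier (G 0)"
        using \<open>d q x k \<in> m\<close> by simp
      ultimately show ?thesis
        using \<open>d q x k \<in> m\<close> d0_image in_V[of _ "r 0"] by (simp add: V.smult_assoc1[symmetric]) (simp add: vec_module_simps unit_vec_def)
    qed
  qed (rule sgn_closed, blast)
  show thesis
  proof (rule that[of \<Lambda>])
    fix j w assume w: "w \<in> carrier (G (j + q))"
    show "D j (\<Lambda> j w) = sgn q \<odot>\<^bsub>V\<^esub> (if j = 0 then \<zero>\<^bsub>V\<^esub> else \<Lambda> (j - 1) (D (j + q) w))"
    proof (cases j)
      case (Suc i)
      have "\<Lambda> i (d (i + q) w) \<in> carrier V"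
        using in_V[OF module_hom_closed[OF L(2) module_hom_closed[OF d_hom]]] w Suc by simp
      then show ?thesis using L(3)[of w i] w Suc by simp
    qed simp
  qed (use L in auto)
qed

text \<open>The pairing is extended from degree \<open>q\<close> to degree \<open>q + 1\<close> in the first argument: multiplication
  by a basis vector \<open>b\<close> is a null homotopy of the multiplication by the cycle \<open>d b\<close>.\<close>

lemma multiplication_exists:
  obtains \<mu> where "pairing 0 \<mu>"
    "\<And>n u. u \<in> carrier (G n) \<Longrightarrow> \<mu> 0 n (unit_vec R 0) u = u"
    "\<And>q w. w \<in> carrier (G q) \<Longrightarrow> \<mu> q 0 w (unit_vec R 0) = w"
proof -
  let ?e = "unit_vec R 0"
  \<comment> \<open>\<open>M\<close> is the component with first argument of degree
    \<open>q\<close>. Its Leibniz rule is kept only for cycles \<open>w\<close>, where it does not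
    refer to the previous component; \<open>B\<close> is the full rule linking two consecutive
    components.\<close>
  define A where "A q M \<longleftrightarrow>
     (\<forall>n w. w \<in> carrier (G q) \<longrightarrow> M n w \<in> module_hom R (G n) (G (n + q))) \<and>
     (\<forall>n u. u \<in> carrier (G n) \<longrightarrow> (\<lambda>w. M n w u) \<in> module_hom R (G q) (G (n + q))) \<and>
     (\<forall>w. w \<in> carrier (G q) \<longrightarrow> M 0 w ?e = w) \<and>
     (\<forall>n w u. w \<in> carrier (G q) \<longrightarrow> u \<in> carrier (G n) \<longrightarrow> D q w = \<zero>\<^bsub>V\<^esub> \<longrightarrow>
        D (n + q) (M n w u) = sgn q \<odot>\<^bsub>V\<^esub> M (n - 1) w (D n u)) \<and>
     (q = 0 \<longrightarrow> (\<forall>n w u. M n w u = w 0 \<odot>\<^bsub>V\<^esub> u))"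
    for q and M :: "nat \<Rightarrow> (nat \<Rightarrow> 'a) \<Rightarrow> (nat \<Rightarrow> 'a) \<Rightarrow> nat \<Rightarrow> 'a"
  define B where "B q M M' \<longleftrightarrow>
     (\<forall>n w u. w \<in> carrier (G (Suc q)) \<longrightarrow> u \<in> carrier (G n) \<longrightarrow>
        D (n + Suc q) (M' n w u) = M n (d q w) u \<oplus>\<^bsub>V\<^esub> sgn (Suc q) \<odot>\<^bsub>V\<^esub> M' (n - 1) w (D n u))"
    for q and M M' :: "nat \<Rightarrow> (nat \<Rightarrow> 'a) \<Rightarrow> (nat \<Rightarrow> 'a) \<Rightarrow> nat \<Rightarrow> 'a"
  have "\<exists>f. \<forall>q. A q (f q) \<and> B q (f q) (f (Suc q))"
  proof (rule dependent_nat_choice)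
    have "A 0 (\<lambda>n w u. w 0 \<odot>\<^bsub>V\<^esub> u)"
      unfolding A_def
    proof (intro conjI allI impI)
      fix n w assume w: "w \<in> carrier (G 0)"
      show "(\<lambda>u. w 0 \<odot>\<^bsub>V\<^esub> u) \<in> module_hom R (G n) (G (n + 0))"
        using module_hom_scale[OF vec_module module_hom_ident coord_closed[OF w], of "{..<r n}" 0] by simp
    next
      fix n u assume "u \<in> carrier (G n)"
      then show "(\<lambda>w. w 0 \<odot>\<^bsub>V\<^esub> u) \<in> module_hom R (G 0) (G (n + 0))" using coord_hom by simp
    next
      fix w assume "w \<in> carrier (G 0)"
      then show "w 0 \<odot>\<^bsub>V\<^esub> ?e = w" using G0_eq by simp
    next
      fix n w u assume w: "w \<in> carrier (G 0)" and u: "u \<in> carrier (G n)"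
      show "D (n + 0) (w 0 \<odot>\<^bsub>V\<^esub> u) = sgn 0 \<odot>\<^bsub>V\<^esub> (w 0 \<odot>\<^bsub>V\<^esub> D n u)"
        using hom_smult[OF D_hom coord_closed[OF w] u] in_V[OF D_closed[OF u]] coord_closed[OF w] by simp
    qed auto
    then show "\<exists>M. A 0 M" by blast
  next
    fix M q assume M: "A q M"
    have M1: "\<And>n w. w \<in> carrier (G q) \<Longrightarrow> M n w \<in> module_hom R (G n) (G (n + q))"
      and M2: "\<And>n u. u \<in> carrier (G n) \<Longrightarrow> (\<lambda>w. M n w u) \<in> module_hom R (G q) (G (n + q))"
      and M3: "\<And>w. w \<in> carrier (G q) \<Longrightarrow> M 0 w ?e = w"
      and M4: "\<And>n w u. \<lbrakk>w \<in> carrier (G q); u \<in> carrier (G n); D q w = \<zero>\<^bsub>V\<^esub>\<rbrakk> \<Longrightarrow>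
        D (n + q) (M n w u) = sgn q \<odot>\<^bsub>V\<^esub> M (n - 1) w (D n u)"
      using M unfolding A_def by blast+
    \<comment> \<open>\<open>s\<close> is to become multiplication by the basis vector
      \<open>b\<close> with index \<open>k\<close>. Its part in degree 0, which sends
      \<open>u\<close> to \<open>u 0\<close> times \<open>b\<close>, is dictated by the right
      unit.\<close>
    define T where "T k s \<longleftrightarrow> s 0 = (\<lambda>x. x 0 \<odot>\<^bsub>V\<^esub> unit_vec R k) \<and>
       (\<forall>n. s n \<in> module_hom R (G n) (G (n + Suc q))) \<and>
       (\<forall>n x. x \<in> carrier (G (Suc n)) \<longrightarrow>
         d (n + Suc q) (s (Suc n) x) = M (Suc n) (d q (unit_vec R k)) x \<oplus>\<^bsub>V\<^esub> sgn (Suc q) \<odot>\<^bsub>V\<^esub> s n (d n x))"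
      for k and s :: "nat \<Rightarrow> (nat \<Rightarrow> 'a) \<Rightarrow> nat \<Rightarrow> 'a"
    have exT: "\<exists>s. T k s" if k: "k < r (Suc q)" for k
    proof -
      let ?b = "unit_vec R k"
      have b: "?b \<in> carrier (G (Suc q))" by (rule e_closed[OF k])
      have db: "d q ?b \<in> carrier (G q)" by (rule module_hom_closed[OF d_hom b])
      \<comment> \<open>Since \<open>d b\<close> is a cycle, the restricted Leibniz rule makes
        multiplication by it a chain map up to sign, which is the condition on \<open>\<phi>\<close>
        in \<open>chain_lift\<close>.\<close>
      have Ddb: "D q (d q ?b) = \<zero>\<^bsub>V\<^esub>" using d_d b by (cases q) auto
      have zero: "sgn q \<odot>\<^bsub>V\<^esub> x \<oplus>\<^bsub>V\<^esub> sgn (Suc q) \<odot>\<^bsub>V\<^esub> x = \<zero>\<^bsub>V\<^esub>" if "x \<in> carrier (G i)" for x i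
        using sgn_Suc_cancel[OF in_V[OF that]] .
      obtain s where "s 0 = (\<lambda>x. x 0 \<odot>\<^bsub>V\<^esub> ?b)" "\<And>n. s n \<in> module_hom R (G n) (G (n + Suc q))"
        "\<And>n x. x \<in> carrier (G (Suc n)) \<Longrightarrow>
         d (n + Suc q) (s (Suc n) x) = M (Suc n) (d q ?b) x \<oplus>\<^bsub>G (n + Suc q)\<^esub> sgn (Suc q) \<odot>\<^bsub>G (n + Suc q)\<^esub> s n (d n x)"
      proof (rule chain_lift[where P = G and dP = d and Q = "\<lambda>n. G (n + Suc q)" and dQ = "\<lambda>n. d (n + Suc q)"
            and \<sigma> = "sgn (Suc q)" and \<phi> = "\<lambda>n. M (Suc n) (d q ?b)" and t = "\<lambda>x. x 0 \<odot>\<^bsub>V\<^esub> ?b" and R = R])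
        fix n
        show "free_module R (G n)" by (rule G_free)
        show "d n \<in> module_hom R (G (Suc n)) (G n)" by (rule d_hom)
        show "d n (d (Suc n) x) = \<zero>\<^bsub>G n\<^esub>" if "x \<in> carrier (G (Suc (Suc n)))" for x using d_d that by simp
        show "module R (G (n + Suc q))" by (rule vec_module)
        show "d (n + Suc q) \<in> module_hom R (G (Suc n + Suc q)) (G (n + Suc q))" using d_hom by simp
        show "x \<in> d (Suc n + Suc q) ` carrier (G (Suc (Suc n) + Suc q))"
          if "x \<in> carrier (G (Suc n + Suc q))" "d (n + Suc q) x = \<zero>\<^bsub>G (n + Suc q)\<^esub>" for x
          using exact that by simp
        show "M (Suc n) (d q ?b) \<in> module_hom R (G (Suc n)) (G (n + Suc q))" using M1[OF db, of "Suc n"] by simp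
        show "d (n + Suc q) (M (Suc (Suc n)) (d q ?b) x) \<oplus>\<^bsub>G (n + Suc q)\<^esub>
            sgn (Suc q) \<odot>\<^bsub>G (n + Suc q)\<^esub> M (Suc n) (d q ?b) (d (Suc n) x) = \<zero>\<^bsub>G (n + Suc q)\<^esub>"
          if x: "x \<in> carrier (G (Suc (Suc n)))" for x
          using M4[OF db x Ddb] zero[OF module_hom_closed[OF M1[OF db] module_hom_closed[OF d_hom x]]] by simp
        show "(\<lambda>x. x 0 \<odot>\<^bsub>V\<^esub> ?b) \<in> module_hom R (G 0) (G (0 + Suc q))" using coord_hom[OF b] by simp
        show "M (Suc 0) (d q ?b) x \<oplus>\<^bsub>G (0 + Suc q)\<^esub> sgn (Suc q) \<odot>\<^bsub>G (0 + Suc q)\<^esub> (d 0 x 0 \<odot>\<^bsub>V\<^esub> ?b)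
            \<in> d (0 + Suc q) ` carrier (G (Suc 0 + Suc q))" if x: "x \<in> carrier (G (Suc 0))" for x
        proof -
          have dx: "d 0 x \<in> carrier (G 0)" by (rule module_hom_closed[OF d_hom x])
          have c: "d 0 x 0 \<in> carrier R" by (rule coord_closed[OF dx])
          have mx: "M (Suc 0) (d q ?b) x \<in> carrier (G (Suc q))" using module_hom_closed[OF M1[OF db] x] by simp
          \<comment> \<open>A cycle is a boundary here, so it suffices to apply \<open>d q\<close>.
            The right unit turns both terms into the multiple of \<open>d b\<close> by
            \<open>d 0 x 0\<close>, with opposite signs.\<close>
          have "d q (M (Suc 0) (d q ?b) x) = sgn q \<odot>\<^bsub>V\<^esub> M 0 (d q ?b) (d 0 x)"
            using M4[OF db x Ddb] by simp
          also have "M 0 (d q ?b) (d 0 x) = M 0 (d q ?b) (d 0 x 0 \<odot>\<^bsub>V\<^esub> ?e)"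
            using G0_eq[OF dx] by (rule arg_cong)
          also have "\<dots> = d 0 x 0 \<odot>\<^bsub>V\<^esub> d q ?b"
            using hom_smult[OF M1[OF db] c e0_closed] M3[OF db] by simp
          finally have "d q (M (Suc 0) (d q ?b) x \<oplus>\<^bsub>V\<^esub> sgn (Suc q) \<odot>\<^bsub>V\<^esub> (d 0 x 0 \<odot>\<^bsub>V\<^esub> ?b)) =
             sgn q \<odot>\<^bsub>V\<^esub> (d 0 x 0 \<odot>\<^bsub>V\<^esub> d q ?b) \<oplus>\<^bsub>V\<^esub> sgn (Suc q) \<odot>\<^bsub>V\<^esub> (d 0 x 0 \<odot>\<^bsub>V\<^esub> d q ?b)"
            using mx b c by (simp add: hom_add[OF d_hom] hom_smult[OF d_hom])
          also have "\<dots> = \<zero>\<^bsub>V\<^esub>" using zero[of "d 0 x 0 \<odot>\<^bsub>V\<^esub> d q ?b" q] c db by simp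
          finally show ?thesis using exact mx b c by simp
        qed
      qed (rule sgn_closed, blast)
      then have "T k s" unfolding T_def by simp
      then show ?thesis by blast
    qed
    define s where "s k = (SOME s. T k s)" for k
    have T: "T k (s k)" if "k < r (Suc q)" for k unfolding s_def by (rule someI_ex[OF exT[OF that]])
    have s0: "\<And>k. k < r (Suc q) \<Longrightarrow> s k 0 = (\<lambda>x. x 0 \<odot>\<^bsub>V\<^esub> unit_vec R k)"
      and s1: "\<And>k n. k < r (Suc q) \<Longrightarrow> s k n \<in> module_hom R (G n) (G (n + Suc q))"
      and s2: "\<And>k n x. \<lbrakk>k < r (Suc q); x \<in> carrier (G (Suc n))\<rbrakk> \<Longrightarrow>
         d (n + Suc q) (s k (Suc n) x) = M (Suc n) (d q (unit_vec R k)) x \<oplus>\<^bsub>V\<^esub> sgn (Suc q) \<odot>\<^bsub>V\<^esub> s k n (d n x)"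
      using T unfolding T_def by blast+
    define U where "U n M' \<longleftrightarrow> (\<forall>w. w \<in> carrier (G (Suc q)) \<longrightarrow> M' w \<in> module_hom R (G n) (G (n + Suc q))) \<and>
       (\<forall>u. u \<in> carrier (G n) \<longrightarrow> (\<lambda>w. M' w u) \<in> module_hom R (G (Suc q)) (G (n + Suc q))) \<and>
       (\<forall>k u. k < r (Suc q) \<longrightarrow> u \<in> carrier (G n) \<longrightarrow> M' (unit_vec R k) u = s k n u)"
      for n and M' :: "(nat \<Rightarrow> 'a) \<Rightarrow> (nat \<Rightarrow> 'a) \<Rightarrow> nat \<Rightarrow> 'a"
    have exU: "\<exists>M'. U n M'" for n
      unfolding U_def by (rule vec_bilinear_extend[OF one_not_zero s1[of _ n]]) blast+
    define M' where "M' n = (SOME M'. U n M')" for n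
    have U: "U n (M' n)" for n unfolding M'_def by (rule someI_ex[OF exU])
    have M'1: "\<And>n w. w \<in> carrier (G (Suc q)) \<Longrightarrow> M' n w \<in> module_hom R (G n) (G (n + Suc q))"
      and M'2: "\<And>n u. u \<in> carrier (G n) \<Longrightarrow> (\<lambda>w. M' n w u) \<in> module_hom R (G (Suc q)) (G (n + Suc q))"
      and M'3: "\<And>n k u. \<lbrakk>k < r (Suc q); u \<in> carrier (G n)\<rbrakk> \<Longrightarrow> M' n (unit_vec R k) u = s k n u"
      using U unfolding U_def by blast+
    have unit: "M' 0 w ?e = w" if w: "w \<in> carrier (G (Suc q))" for w
    proof (rule vec_hom_ext[OF finite_lessThan vec_module _ module_hom_ident _ w])
      show "(\<lambda>w. M' 0 w ?e) \<in> module_hom R (G (Suc q)) (G (Suc q))" using M'2[OF e0_closed, of 0] by simp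
      show "M' 0 (unit_vec R k) ?e = unit_vec R k" if "k \<in> {..<r (Suc q)}" for k
        using that M'3[OF _ e0_closed] s0 in_V[OF e_closed] by (simp add: unit_vec_def)
    qed
    \<comment> \<open>Both sides are linear in \<open>w\<close>, so basis vectors suffice. For them
      positive \<open>n\<close> is the null homotopy, and \<open>n = 0\<close> is the right unit of
      the previous component.\<close>
    have rel: "B q M M'"
      unfolding B_def
    proof (intro allI impI)
      fix n w u assume w: "w \<in> carrier (G (Suc q))" and u: "u \<in> carrier (G n)"
      have Du: "D n u \<in> carrier (G (n - 1))" by (rule D_closed[OF u])
      have Dh: "D (n + Suc q) \<in> module_hom R (G (n + Suc q)) (G (n + q))" using D_hom[of "n + Suc q"] by simp
      have h1: "(\<lambda>w. M n (d q w) u) \<in> module_hom R (G (Suc q)) (G (n + q))"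
        by (rule module_hom_comp[OF d_hom M2[OF u]])
      have h2: "(\<lambda>w. sgn (Suc q) \<odot>\<^bsub>V\<^esub> M' (n - 1) w (D n u)) \<in> module_hom R (G (Suc q)) (G (n + q))"
      proof (cases n)
        case 0
        have "(\<lambda>w. \<zero>\<^bsub>V\<^esub>) \<in> module_hom R (G (Suc q)) (G (n + q))" by (rule zero_hom)
        then show ?thesis
          using 0 hom_zero[OF M'1[of _ 0]] by (simp add: module_hom_def hom_def Pi_iff)
      next
        case (Suc i)
        then show ?thesis using module_hom_scale[OF vec_module M'2[OF Du] sgn_closed] by simp
      qed
      have h3: "(\<lambda>w. M n (d q w) u \<oplus>\<^bsub>V\<^esub> sgn (Suc q) \<odot>\<^bsub>V\<^esub> M' (n - 1) w (D n u)) \<in> module_hom R (G (Suc q)) (G (n + q))"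
        using module_hom_plus[OF vec_module h1 h2] by simp
      show "D (n + Suc q) (M' n w u) = M n (d q w) u \<oplus>\<^bsub>V\<^esub> sgn (Suc q) \<odot>\<^bsub>V\<^esub> M' (n - 1) w (D n u)"
      proof (rule vec_hom_ext[OF finite_lessThan vec_module module_hom_comp[OF M'2[OF u] Dh] h3 _ w])
        fix k assume "k \<in> {..<r (Suc q)}"
        then have k: "k < r (Suc q)" by simp
        have b: "unit_vec R k \<in> carrier (G (Suc q))" by (rule e_closed[OF k])
        have db: "d q (unit_vec R k) \<in> carrier (G q)" by (rule module_hom_closed[OF d_hom b])
        show "D (n + Suc q) (M' n (unit_vec R k) u) =
          M n (d q (unit_vec R k)) u \<oplus>\<^bsub>V\<^esub> sgn (Suc q) \<odot>\<^bsub>V\<^esub> M' (n - 1) (unit_vec R k) (D n u)"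
        proof (cases n)
          case 0
          have u0: "u \<in> carrier (G 0)" using u 0 by simp
          have c: "u 0 \<in> carrier R" by (rule coord_closed[OF u])
          have "D (n + Suc q) (M' n (unit_vec R k) u) = u 0 \<odot>\<^bsub>V\<^esub> d q (unit_vec R k)"
            using 0 M'3[OF k u] s0[OF k] hom_smult[OF d_hom c b] by simp
          also have "\<dots> = M 0 (d q (unit_vec R k)) (u 0 \<odot>\<^bsub>V\<^esub> ?e)"
            using hom_smult[OF M1[OF db] c e0_closed] M3[OF db] by simp
          also have "\<dots> = M n (d q (unit_vec R k)) u" using G0_eq[OF u0] 0 by simp
          also have "\<dots> = M n (d q (unit_vec R k)) u \<oplus>\<^bsub>V\<^esub> sgn (Suc q) \<odot>\<^bsub>V\<^esub> M' (n - 1) (unit_vec R k) (D n u)"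
            using 0 hom_zero[OF M'1[OF b, of 0]] in_V[OF module_hom_closed[OF M1[OF db] u]] by simp
          finally show ?thesis .
        next
          case (Suc i)
          then show ?thesis
            using s2[OF k, of u i] u M'3[OF k u] M'3[OF k Du] by simp
        qed
      qed
    qed
    have "A (Suc q) M'"
      unfolding A_def
    proof (intro conjI allI impI)
      fix n w u assume w: "w \<in> carrier (G (Suc q))" and u: "u \<in> carrier (G n)" and Dw: "D (Suc q) w = \<zero>\<^bsub>V\<^esub>"
      have "M' (n - 1) w (D n u) \<in> carrier V"
        using in_V[OF module_hom_closed[OF M'1[OF w] D_closed[OF u]]] .
      moreover have "M n (d q w) u = \<zero>\<^bsub>V\<^esub>" using hom_zero[OF M2[OF u]] Dw by simp
      ultimately show "D (n + Suc q) (M' n w u) = sgn (Suc q) \<odot>\<^bsub>V\<^esub> M' (n - 1) w (D n u)"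
        using rel w u unfolding B_def by simp
    qed (use M'1 M'2 unit in auto)
    then show "\<exists>M'. A (Suc q) M' \<and> B q M M'" using rel by blast
  qed
  then obtain \<mu> where mu: "\<And>q. A q (\<mu> q)" "\<And>q. B q (\<mu> q) (\<mu> (Suc q))" by blast
  note mu' = mu(1)[unfolded A_def]
  have mu1: "\<mu> q n w \<in> module_hom R (G n) (G (n + q))" if "w \<in> carrier (G q)" for q n w
    using mu'[of q] that by blast
  have mu2: "(\<lambda>w. \<mu> q n w u) \<in> module_hom R (G q) (G (n + q))" if "u \<in> carrier (G n)" for q n u
    using mu'[of q] that by blast
  have mu3: "\<mu> q 0 w ?e = w" if "w \<in> carrier (G q)" for q w
    using mu'[of q] that by blast
  have mu4: "D (n + q) (\<mu> q n w u) = sgn q \<odot>\<^bsub>V\<^esub> \<mu> q (n - 1) w (D n u)"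
    if "w \<in> carrier (G q)" "u \<in> carrier (G n)" "D q w = \<zero>\<^bsub>V\<^esub>" for q n w u
    using mu'[of q] that by blast
  have mu5: "\<mu> 0 n w u = w 0 \<odot>\<^bsub>V\<^esub> u" for n w u
    using mu'[of 0] by blast
  show thesis
  proof (rule that[of \<mu>])
    show "pairing 0 \<mu>"
      unfolding pairing_def
    proof (intro conjI allI impI)
      fix q n w u assume w: "w \<in> carrier (G q)" and u: "u \<in> carrier (G n)"
      show "D (n + q - 0) (\<mu> q n w u) = \<mu> (q - 1) n (D q w) u \<oplus>\<^bsub>V\<^esub> sgn q \<odot>\<^bsub>V\<^esub> \<mu> q (n - 1) w (D n u)"
      proof (cases q)
        case 0
        have "\<mu> 0 (n - 1) w (D n u) \<in> carrier V"
          using in_V[OF module_hom_closed[OF mu1 D_closed[OF u]]] w 0 by simp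
        moreover have "\<mu> 0 n \<zero>\<^bsub>V\<^esub> u = \<zero>\<^bsub>V\<^esub>" by (rule hom_zero[OF mu2[OF u]])
        ultimately show ?thesis using mu4[OF w u] 0 by simp
      next
        case (Suc p)
        then show ?thesis using mu(2)[of p] w u unfolding B_def by simp
      qed
    qed (use mu1 mu2 in auto)
    show "\<mu> 0 n ?e u = u" if "u \<in> carrier (G n)" for n u
      using that in_V[OF that] unfolding mu5 by (simp add: unit_vec_def)
  qed (rule mu3)
qed

section \<open>Elimination of basis vectors from the first argument of a pairing\<close>

lemma D_shift_hom: "D (t - N) \<in> module_hom R (shift N t) (shift N (t - 1))"
proof (cases "t \<le> N")
  case True
  then have "D (t - N) = (\<lambda>x. \<zero>\<^bsub>V\<^esub>)" by auto
  then show ?thesis by (simp only: zero_hom)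
next
  case False
  then have "\<not> t < N" "\<not> t - 1 < N" "t - 1 - N = t - N - 1" by auto
  then show ?thesis using D_hom[of "t - N"] by (simp only: if_False)
qed

lemma D_zero [simp]: "D j \<zero>\<^bsub>V\<^esub> = \<zero>\<^bsub>V\<^esub>"
  by (rule hom_zero[OF D_hom])

lemma pairing_diff:
  assumes "pairing N c" "pairing N c'"
  shows "pairing N (\<lambda>q j w u. c q j w u \<oplus>\<^bsub>V\<^esub> (\<ominus> \<one>) \<odot>\<^bsub>V\<^esub> c' q j w u)"
  unfolding pairing_def
proof (intro conjI allI impI)
  fix q j w u
  note c = pairingD[OF assms(1)] and c' = pairingD[OF assms(2)]
  have m: "\<ominus> \<one> \<in> carrier R" by simp
  show "(\<lambda>u. c q j w u \<oplus>\<^bsub>V\<^esub> (\<ominus> \<one>) \<odot>\<^bsub>V\<^esub> c' q j w u) \<in> module_hom R (G j) (shift N (j + q))"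
    if "w \<in> carrier (G q)"
    using module_hom_plus[OF vec_module c(1)[OF that] module_hom_scale[OF vec_module c'(1)[OF that] m]] by simp
  show "(\<lambda>w. c q j w u \<oplus>\<^bsub>V\<^esub> (\<ominus> \<one>) \<odot>\<^bsub>V\<^esub> c' q j w u) \<in> module_hom R (G q) (shift N (j + q))"
    if "u \<in> carrier (G j)"
    using module_hom_plus[OF vec_module c(2)[OF that] module_hom_scale[OF vec_module c'(2)[OF that] m]] by simp
  assume w: "w \<in> carrier (G q)" and u: "u \<in> carrier (G j)"
  note Dw = D_closed[OF w] and Du = D_closed[OF u]
  have V: "c (q - 1) j (D q w) u \<in> carrier V" "c' (q - 1) j (D q w) u \<in> carrier V"
    "c q (j - 1) w (D j u) \<in> carrier V" "c' q (j - 1) w (D j u) \<in> carrier V"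
    using c(5)[OF Dw u] c'(5)[OF Dw u] c(5)[OF w Du] c'(5)[OF w Du] .
  have "D (j + q - N) (c q j w u \<oplus>\<^bsub>V\<^esub> (\<ominus> \<one>) \<odot>\<^bsub>V\<^esub> c' q j w u) =
     D (j + q - N) (c q j w u) \<oplus>\<^bsub>V\<^esub> (\<ominus> \<one>) \<odot>\<^bsub>V\<^esub> D (j + q - N) (c' q j w u)"
    using hom_add[OF D_shift_hom c(4)[OF w u] vec_closed(3)[OF m c'(4)[OF w u]]]
      hom_smult[OF D_shift_hom m c'(4)[OF w u]] by simp
  also have "\<dots> = (c (q - 1) j (D q w) u \<oplus>\<^bsub>V\<^esub> sgn q \<odot>\<^bsub>V\<^esub> c q (j - 1) w (D j u)) \<oplus>\<^bsub>V\<^esub>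
     (\<ominus> \<one>) \<odot>\<^bsub>V\<^esub> (c' (q - 1) j (D q w) u \<oplus>\<^bsub>V\<^esub> sgn q \<odot>\<^bsub>V\<^esub> c' q (j - 1) w (D j u))"
    unfolding c(3)[OF w u] c'(3)[OF w u] ..
  also have "\<dots> = (c (q - 1) j (D q w) u \<oplus>\<^bsub>V\<^esub> (\<ominus> \<one>) \<odot>\<^bsub>V\<^esub> c' (q - 1) j (D q w) u) \<oplus>\<^bsub>V\<^esub>
      sgn q \<odot>\<^bsub>V\<^esub> (c q (j - 1) w (D j u) \<oplus>\<^bsub>V\<^esub> (\<ominus> \<one>) \<odot>\<^bsub>V\<^esub> c' q (j - 1) w (D j u))"
  proof -
    have "(\<ominus> \<one>) \<odot>\<^bsub>V\<^esub> (sgn q \<odot>\<^bsub>V\<^esub> x) = sgn q \<odot>\<^bsub>V\<^esub> ((\<ominus> \<one>) \<odot>\<^bsub>V\<^esub> x)" if "x \<in> carrier V" for x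
      using that V.smult_assoc1[OF m sgn_closed that, of q] V.smult_assoc1[OF sgn_closed m that, of q] m_comm[OF m sgn_closed, of q] by simp
    then show ?thesis using V m sgn_closed by (simp add: V.smult_r_distr V.M.a_ac)
  qed
  finally show "D (j + q - N) (c q j w u \<oplus>\<^bsub>V\<^esub> (\<ominus> \<one>) \<odot>\<^bsub>V\<^esub> c' q j w u) =
      (c (q - 1) j (D q w) u \<oplus>\<^bsub>V\<^esub> (\<ominus> \<one>) \<odot>\<^bsub>V\<^esub> c' (q - 1) j (D q w) u) \<oplus>\<^bsub>V\<^esub>
      sgn q \<odot>\<^bsub>V\<^esub> (c q (j - 1) w (D j u) \<oplus>\<^bsub>V\<^esub> (\<ominus> \<one>) \<odot>\<^bsub>V\<^esub> c' q (j - 1) w (D j u))" .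
qed

text \<open>The progress of the elimination. Basis vectors are ordered by degree and then by index,
  and those before position \<open>(q0, k)\<close> have been cleared, against second arguments of
  every degree.\<close>

definition vanishes_below where
  "vanishes_below c q0 k \<longleftrightarrow>
     (\<forall>q<q0. \<forall>j w u. w \<in> carrier (G q) \<longrightarrow> u \<in> carrier (G j) \<longrightarrow> c q j w u = \<zero>\<^bsub>V\<^esub>) \<and>
     (\<forall>i<k. \<forall>j u. u \<in> carrier (G j) \<longrightarrow> c q0 j (unit_vec R i) u = \<zero>\<^bsub>V\<^esub>)"

text \<open>The other Leibniz term has first argument \<open>D b\<close>, of degree
  \<open>q0 - 1\<close>, where \<open>c\<close> already vanishes; for \<open>q0 = 0\<close> the
  argument itself is zero.\<close>

lemma pairing_leading_chain_map:
  assumes c: "pairing N c" and v: "vanishes_below c q0 k" and b: "b \<in> carrier (G q0)" and y: "y \<in> carrier (G j)"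
  shows "D (j + q0 - N) (c q0 j b y) = sgn q0 \<odot>\<^bsub>V\<^esub> c q0 (j - 1) b (D j y)"
proof -
  have "c (q0 - 1) j (D q0 b) y = \<zero>\<^bsub>V\<^esub>"
  proof (cases q0)
    case 0
    then show ?thesis using pairingD(7)[OF c y] by simp
  next
    case (Suc q)
    have "D q0 b \<in> carrier (G q)" using D_closed[OF b] Suc by simp
    then show ?thesis using v y Suc unfolding vanishes_below_def by simp
  qed
  then show ?thesis
    using pairingD(3)[OF c b y] pairingD(5)[OF c b D_closed[OF y]] by simp
qed

text \<open>The pairing subtracted here is \<open>(w, u) \<mapsto> c (b, \<mu> (\<Lambda> w, u))\<close> for the first basis vector \<open>b\<close> on which \<open>c\<close>
  does not vanish; \<open>\<Lambda>\<close> is a chain map lifting the coordinate of \<open>b\<close>. All its values are values of the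
  chain map \<open>c (b, -)\<close>.\<close>

lemma pairing_reduce:
  assumes c: "pairing N c" and v: "vanishes_below c q0 k" and k: "k < r q0"
  obtains c' where "pairing N c'" "vanishes_below c' q0 (Suc k)"
    "\<And>q j w u. \<lbrakk>q0 \<le> q; w \<in> carrier (G q); u \<in> carrier (G j)\<rbrakk> \<Longrightarrow> \<exists>y\<in>carrier (G (j + (q - q0))).
       c q j w u = c' q j w u \<oplus>\<^bsub>V\<^esub> c q0 (j + (q - q0)) (unit_vec R k) y"
proof -
  let ?b = "unit_vec R k"
  have b: "?b \<in> carrier (G q0)" by (rule e_closed[OF k])
  obtain \<mu> where mu: "pairing 0 \<mu>" "\<And>n u. u \<in> carrier (G n) \<Longrightarrow> \<mu> 0 n (unit_vec R 0) u = u"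
    by (rule multiplication_exists) blast
  obtain \<Lambda> where L1: "\<And>j. \<Lambda> j \<in> module_hom R (G (j + q0)) (G j)"
    and L2: "\<And>w. w \<in> carrier (G q0) \<Longrightarrow> \<Lambda> 0 w = w k \<odot>\<^bsub>V\<^esub> unit_vec R 0"
    and L3: "\<And>j w. w \<in> carrier (G (j + q0)) \<Longrightarrow>
      D j (\<Lambda> j w) = sgn q0 \<odot>\<^bsub>V\<^esub> (if j = 0 then \<zero>\<^bsub>V\<^esub> else \<Lambda> (j - 1) (D (j + q0) w))"
    using coordinate_lift[OF k] by blast
  note mu1 = pairingD(1)[OF mu(1)] and mu2 = pairingD(2)[OF mu(1)] and mu3 = pairingD(3)[OF mu(1)]
    and mu4 = pairingD(4)[OF mu(1)] and mu6 = pairingD(6)[OF mu(1)] and mu7 = pairingD(7)[OF mu(1)]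
  \<comment> \<open>\<open>\<Lambda>\<close> starts in degree \<open>q0\<close>. Setting
    \<open>f\<close> to zero below keeps what has already been cleared.\<close>
  define f where "f q j w u = (if q < q0 then \<zero>\<^bsub>V\<^esub> else
     c q0 (j + (q - q0)) ?b (\<mu> (q - q0) j (\<Lambda> (q - q0) w) u))" for q j w u
  have f: "pairing N f"
    unfolding pairing_def
  proof (intro conjI allI impI)
    fix q j w assume w: "w \<in> carrier (G q)"
    show "f q j w \<in> module_hom R (G j) (shift N (j + q))"
    proof (cases "q < q0")
      case True
      then have "f q j w = (\<lambda>u. \<zero>\<^bsub>V\<^esub>)" by (auto simp: f_def)
      then show ?thesis by (simp only: zero_hom)
    next
      case False
      then obtain p where p: "q = p + q0" by (metis add.commute le_add_diff_inverse not_less)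
      have Lw: "\<Lambda> p w \<in> carrier (G p)" using module_hom_closed[OF L1] w p by simp
      have "\<mu> p j (\<Lambda> p w) \<in> module_hom R (G j) (G (j + p))" using mu1[OF Lw, of j] by simp
      have eq: "j + p + q0 = j + q" using p by simp
      have "(\<lambda>u. c q0 (j + p) ?b (\<mu> p j (\<Lambda> p w) u)) \<in> module_hom R (G j) (shift N (j + q))"
        using module_hom_comp[OF \<open>\<mu> p j (\<Lambda> p w) \<in> _\<close> pairingD(1)[OF c b]] unfolding eq .
      moreover have "f q j w = (\<lambda>u. c q0 (j + p) ?b (\<mu> p j (\<Lambda> p w) u))" using p by (auto simp: f_def)
      ultimately show ?thesis by simp
    qed
  next
    fix q j u assume u: "u \<in> carrier (G j)"
    show "(\<lambda>w. f q j w u) \<in> module_hom R (G q) (shift N (j + q))"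
    proof (cases "q < q0")
      case True
      then have "(\<lambda>w. f q j w u) = (\<lambda>u. \<zero>\<^bsub>V\<^esub>)" by (auto simp: f_def)
      then show ?thesis by (simp only: zero_hom)
    next
      case False
      then obtain p where p: "q = p + q0" by (metis add.commute le_add_diff_inverse not_less)
      have "(\<lambda>w. \<mu> p j w u) \<in> module_hom R (G p) (G (j + p))" using mu2[OF u, of p] by simp
      from module_hom_comp[OF L1 this]
      have h: "(\<lambda>w. \<mu> p j (\<Lambda> p w) u) \<in> module_hom R (G q) (G (j + p))" unfolding p .
      have eq: "j + p + q0 = j + q" using p by simp
      have "(\<lambda>w. c q0 (j + p) ?b (\<mu> p j (\<Lambda> p w) u)) \<in> module_hom R (G q) (shift N (j + q))"
        using module_hom_comp[OF h pairingD(1)[OF c b]] unfolding eq .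
      moreover have "(\<lambda>w. f q j w u) = (\<lambda>w. c q0 (j + p) ?b (\<mu> p j (\<Lambda> p w) u))" using p by (auto simp: f_def)
      ultimately show ?thesis by simp
    qed
  next
    fix q j w u assume w: "w \<in> carrier (G q)" and u: "u \<in> carrier (G j)"
    show "D (j + q - N) (f q j w u) = f (q - 1) j (D q w) u \<oplus>\<^bsub>V\<^esub> sgn q \<odot>\<^bsub>V\<^esub> f q (j - 1) w (D j u)"
    proof (cases "q < q0")
      case True
      then show ?thesis by (simp add: f_def less_imp_diff_less)
    next
      case False
      then obtain p where p: "q = p + q0" by (metis add.commute le_add_diff_inverse not_less)
      define Lw where "Lw = \<Lambda> p w"
      have Lw: "Lw \<in> carrier (G p)" unfolding Lw_def using module_hom_closed[OF L1] w p by simp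
      \<comment> \<open>This is \<open>D (\<Lambda> w)\<close> up to sign. It is zero for
        \<open>p = 0\<close>, in accordance with \<open>f\<close> being zero in degree
        \<open>q0 - 1\<close>.\<close>
      define dL where "dL = (if p = 0 then \<zero>\<^bsub>V\<^esub> else \<Lambda> (p - 1) (D q w))"
      have dL: "dL \<in> carrier (G (p - 1))"
      proof (cases p)
        case (Suc i)
        then have "D q w \<in> carrier (G (i + q0))" using D_closed[OF w] p by simp
        then show ?thesis using module_hom_closed[OF L1] Suc by (simp add: dL_def)
      qed (simp add: dL_def)
      define x where "x = \<mu> (p - 1) j dL u"
      define y where "y = \<mu> p (j - 1) Lw (D j u)"
      have muy: "\<mu> p j Lw u \<in> carrier (G (j + p))" using mu4[OF Lw u] by simp
      have x: "x \<in> carrier (G (j + p - 1))"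
      proof (cases p)
        case 0
        then show ?thesis using mu7[OF u] by (simp add: x_def dL_def)
      next
        case (Suc i)
        then show ?thesis using mu4[OF dL u] by (simp add: x_def)
      qed
      have y: "y \<in> carrier (G (j + p - 1))"
      proof (cases j)
        case 0
        then show ?thesis using mu6[OF Lw] by (simp add: y_def)
      next
        case (Suc i)
        then show ?thesis using mu4[OF Lw D_closed[OF u]] by (simp add: y_def)
      qed
      have Dy: "D (j + p) (\<mu> p j Lw u) = sgn q0 \<odot>\<^bsub>V\<^esub> x \<oplus>\<^bsub>V\<^esub> sgn p \<odot>\<^bsub>V\<^esub> y"
      proof -
        have "D p Lw = sgn q0 \<odot>\<^bsub>V\<^esub> dL" using L3[of w p] w p by (simp add: Lw_def dL_def)
        then have "\<mu> (p - 1) j (D p Lw) u = sgn q0 \<odot>\<^bsub>V\<^esub> x"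
          using hom_smult[OF mu2[OF u] sgn_closed dL] by (simp add: x_def)
        then show ?thesis using mu3[OF Lw u] by (simp add: y_def)
      qed
      let ?c = "c q0 (j + p - 1) ?b"
      note ch = pairingD(1)[OF c b, of "j + p - 1"]
      have cx: "?c x \<in> carrier V" and cy: "?c y \<in> carrier V"
        using pairingD(5)[OF c b x] pairingD(5)[OF c b y] .
      \<comment> \<open>The sign of \<open>c (b, -)\<close> cancels that of \<open>\<Lambda>\<close>
        in the term with \<open>x\<close> and combines with \<open>sgn p\<close> to
        \<open>sgn q\<close> in the term with \<open>y\<close>.\<close>
      have "D (j + q - N) (f q j w u) = sgn q0 \<odot>\<^bsub>V\<^esub> ?c (D (j + p) (\<mu> p j Lw u))"
        using pairing_leading_chain_map[OF c v b muy] p by (simp add: f_def Lw_def add.assoc)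
      also have "\<dots> = sgn q0 \<odot>\<^bsub>V\<^esub> (sgn q0 \<odot>\<^bsub>V\<^esub> ?c x \<oplus>\<^bsub>V\<^esub> sgn p \<odot>\<^bsub>V\<^esub> ?c y)"
        unfolding Dy using hom_add[OF ch vec_closed(3)[OF sgn_closed x] vec_closed(3)[OF sgn_closed y]]
          hom_smult[OF ch sgn_closed x] hom_smult[OF ch sgn_closed y] by simp
      also have "\<dots> = ?c x \<oplus>\<^bsub>V\<^esub> sgn q \<odot>\<^bsub>V\<^esub> ?c y"
        using cx cy sgn_sgn[OF cx] V.smult_assoc1[OF sgn_closed sgn_closed cy, of q0 p] sgn_mult[of q0 p] p
        by (simp add: V.smult_r_distr add.commute)
      also have "?c x = f (q - 1) j (D q w) u"
      proof (cases p)
        case 0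
        have x0: "x = \<zero>\<^bsub>V\<^esub>" using 0 mu7[OF u] by (simp add: x_def dL_def)
        \<comment> \<open>For \<open>q0 = 0\<close> truncation turns \<open>q - 1\<close> into 0,
          where \<open>f\<close> is not cut off; the value is still zero because \<open>D w\<close>
          is.\<close>
        have "f (q - 1) j (D q w) u = \<zero>\<^bsub>V\<^esub>"
        proof (cases q0)
          case 0
          then show ?thesis using \<open>p = 0\<close> p hom_zero[OF L1, of 0] mu7[OF u] pairingD(6)[OF c b] by (simp add: f_def)
        qed (use p 0 in \<open>simp add: f_def\<close>)
        then show ?thesis using x0 pairingD(6)[OF c b] by simp
      next
        case (Suc i)
        then show ?thesis using p by (simp add: f_def x_def dL_def)
      qed
      also have "?c y = f q (j - 1) w (D j u)"
      proof (cases j)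
        case 0
        have "y = \<zero>\<^bsub>V\<^esub>" using 0 mu6[OF Lw] by (simp add: y_def)
        then show ?thesis using 0 p mu6[OF Lw] pairingD(6)[OF c b] by (simp add: f_def Lw_def)
      next
        case (Suc i)
        then show ?thesis using p by (simp add: f_def y_def Lw_def)
      qed
      finally show ?thesis .
    qed
  qed
  let ?c' = "\<lambda>q j w u. c q j w u \<oplus>\<^bsub>V\<^esub> (\<ominus> \<one>) \<odot>\<^bsub>V\<^esub> f q j w u"
  have canc: "x \<oplus>\<^bsub>V\<^esub> (\<ominus> \<one>) \<odot>\<^bsub>V\<^esub> x = \<zero>\<^bsub>V\<^esub>" if "x \<in> carrier V" for x
    using that by (simp add: V.smult_l_minus V.M.r_neg)
  show thesis
  proof (rule that[of ?c'])
    show "pairing N ?c'" by (rule pairing_diff[OF c f])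
    show "vanishes_below ?c' q0 (Suc k)"
      unfolding vanishes_below_def
    proof (intro conjI allI impI)
      fix q j w u assume "q < q0" "w \<in> carrier (G q)" "u \<in> carrier (G j)"
      then show "?c' q j w u = \<zero>\<^bsub>V\<^esub>" using v by (simp add: f_def vanishes_below_def)
    next
      fix i j u assume i: "i < Suc k" and u: "u \<in> carrier (G j)"
      have e: "unit_vec R i \<in> carrier (G q0)" using i k by (intro e_closed) simp
      \<comment> \<open>On basis vectors of degree \<open>q0\<close> the map
        \<open>\<Lambda> 0\<close> is a Kronecker delta. With the left unit of \<open>\<mu>\<close>,
        \<open>f (b, -)\<close> equals \<open>c (b, -)\<close>, while \<open>f\<close> is zero at
        the basis vectors cleared before.\<close>
      have Li: "\<Lambda> 0 (unit_vec R i) = (if i = k then unit_vec R 0 else \<zero>\<^bsub>V\<^esub>)"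
        unfolding L2[OF e] using in_V[OF e0_closed] by (simp add: unit_vec_def)
      show "?c' q0 j (unit_vec R i) u = \<zero>\<^bsub>V\<^esub>"
      proof (cases "i = k")
        case True
        then show ?thesis using Li mu(2)[OF u] canc[OF pairingD(5)[OF c b u]] by (simp add: f_def)
      next
        case False
        then have "c q0 j (unit_vec R i) u = \<zero>\<^bsub>V\<^esub>" using v i u by (simp add: vanishes_below_def)
        moreover have "f q0 j (unit_vec R i) u = \<zero>\<^bsub>V\<^esub>"
          using False Li mu7[OF u] pairingD(6)[OF c b] by (simp add: f_def)
        ultimately show ?thesis by simp
      qed
    qed
    fix q j w u assume q: "q0 \<le> q" and w: "w \<in> carrier (G q)" and u: "u \<in> carrier (G j)"
    obtain p where p: "q = p + q0" using q by (metis add.commute le_add_diff_inverse)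
    have y: "\<mu> p j (\<Lambda> p w) u \<in> carrier (G (j + p))"
      using mu4[OF module_hom_closed[OF L1] u, of w p] w p by simp
    have fq: "f q j w u = c q0 (j + p) ?b (\<mu> p j (\<Lambda> p w) u)" using p by (simp add: f_def)
    note fV = pairingD(5)[OF f w u] and cV = pairingD(5)[OF c w u]
    have "?c' q j w u \<oplus>\<^bsub>V\<^esub> f q j w u = c q j w u"
      using fV cV by (simp add: V.smult_l_minus V.M.a_assoc V.M.l_neg)
    then show "\<exists>y\<in>carrier (G (j + (q - q0))). c q j w u = ?c' q j w u \<oplus>\<^bsub>V\<^esub> c q0 (j + (q - q0)) ?b y"
      using y fq p by (intro bexI[of _ "\<mu> p j (\<Lambda> p w) u"]) simp_all
  qed
qed

text \<open>A version of \<open>boundary_lift\<close> for a single element \<open>y\<close>, made so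
  as to be additive in \<open>y\<close>. In the application \<open>I\<close> annihilates
  \<open>m\<close>, so every \<open>t y\<close> is killed by \<open>m\<close>; hence the
  name.\<close>

definition socle_multiples_lift :: "'a set \<Rightarrow> 'a set \<Rightarrow> nat \<Rightarrow> (nat \<Rightarrow> 'a) \<Rightarrow> bool" where
  "socle_multiples_lift I J i y \<longleftrightarrow>
     y \<in> carrier (G i) \<and> (\<forall>t\<in>I. \<exists>x\<in>ideal_smult J (G (Suc i)). d i x = t \<odot>\<^bsub>V\<^esub> y)"

lemma socle_multiples_lift_add:
  assumes "J \<subseteq> carrier R" "I \<subseteq> carrier R" "socle_multiples_lift I J i y" "socle_multiples_lift I J i z"
  shows "socle_multiples_lift I J i (y \<oplus>\<^bsub>V\<^esub> z)"
  unfolding socle_multiples_lift_def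
proof (intro conjI ballI)
  interpret Gi: module R "G (Suc i)" by (rule vec_module)
  have yz: "y \<in> carrier (G i)" "z \<in> carrier (G i)" using assms(3,4) by (auto simp: socle_multiples_lift_def)
  then show "y \<oplus>\<^bsub>V\<^esub> z \<in> carrier (G i)" by simp
  fix t assume t: "t \<in> I"
  obtain x where x: "x \<in> ideal_smult J (G (Suc i))" "d i x = t \<odot>\<^bsub>V\<^esub> y"
    using assms(3) t by (auto simp: socle_multiples_lift_def)
  obtain x' where x': "x' \<in> ideal_smult J (G (Suc i))" "d i x' = t \<odot>\<^bsub>V\<^esub> z"
    using assms(4) t by (auto simp: socle_multiples_lift_def)
  have "x \<oplus>\<^bsub>V\<^esub> x' \<in> ideal_smult J (G (Suc i))"
    using Gi.ideal_smult_add[OF assms(1) x(1) x'(1)] by simp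
  moreover have "d i (x \<oplus>\<^bsub>V\<^esub> x') = t \<odot>\<^bsub>V\<^esub> (y \<oplus>\<^bsub>V\<^esub> z)"
    using hom_add[OF d_hom Gi.ideal_smult_closed[OF assms(1) x(1)] Gi.ideal_smult_closed[OF assms(1) x'(1)]]
      V.smult_r_distr[of t y z] t assms(2) yz[THEN in_V] x(2) x'(2) by auto
  ultimately show "\<exists>x\<in>ideal_smult J (G (Suc i)). d i x = t \<odot>\<^bsub>V\<^esub> (y \<oplus>\<^bsub>V\<^esub> z)" by blast
qed

lemma socle_multiples_lift_zero: "I \<subseteq> carrier R \<Longrightarrow> socle_multiples_lift I J i \<zero>\<^bsub>V\<^esub>"
  unfolding socle_multiples_lift_def
  using ideal_smult.zero[of "G (Suc i)" J] hom_zero[OF d_hom, of i]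
  by (auto simp: subset_iff intro!: bexI[of _ "\<zero>\<^bsub>V\<^esub>"])

text \<open>\<open>c q0 j b\<close> is the chain map \<open>\<theta>\<close> of the overview, from
  degree \<open>j\<close> to degree \<open>i = j + q0 - N\<close>. Positivity of \<open>j\<close> is
  what turns the cycle \<open>t z\<close> into a boundary.\<close>

lemma socle_multiples_lift_value:
  assumes I: "I \<subseteq> carrier R" "\<And>t a. \<lbrakk>t \<in> I; a \<in> m\<rbrakk> \<Longrightarrow> t \<otimes> a = \<zero>" and J: "J \<subseteq> carrier R"
    and bl: "boundary_lift I J G d j" and "j > 0" "j + q0 = i + N"
    and c: "pairing N c" and v: "vanishes_below c q0 k" and b: "b \<in> carrier (G q0)" and z: "z \<in> carrier (G j)"
  shows "socle_multiples_lift I J i (c q0 j b z)"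
  unfolding socle_multiples_lift_def
proof (intro conjI ballI)
  interpret Gj: module R "G j" by (rule vec_module)
  interpret Gs: module R "G (Suc j)" by (rule vec_module)
  have sh: "shift N (j + q0) = G i" "shift N (Suc j + q0) = G (Suc i)" using assms(6) by simp_all
  have ch: "c q0 j b \<in> module_hom R (G j) (G i)" "c q0 (Suc j) b \<in> module_hom R (G (Suc j)) (G (Suc i))"
    using pairingD(1)[OF c b, of j] pairingD(1)[OF c b, of "Suc j"] unfolding sh .
  show "c q0 j b z \<in> carrier (G i)" by (rule module_hom_closed[OF ch(1) z])
  fix t assume t: "t \<in> I"
  have tc: "t \<in> carrier R" using t I(1) by blast
  obtain j' where j': "j = Suc j'" using \<open>j > 0\<close> by (cases j) auto
  have tz: "t \<odot>\<^bsub>V\<^esub> z \<in> carrier (G j)" using tc z by simp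
  have "t \<otimes> d j' z k = \<zero>" for k using I(2)[OF t minimal] z j' by simp
  then have "d j' (t \<odot>\<^bsub>V\<^esub> z) = \<zero>\<^bsub>V\<^esub>"
    using hom_smult[OF d_hom tc, of z j'] z j' by (simp add: vec_module_simps)
  then obtain w where w: "w \<in> carrier (G (Suc j))" "t \<odot>\<^bsub>V\<^esub> z = d j w"
    using exact[of "t \<odot>\<^bsub>V\<^esub> z" j'] tz j' by auto
  have "d j w \<in> ideal_smult I (G j)" using Gj.ideal_smultI[OF I(1) t z] w(2) by simp
  then obtain w0 where w0: "w0 \<in> ideal_smult J (G (Suc j))" "d j w0 = t \<odot>\<^bsub>V\<^esub> z"
    using bl w unfolding boundary_lift_def by metis
  have w0c: "w0 \<in> carrier (G (Suc j))" by (rule Gs.ideal_smult_closed[OF J w0(1)])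
  have cz: "c q0 j b z \<in> carrier V" by (rule pairingD(5)[OF c b z])
  \<comment> \<open>The factor undoes the sign with which \<open>c (b, -)\<close> commutes with the
    differentials.\<close>
  let ?x = "sgn q0 \<odot>\<^bsub>V\<^esub> c q0 (Suc j) b w0"
  have "?x \<in> ideal_smult J (G (Suc i))"
    using module.ideal_smult_smult[OF vec_module J sgn_closed module_hom_ideal_smult[OF vec_module vec_module ch(2) J w0(1)]]
    by simp
  moreover have "d i ?x = t \<odot>\<^bsub>V\<^esub> c q0 j b z"
  proof -
    have "Suc j + q0 - N = Suc i" using assms(6) by simp
    then have "d i (c q0 (Suc j) b w0) = sgn q0 \<odot>\<^bsub>V\<^esub> c q0 j b (t \<odot>\<^bsub>V\<^esub> z)"
      using pairing_leading_chain_map[OF c v b w0c] w0(2) by simp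
    then have "d i ?x = sgn q0 \<odot>\<^bsub>V\<^esub> (sgn q0 \<odot>\<^bsub>V\<^esub> (t \<odot>\<^bsub>V\<^esub> c q0 j b z))"
      using hom_smult[OF d_hom sgn_closed module_hom_closed[OF ch(2) w0c]] hom_smult[OF ch(1) tc z] by simp
    then show ?thesis using sgn_sgn tc cz by simp
  qed
  ultimately show "\<exists>x\<in>ideal_smult J (G (Suc i)). d i x = t \<odot>\<^bsub>V\<^esub> c q0 j b z" by blast
qed

text \<open>Downward induction on the position \<open>(q0, k)\<close> up to which \<open>c\<close>
  has been cleared, for all \<open>c\<close> at once because each reduction replaces the pairing.
  When all degrees up to \<open>i\<close> are cleared, the value \<open>c i N w u\<close> is zero.
  Each reduction splits off one value of a chain map, and the property is additive.\<close>

lemma socle_multiples_lift_pairing: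
  assumes I: "I \<subseteq> carrier R" "\<And>t a. \<lbrakk>t \<in> I; a \<in> m\<rbrakk> \<Longrightarrow> t \<otimes> a = \<zero>" and J: "J \<subseteq> carrier R"
    and bl: "\<And>j. j \<ge> N \<Longrightarrow> boundary_lift I J G d j" and N: "N > 0"
    and w: "w \<in> carrier (G i)" and u: "u \<in> carrier (G N)" and c: "pairing N c"
  shows "socle_multiples_lift I J i (c i N w u)"
proof -
  have "\<forall>c. pairing N c \<longrightarrow> vanishes_below c q0 0 \<longrightarrow> socle_multiples_lift I J i (c i N w u)"
    if "q0 \<le> Suc i" for q0
    using that
  proof (induction rule: inc_induct)
    case base
    show ?case
      using w u socle_multiples_lift_zero[OF I(1)] by (auto simp: vanishes_below_def)
  next
    case (step q0)
    have "\<forall>c. pairing N c \<longrightarrow> vanishes_below c q0 k \<longrightarrow> socle_multiples_lift I J i (c i N w u)"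
      if "k \<le> r q0" for k
      using that
    proof (induction rule: inc_induct)
      case base
      show ?case
      proof (intro allI impI)
        fix c assume c: "pairing N c" and v: "vanishes_below c q0 (r q0)"
        \<comment> \<open>By linearity, vanishing on all basis vectors of degree \<open>q0\<close>
          is vanishing on \<open>G q0\<close>, so the elimination passes to degree
          \<open>q0 + 1\<close>.\<close>
        have "c q0 j w u = \<zero>\<^bsub>V\<^esub>" if w: "w \<in> carrier (G q0)" and u: "u \<in> carrier (G j)" for j w u
          by (rule vec_hom_ext[OF finite_lessThan vec_module pairingD(2)[OF c u] zero_hom _ w])
            (use v u in \<open>auto simp: vanishes_below_def\<close>)
        then have "vanishes_below c (Suc q0) 0"
          using v by (auto simp: vanishes_below_def less_Suc_eq)
        then show "socle_multiples_lift I J i (c i N w u)" using step.IH c by blast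
      qed
    next
      case (step k)
      show ?case
      proof (intro allI impI)
        fix c assume c: "pairing N c" and v: "vanishes_below c q0 k"
        have q0: "q0 \<le> i" using \<open>q0 < Suc i\<close> by simp
        obtain c' where c': "pairing N c'" "vanishes_below c' q0 (Suc k)"
          "\<And>q j w u. \<lbrakk>q0 \<le> q; w \<in> carrier (G q); u \<in> carrier (G j)\<rbrakk> \<Longrightarrow> \<exists>y\<in>carrier (G (j + (q - q0))).
             c q j w u = c' q j w u \<oplus>\<^bsub>V\<^esub> c q0 (j + (q - q0)) (unit_vec R k) y"
          using pairing_reduce[OF c v \<open>k < r q0\<close>] by blast
        \<comment> \<open>The value split off comes from a degree that is at least \<open>N\<close>,
          where lifting is assumed.\<close>
        obtain y where y: "y \<in> carrier (G (N + (i - q0)))"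
          "c i N w u = c' i N w u \<oplus>\<^bsub>V\<^esub> c q0 (N + (i - q0)) (unit_vec R k) y"
          using c'(3)[OF q0 w u] by blast
        have "socle_multiples_lift I J i (c q0 (N + (i - q0)) (unit_vec R k) y)"
          by (rule socle_multiples_lift_value[OF I J bl _ _ c v e_closed[OF \<open>k < r q0\<close>] y(1)]) (use N q0 in auto)
        moreover have "socle_multiples_lift I J i (c' i N w u)" using step.IH c'(1,2) by blast
        ultimately show "socle_multiples_lift I J i (c i N w u)"
          unfolding y(2) by (intro socle_multiples_lift_add I(1) J)
      qed
    qed
    from this[of 0] show ?case by simp
  qed
  moreover have "vanishes_below c 0 0" by (simp add: vanishes_below_def)
  ultimately show ?thesis using c by blast
qed

text \<open>The pairing is \<open>\<mu> (w, h u)\<close>, with \<open>h\<close> lifting a coordinate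
  of \<open>G N\<close>; positive ranks provide one. Then \<open>h\<close> sends the corresponding
  basis vector to 1, and the right unit of \<open>\<mu>\<close> gives the value \<open>w\<close>. An
  odd \<open>N\<close> would put an extra sign on the second Leibniz term.\<close>

lemma unit_value_pairing:
  assumes N: "even N" "N > 0"
  obtains c where "pairing N c" "\<And>q w. w \<in> carrier (G q) \<Longrightarrow> c q N w (unit_vec R 0) = w"
proof -
  obtain \<mu> where mu: "pairing 0 \<mu>" "\<And>q w. w \<in> carrier (G q) \<Longrightarrow> \<mu> q 0 w (unit_vec R 0) = w"
    by (rule multiplication_exists) blast
  obtain h where h1: "\<And>j. h j \<in> module_hom R (G (j + N)) (G j)"
    and h2: "\<And>w. w \<in> carrier (G N) \<Longrightarrow> h 0 w = w 0 \<odot>\<^bsub>V\<^esub> unit_vec R 0"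
    and h3: "\<And>j w. w \<in> carrier (G (j + N)) \<Longrightarrow>
      D j (h j w) = sgn N \<odot>\<^bsub>V\<^esub> (if j = 0 then \<zero>\<^bsub>V\<^esub> else h (j - 1) (D (j + N) w))"
    using coordinate_lift[OF rpos] by blast
  have sN: "sgn N = \<one>" using N by (simp add: sgn_def)
  note mu1 = pairingD(1)[OF mu(1)] and mu2 = pairingD(2)[OF mu(1)] and mu3 = pairingD(3)[OF mu(1)]
    and mu6 = pairingD(6)[OF mu(1)]
  define c where "c q j w u = (if j < N then \<zero>\<^bsub>V\<^esub> else \<mu> q (j - N) w (h (j - N) u))" for q j w u
  show thesis
  proof (rule that[of c])
    show "pairing N c"
      unfolding pairing_def
    proof (intro conjI allI impI)
      fix q j w assume w: "w \<in> carrier (G q)"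
      show "c q j w \<in> module_hom R (G j) (shift N (j + q))"
      proof (cases "j < N")
        case True
        then have "c q j w = (\<lambda>u. \<zero>\<^bsub>V\<^esub>)" by (auto simp: c_def)
        then show ?thesis by (simp only: zero_hom)
      next
        case False
        then obtain p where p: "j = p + N" by (metis add.commute le_add_diff_inverse not_less)
        have eq: "shift N (j + q) = shift 0 (p + q)" using p by simp
        have "(\<lambda>u. \<mu> q p w (h p u)) \<in> module_hom R (G j) (shift N (j + q))"
          using module_hom_comp[OF h1 mu1[OF w]] unfolding eq unfolding p .
        moreover have "c q j w = (\<lambda>u. \<mu> q p w (h p u))" using p by (auto simp: c_def)
        ultimately show ?thesis by simp
      qed
    next
      fix q j u assume u: "u \<in> carrier (G j)"
      show "(\<lambda>w. c q j w u) \<in> module_hom R (G q) (shift N (j + q))"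
      proof (cases "j < N")
        case True
        then have "(\<lambda>w. c q j w u) = (\<lambda>u. \<zero>\<^bsub>V\<^esub>)" by (auto simp: c_def)
        then show ?thesis by (simp only: zero_hom)
      next
        case False
        then obtain p where p: "j = p + N" by (metis add.commute le_add_diff_inverse not_less)
        have eq: "shift N (j + q) = shift 0 (p + q)" using p by simp
        have hu: "h p u \<in> carrier (G p)" using module_hom_closed[OF h1] u p by simp
        have "(\<lambda>w. \<mu> q p w (h p u)) \<in> module_hom R (G q) (shift N (j + q))"
          using mu2[OF hu] unfolding eq .
        moreover have "(\<lambda>w. c q j w u) = (\<lambda>w. \<mu> q p w (h p u))" using p by (auto simp: c_def)
        ultimately show ?thesis by simp
      qed
    next
      fix q j w u assume w: "w \<in> carrier (G q)" and u: "u \<in> carrier (G j)"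
      show "D (j + q - N) (c q j w u) = c (q - 1) j (D q w) u \<oplus>\<^bsub>V\<^esub> sgn q \<odot>\<^bsub>V\<^esub> c q (j - 1) w (D j u)"
      proof (cases "j < N")
        case True
        then show ?thesis by (simp add: c_def less_imp_diff_less)
      next
        case False
        then obtain p where p: "j = p + N" by (metis add.commute le_add_diff_inverse not_less)
        have hu: "h p u \<in> carrier (G p)" using module_hom_closed[OF h1] u p by simp
        have Dh: "D p (h p u) = (if p = 0 then \<zero>\<^bsub>V\<^esub> else h (p - 1) (D j u))"
        proof (cases p)
          case (Suc i)
          have "D j u \<in> carrier (G (i + N))" using D_closed[OF u] p Suc by simp
          then have "h i (D j u) \<in> carrier V" using in_V[OF module_hom_closed[OF h1]] by blast
          then show ?thesis using h3[of u p] u p sN Suc by simp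
        qed simp
        have "\<mu> q (p - 1) w (D p (h p u)) = c q (j - 1) w (D j u)"
        proof (cases p)
          case 0
          then show ?thesis using p N(2) mu6[OF w] by (simp add: c_def)
        next
          case (Suc i)
          then show ?thesis unfolding Dh using p by (simp add: c_def)
        qed
        then show ?thesis using mu3[OF w hu] p by (simp add: c_def)
      qed
    qed
    show "c q N w (unit_vec R 0) = w" if w: "w \<in> carrier (G q)" for q w
      using h2[OF e0_closed] in_V[OF e0_closed] mu(2)[OF w] by (simp add: c_def) (simp add: unit_vec_def)
  qed
qed

text \<open>Every \<open>w\<close> is a value of the pairing with the unit property, so each
  \<open>t w\<close> lifts, and so do sums of such elements. This yields more than the criterion:
  all of \<open>I G\<close> in degree \<open>i\<close>, boundary or not, is hit by
  \<open>J G\<close> in degree \<open>i + 1\<close>.\<close>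

lemma boundary_lift_all:
  assumes I: "I \<subseteq> carrier R" "\<And>t a. \<lbrakk>t \<in> I; a \<in> m\<rbrakk> \<Longrightarrow> t \<otimes> a = \<zero>" and J: "J \<subseteq> carrier R"
    and bl: "\<And>j. j \<ge> N0 \<Longrightarrow> boundary_lift I J G d j"
  shows "boundary_lift I J G d i"
proof -
  \<comment> \<open>Even and positive for \<open>unit_value_pairing\<close>, and at least
    \<open>N0\<close> for the hypothesis.\<close>
  define N where "N = 2 * Suc N0"
  have N: "even N" "N > 0" by (simp_all add: N_def)
  obtain c where c: "pairing N c" "\<And>q w. w \<in> carrier (G q) \<Longrightarrow> c q N w (unit_vec R 0) = w"
    using unit_value_pairing[OF N] by blast
  have sl: "socle_multiples_lift I J i w" if w: "w \<in> carrier (G i)" for w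
  proof -
    have "socle_multiples_lift I J i (c i N w (unit_vec R 0))"
      by (rule socle_multiples_lift_pairing[OF I J bl N(2) w e0_closed c(1)]) (auto simp: N_def)
    then show ?thesis using c(2)[OF w] by simp
  qed
  interpret Gi: module R "G (Suc i)" by (rule vec_module)
  have "\<exists>x\<in>ideal_smult J (G (Suc i)). d i x = z" if "z \<in> ideal_smult I (G i)" for z
    using that
  proof induction
    case zero
    then show ?case
      using ideal_smult.zero[of "G (Suc i)" J] hom_zero[OF d_hom, of i] by auto
  next
    case (step t w z)
    obtain x where x: "x \<in> ideal_smult J (G (Suc i))" "d i x = z" using step by blast
    obtain y where y: "y \<in> ideal_smult J (G (Suc i))" "d i y = t \<odot>\<^bsub>V\<^esub> w"
      using sl[OF step(2)] step(1) by (auto simp: socle_multiples_lift_def)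
    have "x \<oplus>\<^bsub>V\<^esub> y \<in> ideal_smult J (G (Suc i))" using Gi.ideal_smult_add[OF J x(1) y(1)] by simp
    moreover have "d i (x \<oplus>\<^bsub>V\<^esub> y) = z \<oplus>\<^bsub>V\<^esub> t \<odot>\<^bsub>V\<^esub> w"
      using hom_add[OF d_hom Gi.ideal_smult_closed[OF J x(1)] Gi.ideal_smult_closed[OF J y(1)]] x(2) y(2) by simp
    ultimately show ?case by auto
  qed
  then show ?thesis unfolding boundary_lift_def by blast
qed

end

section \<open>Tensor products with cyclic modules\<close>

text \<open>The class of \<open>x \<otimes> 1\<close>. As \<open>R / I\<close> is generated by the
  class of 1, these classes exhaust the tensor product.\<close>

definition pure_tensor :: "('a, 'b) ring_scheme \<Rightarrow> ('a, 'm, 'c) module_scheme \<Rightarrow> 'a set \<Rightarrow> 'm \<Rightarrow> (('m \<times> 'a set) \<Rightarrow>\<^sub>0 int) set" where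
  "pure_tensor R M I x = tensor_subgroup R M (quotient_module R I)
     #>\<^bsub>free_Abelian_group (carrier M \<times> carrier (quotient_module R I))\<^esub> frag_of (x, I +>\<^bsub>R\<^esub> \<one>\<^bsub>R\<^esub>)"

lemma tensor_subgroup_subgroup:
  assumes "module R M" "module R N"
  shows "subgroup (tensor_subgroup R M N) (free_Abelian_group (carrier M \<times> carrier N))"
    and "tensor_relators R M N \<subseteq> carrier (free_Abelian_group (carrier M \<times> carrier N))"
proof -
  interpret M: module R M by fact
  interpret N: module R N by fact
  show rel: "tensor_relators R M N \<subseteq> carrier (free_Abelian_group (carrier M \<times> carrier N))"
    unfolding tensor_relators_def
    by (auto simp del: carrier_free_Abelian_group_iff intro!: group.inv_closed simp flip: carrier_free_Abelian_group_iff)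
      (auto dest!: subsetD[OF keys_diff])
  show "subgroup (tensor_subgroup R M N) (free_Abelian_group (carrier M \<times> carrier N))"
    unfolding tensor_subgroup_def by (rule group.generate_is_subgroup[OF group_free_Abelian_group rel])
qed

lemma free_Abelian_subgroupD:
  assumes "subgroup S (free_Abelian_group B)"
  shows "0 \<in> S" "\<lbrakk>a \<in> S; b \<in> S\<rbrakk> \<Longrightarrow> a + b \<in> S" "a \<in> S \<Longrightarrow> - a \<in> S" "\<lbrakk>a \<in> S; b \<in> S\<rbrakk> \<Longrightarrow> a - b \<in> S"
    "a \<in> S \<Longrightarrow> a \<in> carrier (free_Abelian_group B)"
proof -
  show 1: "0 \<in> S" using subgroup.one_closed[OF assms] by simp
  show 2: "\<lbrakk>a \<in> S; b \<in> S\<rbrakk> \<Longrightarrow> a + b \<in> S" for a b using subgroup.m_closed[OF assms] by simp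
  show 5: "a \<in> S \<Longrightarrow> a \<in> carrier (free_Abelian_group B)" for a by (rule subgroup.mem_carrier[OF assms])
  show 3: "a \<in> S \<Longrightarrow> - a \<in> S" for a
    using subgroup.m_inv_closed[OF assms, of a] 5[of a] by simp
  show "\<lbrakk>a \<in> S; b \<in> S\<rbrakk> \<Longrightarrow> a - b \<in> S" using 2[OF _ 3] by fastforce
qed

lemma free_Abelian_coset_eq_iff:
  assumes "subgroup S (free_Abelian_group B)"
  shows "S #>\<^bsub>free_Abelian_group B\<^esub> a = S #>\<^bsub>free_Abelian_group B\<^esub> b \<longleftrightarrow> a - b \<in> S"
proof
  note S = free_Abelian_subgroupD[OF assms]
  have c: "S #>\<^bsub>free_Abelian_group B\<^esub> a = {s + a | s. s \<in> S}" for a by (auto simp: r_coset_def)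
  {
    assume "S #>\<^bsub>free_Abelian_group B\<^esub> a = S #>\<^bsub>free_Abelian_group B\<^esub> b"
    moreover have "a \<in> S #>\<^bsub>free_Abelian_group B\<^esub> a" unfolding c using S(1) by force
    ultimately obtain s where "s \<in> S" "a = s + b" unfolding c by blast
    then show "a - b \<in> S" by simp
  }
  assume ab: "a - b \<in> S"
  have "s + a = (s + (a - b)) + b" "s + b = (s - (a - b)) + a" for s by simp_all
  then show "S #>\<^bsub>free_Abelian_group B\<^esub> a = S #>\<^bsub>free_Abelian_group B\<^esub> b"
    unfolding c using S(2)[OF _ ab] S(4)[OF _ ab] by blast
qed

lemma tensor_relatorI:
  shows "\<lbrakk>x \<in> carrier M; x' \<in> carrier M; y \<in> carrier N\<rbrakk> \<Longrightarrow>
      frag_of (x \<oplus>\<^bsub>M\<^esub> x', y) - frag_of (x, y) - frag_of (x', y) \<in> tensor_relators R M N"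
    and "\<lbrakk>x \<in> carrier M; y \<in> carrier N; y' \<in> carrier N\<rbrakk> \<Longrightarrow>
      frag_of (x, y \<oplus>\<^bsub>N\<^esub> y') - frag_of (x, y) - frag_of (x, y') \<in> tensor_relators R M N"
    and "\<lbrakk>a \<in> carrier R; x \<in> carrier M; y \<in> carrier N\<rbrakk> \<Longrightarrow>
      frag_of (a \<odot>\<^bsub>M\<^esub> x, y) - frag_of (x, a \<odot>\<^bsub>N\<^esub> y) \<in> tensor_relators R M N"
  unfolding tensor_relators_def by blast+

lemma tensor_relatorE:
  assumes "z \<in> tensor_relators R M N"
    and "\<And>x x' y. \<lbrakk>x \<in> carrier M; x' \<in> carrier M; y \<in> carrier N\<rbrakk> \<Longrightarrow> P (frag_of (x \<oplus>\<^bsub>M\<^esub> x', y) - frag_of (x, y) - frag_of (x', y))"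
    and "\<And>x y y'. \<lbrakk>x \<in> carrier M; y \<in> carrier N; y' \<in> carrier N\<rbrakk> \<Longrightarrow> P (frag_of (x, y \<oplus>\<^bsub>N\<^esub> y') - frag_of (x, y) - frag_of (x, y'))"
    and "\<And>a x y. \<lbrakk>a \<in> carrier R; x \<in> carrier M; y \<in> carrier N\<rbrakk> \<Longrightarrow> P (frag_of (a \<odot>\<^bsub>M\<^esub> x, y) - frag_of (x, a \<odot>\<^bsub>N\<^esub> y))"
  shows "P z"
  using assms(1) unfolding tensor_relators_def
proof (elim UnE)
  assume "z \<in> {frag_of (x \<oplus>\<^bsub>M\<^esub> x', y) - frag_of (x, y) - frag_of (x', y) | x x' y.
        x \<in> carrier M \<and> x' \<in> carrier M \<and> y \<in> carrier N}"
  then show ?thesis using assms(2) by blast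
next
  assume "z \<in> {frag_of (x, y \<oplus>\<^bsub>N\<^esub> y') - frag_of (x, y) - frag_of (x, y') | x y y'.
        x \<in> carrier M \<and> y \<in> carrier N \<and> y' \<in> carrier N}"
  then show ?thesis using assms(3) by blast
next
  assume "z \<in> {frag_of (r \<odot>\<^bsub>M\<^esub> x, y) - frag_of (x, r \<odot>\<^bsub>N\<^esub> y) | r x y.
        r \<in> carrier R \<and> x \<in> carrier M \<and> y \<in> carrier N}"
  then show ?thesis using assms(4) by blast
qed

lemma tensor_relators_in_subgroup:
  assumes "module R M" "module R N" "z \<in> tensor_relators R M N"
  shows "z \<in> tensor_subgroup R M N"
  unfolding tensor_subgroup_def using assms(3) by (rule generate.incl)

lemma tensor_subgroup_minimal:
  assumes "module R M" "module R N" "subgroup H (free_Abelian_group (carrier M \<times> carrier N))"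
    and "tensor_relators R M N \<subseteq> H"
  shows "tensor_subgroup R M N \<subseteq> H"
  unfolding tensor_subgroup_def
  by (rule group.generate_subgroup_incl[OF group_free_Abelian_group assms(4,3)])

text \<open>The subgroup of the relators is mapped into itself, so a tensor product of homomorphisms is computed
  on any representative of a coset.\<close>

lemma tensor_map_coset:
  assumes mod: "module R M" "module R N" "module R M'" "module R N'"
    and f: "f \<in> module_hom R M M'" and g: "g \<in> module_hom R N N'"
  shows "tensor_map R M' N' f g (tensor_subgroup R M N #>\<^bsub>free_Abelian_group (carrier M \<times> carrier N)\<^esub> a) =
    tensor_subgroup R M' N' #>\<^bsub>free_Abelian_group (carrier M' \<times> carrier N')\<^esub> frag_extend (\<lambda>(x, y). frag_of (f x, g y)) a"
proof -
  let ?A = "free_Abelian_group (carrier M \<times> carrier N)" and ?A' = "free_Abelian_group (carrier M' \<times> carrier N')"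
  let ?S = "tensor_subgroup R M N" and ?S' = "tensor_subgroup R M' N'"
  let ?F = "frag_extend (\<lambda>(x, y). frag_of (f x, g y))"
  have sS: "subgroup ?S ?A" and sS': "subgroup ?S' ?A'"
    using tensor_subgroup_subgroup[OF mod(1,2)] tensor_subgroup_subgroup[OF mod(3,4)] by auto
  note S = free_Abelian_subgroupD[OF sS] and S' = free_Abelian_subgroupD[OF sS']
  interpret A: group ?A by simp
  have "?S \<subseteq> {z \<in> carrier ?A. ?F z \<in> ?S'}"
  proof (rule tensor_subgroup_minimal[OF mod(1,2)])
    show "subgroup {z \<in> carrier ?A. ?F z \<in> ?S'} ?A"
    proof (rule A.subgroupI)
      show "{z \<in> carrier ?A. ?F z \<in> ?S'} \<noteq> {}" using S'(1) by (auto intro!: exI[of _ 0])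
      show "inv\<^bsub>?A\<^esub> z \<in> {z \<in> carrier ?A. ?F z \<in> ?S'}" if "z \<in> {z \<in> carrier ?A. ?F z \<in> ?S'}" for z
        using that S'(3) by (auto simp: frag_extend_minus)
      show "z \<otimes>\<^bsub>?A\<^esub> y \<in> {z \<in> carrier ?A. ?F z \<in> ?S'}"
        if "z \<in> {z \<in> carrier ?A. ?F z \<in> ?S'}" "y \<in> {z \<in> carrier ?A. ?F z \<in> ?S'}" for z y
        using that S'(2) A.m_closed[of z y] by (auto simp: frag_extend_add simp del: carrier_free_Abelian_group_iff)
    qed auto
    show "tensor_relators R M N \<subseteq> {z \<in> carrier ?A. ?F z \<in> ?S'}"
    proof
      fix z assume z: "z \<in> tensor_relators R M N"
      then have "?F z \<in> tensor_relators R M' N'"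
        by (rule tensor_relatorE)
          (simp_all add: frag_extend_diff module_homD[OF f] module_homD[OF g] tensor_relatorI)
      then show "z \<in> {z \<in> carrier ?A. ?F z \<in> ?S'}"
        using tensor_relators_in_subgroup[OF mod(3,4)] z tensor_subgroup_subgroup(2)[OF mod(1,2)] by blast
    qed
  qed
  then have FS: "?F s \<in> ?S'" if "s \<in> ?S" for s using that by blast
  have "?S' <#>\<^bsub>?A'\<^esub> (?F ` (?S #>\<^bsub>?A\<^esub> a)) = ?S' #>\<^bsub>?A'\<^esub> ?F a"
  proof (rule Set.set_eqI)
    fix x
    have "x \<in> ?S' <#>\<^bsub>?A'\<^esub> (?F ` (?S #>\<^bsub>?A\<^esub> a)) \<longleftrightarrow> (\<exists>t\<in>?S'. \<exists>s\<in>?S. x = t + ?F (s + a))"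
      unfolding set_mult_def r_coset_def by auto
    also have "\<dots> \<longleftrightarrow> (\<exists>t\<in>?S'. x = t + ?F a)"
    proof
      assume "\<exists>t\<in>?S'. \<exists>s\<in>?S. x = t + ?F (s + a)"
      then obtain t s where ts: "t \<in> ?S'" "s \<in> ?S" "x = t + ?F (s + a)" by blast
      then have "x = (t + ?F s) + ?F a" by (simp add: frag_extend_add add.assoc)
      then show "\<exists>t\<in>?S'. x = t + ?F a" using S'(2)[OF ts(1) FS[OF ts(2)]] by blast
    next
      assume "\<exists>t\<in>?S'. x = t + ?F a"
      then obtain t where t: "t \<in> ?S'" "x = t + ?F (0 + a)" by auto
      then show "\<exists>t\<in>?S'. \<exists>s\<in>?S. x = t + ?F (s + a)" using S(1) by blast
    qed
    also have "\<dots> \<longleftrightarrow> x \<in> ?S' #>\<^bsub>?A'\<^esub> ?F a"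
      unfolding r_coset_def by auto
    finally show "x \<in> ?S' <#>\<^bsub>?A'\<^esub> (?F ` (?S #>\<^bsub>?A\<^esub> a)) \<longleftrightarrow> x \<in> ?S' #>\<^bsub>?A'\<^esub> ?F a" .
  qed
  then show ?thesis unfolding tensor_map_def induced_map_def .
qed

text \<open>The facts proved here identify \<open>T\<close> with \<open>M / I M\<close>:
  \<open>pt\<close> is additive and onto, and its kernel is \<open>ideal_smult I M\<close>.\<close>

locale tensor_quotient = M: module R M + I: ideal I R
  for R (structure) and M :: "('a, 'm, 'c) module_scheme" (structure) and I
begin

abbreviation "Q \<equiv> quotient_module R I"
abbreviation "A \<equiv> free_Abelian_group (carrier M \<times> carrier Q)"
abbreviation "S \<equiv> tensor_subgroup R M Q"
abbreviation "T \<equiv> tensor R M Q"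
abbreviation "u \<equiv> I +>\<^bsub>R\<^esub> \<one>\<^bsub>R\<^esub>"
abbreviation "pt \<equiv> pure_tensor R M I"

lemma mod_M: "module R M"
  by (rule M.module_axioms)

lemma mod_Q: "module R Q"
  by (rule M.R.quotient_module[OF I.is_ideal])

sublocale Q: module R Q by (rule mod_Q)

lemmas coset = M.R.quotient_module_coset[OF I.is_ideal]

lemma u_closed: "u \<in> carrier Q"
  by (rule coset(1)) simp

lemma subgroup_S: "subgroup S A"
  by (rule tensor_subgroup_subgroup[OF mod_M mod_Q])

lemmas S_closed = free_Abelian_subgroupD[OF subgroup_S]

lemma relator: "z \<in> tensor_relators R M Q \<Longrightarrow> z \<in> S"
  by (rule tensor_relators_in_subgroup[OF mod_M mod_Q])

lemma normal_S: "S \<lhd> A"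
  using comm_group.subgroup_imp_normal[OF abelian_free_Abelian_group subgroup_S] .

lemma group_T: "group T"
  unfolding tensor_def by (rule normal.factorgroup_is_group[OF normal_S])

lemma pt_mult:
  assumes "x \<in> carrier M" "y \<in> carrier M"
  shows "pt x \<otimes>\<^bsub>T\<^esub> pt y = pt (x \<oplus>\<^bsub>M\<^esub> y)"
proof -
  have "pt x \<otimes>\<^bsub>T\<^esub> pt y = S #>\<^bsub>A\<^esub> (frag_of (x, u) + frag_of (y, u))"
    unfolding tensor_def pure_tensor_def
    using normal.rcos_sum[OF normal_S, of "frag_of (x, u)" "frag_of (y, u)"] assms u_closed by simp
  also have "\<dots> = pt (x \<oplus>\<^bsub>M\<^esub> y)"
    unfolding pure_tensor_def free_Abelian_coset_eq_iff[OF subgroup_S]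
    using S_closed(3)[OF relator[OF tensor_relatorI(1)[OF assms u_closed]]] by (simp add: algebra_simps)
  finally show ?thesis .
qed

lemma pt_closed: "x \<in> carrier M \<Longrightarrow> pt x \<in> carrier T"
  unfolding tensor_def pure_tensor_def FactGroup_def RCOSETS_def using u_closed by auto

lemma one_T: "\<one>\<^bsub>T\<^esub> = S"
  by (simp add: tensor_def FactGroup_def)

lemma pt_one_iff_S: "pt x = \<one>\<^bsub>T\<^esub> \<longleftrightarrow> frag_of (x, u) \<in> S"
proof -
  have "S = S #>\<^bsub>A\<^esub> 0" by (auto simp: r_coset_def)
  then show ?thesis
    unfolding one_T pure_tensor_def using free_Abelian_coset_eq_iff[OF subgroup_S, of "frag_of (x, u)" 0] by simp
qed

lemma pt_zero: "pt \<zero>\<^bsub>M\<^esub> = \<one>\<^bsub>T\<^esub>"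
proof -
  interpret T: group T by (rule group_T)
  have "pt \<zero>\<^bsub>M\<^esub> \<otimes>\<^bsub>T\<^esub> pt \<zero>\<^bsub>M\<^esub> = pt \<zero>\<^bsub>M\<^esub>" using pt_mult[of "\<zero>\<^bsub>M\<^esub>" "\<zero>\<^bsub>M\<^esub>"] by simp
  then show ?thesis using pt_closed[of "\<zero>\<^bsub>M\<^esub>"] T.l_cancel_one' by (metis M.M.zero_closed)
qed

lemma pt_smult:
  assumes "a \<in> I" "x \<in> carrier M"
  shows "pt (a \<odot>\<^bsub>M\<^esub> x) = \<one>\<^bsub>T\<^esub>"
proof -
  have a: "a \<in> carrier R" using assms(1) I.a_subset by blast
  have au: "a \<odot>\<^bsub>Q\<^esub> u = \<zero>\<^bsub>Q\<^esub>" using coset(3)[OF a M.R.one_closed] coset(4)[OF a] assms(1) a by simp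
  have 1: "frag_of (a \<odot>\<^bsub>M\<^esub> x, u) - frag_of (x, \<zero>\<^bsub>Q\<^esub>) \<in> S"
    using relator[OF tensor_relatorI(3)[OF a assms(2) u_closed]] unfolding au .
  \<comment> \<open>The additivity relator whose two second entries are zero collapses to this
    element.\<close>
  have "- frag_of (x, \<zero>\<^bsub>Q\<^esub>) \<in> S"
    using relator[OF tensor_relatorI(2)[OF assms(2) Q.M.zero_closed Q.M.zero_closed]] by simp
  from S_closed(4)[OF 1 this] show ?thesis unfolding pt_one_iff_S by simp
qed

lemma carrier_T: "carrier T = pt ` carrier M"
proof
  show "pt ` carrier M \<subseteq> carrier T" using pt_closed by blast
  show "carrier T \<subseteq> pt ` carrier M"
  proof
    fix z assume "z \<in> carrier T"
    then obtain a where a: "Poly_Mapping.keys a \<subseteq> carrier M \<times> carrier Q" "z = S #>\<^bsub>A\<^esub> a"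
      unfolding tensor_def FactGroup_def RCOSETS_def by auto
    \<comment> \<open>Induction on the free abelian group: a generator \<open>(x, I + a)\<close> is
      congruent to \<open>(a x, I + 1)\<close>, and differences stay pure because the second entries
      agree.\<close>
    have "\<exists>x\<in>carrier M. a - frag_of (x, u) \<in> S"
      using a(1)
    proof (induction a rule: free_Abelian_group_induct[consumes 1, case_names zero diff gen])
      case zero
      have "frag_of (\<zero>\<^bsub>M\<^esub>, u) \<in> S" using pt_zero pt_one_iff_S by blast
      from S_closed(3)[OF this] have "0 - frag_of (\<zero>\<^bsub>M\<^esub>, u) \<in> S" by simp
      then show ?case using M.M.zero_closed by blast
    next
      case (diff a b)
      then obtain x y where x: "x \<in> carrier M" "a - frag_of (x, u) \<in> S" and y: "y \<in> carrier M" "b - frag_of (y, u) \<in> S"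
        by blast
      let ?d = "x \<ominus>\<^bsub>M\<^esub> y"
      have d: "?d \<in> carrier M" using x y by simp
      have "?d \<oplus>\<^bsub>M\<^esub> y = x" using x y by (simp add: a_minus_def M.M.a_assoc M.M.l_neg)
      then have "frag_of (x, u) - frag_of (?d, u) - frag_of (y, u) \<in> S"
        using relator[OF tensor_relatorI(1)[OF d y(1) u_closed]] by simp
      from S_closed(2)[OF S_closed(4)[OF x(2) y(2)] this]
      have "a - b - frag_of (?d, u) \<in> S" by (simp add: algebra_simps)
      then show ?case using d by blast
    next
      case (gen p)
      then obtain x c where p: "p = (x, c)" "x \<in> carrier M" "c \<in> carrier Q" by blast
      obtain a where a: "a \<in> carrier R" "c = I +>\<^bsub>R\<^esub> a" using p(3) M.R.quotient_module_carrier[OF I.is_ideal] by blast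
      have "a \<odot>\<^bsub>Q\<^esub> u = c" using coset(3)[OF a(1) M.R.one_closed] a by simp
      then have "frag_of (a \<odot>\<^bsub>M\<^esub> x, u) - frag_of (x, c) \<in> S"
        using relator[OF tensor_relatorI(3)[OF a(1) p(2) u_closed]] by simp
      from S_closed(3)[OF this] have "frag_of p - frag_of (a \<odot>\<^bsub>M\<^esub> x, u) \<in> S" unfolding p by simp
      then show ?case using a p by (intro bexI[of _ "a \<odot>\<^bsub>M\<^esub> x"]) auto
    qed
    then show "z \<in> pt ` carrier M"
      unfolding a(2) pure_tensor_def using free_Abelian_coset_eq_iff[OF subgroup_S] by blast
  qed
qed

text \<open>The map \<open>x \<otimes> (I + a) \<mapsto> I M + a x\<close> detects the pure tensors that vanish.\<close>

lemma pt_one_imp_ideal_smult: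
  assumes x: "x \<in> carrier M" and one: "pt x = \<one>\<^bsub>T\<^esub>"
  shows "x \<in> ideal_smult I M"
proof -
  let ?IM = "ideal_smult I M"
  let ?B = "add_monoid M Mod ?IM"
  have IR: "I \<subseteq> carrier R" by (rule I.a_subset)
  have cM: "comm_group (add_monoid M)" by (rule M.M.a_comm_group)
  have sub: "subgroup ?IM (add_monoid M)" by (rule M.ideal_smult_subgroup[OF IR])
  have nor: "?IM \<lhd> add_monoid M" by (rule comm_group.subgroup_imp_normal[OF cM sub])
  interpret B: comm_group ?B by (rule comm_group.abelian_FactGroup[OF cM sub])
  let ?q = "\<lambda>x. ?IM #>\<^bsub>add_monoid M\<^esub> x"
  have q_closed: "?q x \<in> carrier ?B" if "x \<in> carrier M" for x
    using that unfolding FactGroup_def RCOSETS_def by auto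
  have q_add: "?q x \<otimes>\<^bsub>?B\<^esub> ?q y = ?q (x \<oplus>\<^bsub>M\<^esub> y)" if "x \<in> carrier M" "y \<in> carrier M" for x y
    using normal.rcos_sum[OF nor, of x y] that by simp
  have gM: "group (add_monoid M)" by (rule comm_group.axioms(2)[OF cM])
  have q_one: "?q x = \<one>\<^bsub>?B\<^esub> \<longleftrightarrow> x \<in> ?IM" if x: "x \<in> carrier M" for x
  proof -
    have "\<one>\<^bsub>?B\<^esub> = ?IM" by (simp add: FactGroup_def)
    then show ?thesis
      using group.coset_join1[OF gM, of ?IM x] group.coset_join2[OF gM, of x ?IM] sub x by fastforce
  qed
  have q_cong: "?q (a \<odot>\<^bsub>M\<^esub> x) = ?q (b \<odot>\<^bsub>M\<^esub> x)"
    if a: "a \<in> carrier R" "b \<in> carrier R" "I +>\<^bsub>R\<^esub> a = I +>\<^bsub>R\<^esub> b" "x \<in> carrier M" for a b x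
  proof -
    have "a \<in> I +>\<^bsub>R\<^esub> b" using I.a_rcos_self[OF a(1)] a(3) by simp
    then obtain i where i: "i \<in> I" "a = i \<oplus>\<^bsub>R\<^esub> b" unfolding a_r_coset_def' by auto
    have ic: "i \<in> carrier R" using i(1) IR by blast
    have "?q (a \<odot>\<^bsub>M\<^esub> x) = ?q (i \<odot>\<^bsub>M\<^esub> x) \<otimes>\<^bsub>?B\<^esub> ?q (b \<odot>\<^bsub>M\<^esub> x)"
      using q_add[of "i \<odot>\<^bsub>M\<^esub> x" "b \<odot>\<^bsub>M\<^esub> x"] ic a by (simp add: i(2) M.smult_l_distr)
    also have "?q (i \<odot>\<^bsub>M\<^esub> x) = \<one>\<^bsub>?B\<^esub>" using q_one[of "i \<odot>\<^bsub>M\<^esub> x"] ic a(4) M.ideal_smultI[OF IR i(1) a(4)] by simp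
    also have "\<one>\<^bsub>?B\<^esub> \<otimes>\<^bsub>?B\<^esub> ?q (b \<odot>\<^bsub>M\<^esub> x) = ?q (b \<odot>\<^bsub>M\<^esub> x)"
      using a by (intro B.l_one q_closed) simp
    finally show ?thesis .
  qed
  \<comment> \<open>Elements of \<open>R / I\<close> are cosets, so the map needs a representative;
    by \<open>q_cong\<close> the choice does not matter modulo \<open>I M\<close>.\<close>
  define rep where "rep c = (SOME a. a \<in> carrier R \<and> c = I +>\<^bsub>R\<^esub> a)" for c
  have rep: "rep c \<in> carrier R" "I +>\<^bsub>R\<^esub> rep c = c" if "c \<in> carrier Q" for c
  proof -
    have "\<exists>a. a \<in> carrier R \<and> c = I +>\<^bsub>R\<^esub> a" using that M.R.quotient_module_carrier[OF I.is_ideal] by auto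
    from someI_ex[OF this] show "rep c \<in> carrier R" "I +>\<^bsub>R\<^esub> rep c = c" unfolding rep_def by auto
  qed
  have q_rep: "?q (rep (I +>\<^bsub>R\<^esub> a) \<odot>\<^bsub>M\<^esub> x) = ?q (a \<odot>\<^bsub>M\<^esub> x)" if "a \<in> carrier R" "x \<in> carrier M" for a x
    by (rule q_cong[OF rep(1)[OF coset(1)[OF that(1)]] that(1) rep(2)[OF coset(1)[OF that(1)]] that(2)])
  have "(\<lambda>(x, c). ?q (rep c \<odot>\<^bsub>M\<^esub> x)) ` (carrier M \<times> carrier Q) \<subseteq> carrier ?B"
    using rep(1) q_closed by auto
  then obtain h where h: "h \<in> hom A ?B" "\<And>p. p \<in> carrier M \<times> carrier Q \<Longrightarrow> h (frag_of p) = (\<lambda>(x, c). ?q (rep c \<odot>\<^bsub>M\<^esub> x)) p"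
    using B.free_Abelian_group_universal by blast
  interpret h: group_hom A ?B h
    using h(1) by (simp add: group_hom_def group_hom_axioms_def B.is_group)
  have hf: "h (frag_of (x, I +>\<^bsub>R\<^esub> a)) = ?q (a \<odot>\<^bsub>M\<^esub> x)" if "x \<in> carrier M" "a \<in> carrier R" for x a
    using h(2)[of "(x, I +>\<^bsub>R\<^esub> a)"] coset(1) q_rep that by simp
  have hd: "h (a - b) = h a \<otimes>\<^bsub>?B\<^esub> inv\<^bsub>?B\<^esub> h b" if "a \<in> carrier A" "b \<in> carrier A" for a b
  proof -
    have "h (a \<otimes>\<^bsub>A\<^esub> inv\<^bsub>A\<^esub> b) = h a \<otimes>\<^bsub>?B\<^esub> inv\<^bsub>?B\<^esub> h b" using that h.hom_mult[of a "inv\<^bsub>A\<^esub> b"] h.hom_inv[of b] h.G.inv_closed[of b] by metis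
    then show ?thesis using that by simp
  qed
  have "S \<subseteq> kernel A ?B h"
  proof (rule tensor_subgroup_minimal[OF mod_M mod_Q h.subgroup_kernel])
    show "tensor_relators R M Q \<subseteq> kernel A ?B h"
    proof
      fix z assume z: "z \<in> tensor_relators R M Q"
      then have zc: "z \<in> carrier A" using tensor_subgroup_subgroup(2)[OF mod_M mod_Q] by blast
      have fc: "frag_of (x, c) \<in> carrier A" if "x \<in> carrier M" "c \<in> carrier Q" for x c using that by simp
      have dc: "a - b \<in> carrier A" if "a \<in> carrier A" "b \<in> carrier A" for a b
        using h.G.m_closed[OF that(1) h.G.inv_closed[OF that(2)]] that by simp
      have canc: "(p \<otimes>\<^bsub>?B\<^esub> q) \<otimes>\<^bsub>?B\<^esub> inv\<^bsub>?B\<^esub> p \<otimes>\<^bsub>?B\<^esub> inv\<^bsub>?B\<^esub> q = \<one>\<^bsub>?B\<^esub>"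
        if "p \<in> carrier ?B" "q \<in> carrier ?B" for p q
        using that by (metis B.inv_closed B.m_assoc B.m_closed B.m_comm B.r_inv B.r_one)
      from z have "h z = \<one>\<^bsub>?B\<^esub>"
      proof (rule tensor_relatorE)
        fix x x' c assume x: "x \<in> carrier M" "x' \<in> carrier M" and c: "c \<in> carrier Q"
        obtain a where a: "a \<in> carrier R" "c = I +>\<^bsub>R\<^esub> a" using rep[OF c] by metis
        have "?q (a \<odot>\<^bsub>M\<^esub> (x \<oplus>\<^bsub>M\<^esub> x')) = ?q (a \<odot>\<^bsub>M\<^esub> x) \<otimes>\<^bsub>?B\<^esub> ?q (a \<odot>\<^bsub>M\<^esub> x')"
          using q_add[of "a \<odot>\<^bsub>M\<^esub> x" "a \<odot>\<^bsub>M\<^esub> x'"] x a by (simp add: M.smult_r_distr del: mult_FactGroup)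
        then show "h (frag_of (x \<oplus>\<^bsub>M\<^esub> x', c) - frag_of (x, c) - frag_of (x', c)) = \<one>\<^bsub>?B\<^esub>"
          unfolding a(2) using x a canc[OF q_closed q_closed, of "a \<odot>\<^bsub>M\<^esub> x" "a \<odot>\<^bsub>M\<^esub> x'"] c
          by (simp add: hd dc fc hf coset(1) del: carrier_free_Abelian_group_iff mult_FactGroup)
      next
        fix x c c' assume x: "x \<in> carrier M" and c: "c \<in> carrier Q" "c' \<in> carrier Q"
        obtain a where a: "a \<in> carrier R" "c = I +>\<^bsub>R\<^esub> a" using rep[OF c(1)] by metis
        obtain a' where a': "a' \<in> carrier R" "c' = I +>\<^bsub>R\<^esub> a'" using rep[OF c(2)] by metis
        have "?q ((a \<oplus>\<^bsub>R\<^esub> a') \<odot>\<^bsub>M\<^esub> x) = ?q (a \<odot>\<^bsub>M\<^esub> x) \<otimes>\<^bsub>?B\<^esub> ?q (a' \<odot>\<^bsub>M\<^esub> x)"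
          using q_add[of "a \<odot>\<^bsub>M\<^esub> x" "a' \<odot>\<^bsub>M\<^esub> x"] x a a' by (simp add: M.smult_l_distr del: mult_FactGroup)
        then show "h (frag_of (x, c \<oplus>\<^bsub>Q\<^esub> c') - frag_of (x, c) - frag_of (x, c')) = \<one>\<^bsub>?B\<^esub>"
          unfolding a(2) a'(2) coset(2)[OF a(1) a'(1)]
          using x a a' canc[OF q_closed q_closed, of "a \<odot>\<^bsub>M\<^esub> x" "a' \<odot>\<^bsub>M\<^esub> x"]
          by (simp add: hd dc fc hf coset(1) del: carrier_free_Abelian_group_iff mult_FactGroup)
      next
        fix b x c assume b: "b \<in> carrier R" and x: "x \<in> carrier M" and c: "c \<in> carrier Q"
        obtain a where a: "a \<in> carrier R" "c = I +>\<^bsub>R\<^esub> a" using rep[OF c] by metis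
        have "a \<odot>\<^bsub>M\<^esub> (b \<odot>\<^bsub>M\<^esub> x) = (b \<otimes>\<^bsub>R\<^esub> a) \<odot>\<^bsub>M\<^esub> x"
          using M.smult_assoc1[OF a(1) b x] M.R.m_comm[OF a(1) b] by simp
        then show "h (frag_of (b \<odot>\<^bsub>M\<^esub> x, c) - frag_of (x, b \<odot>\<^bsub>Q\<^esub> c)) = \<one>\<^bsub>?B\<^esub>"
          unfolding a(2) coset(3)[OF b a(1)] using x a b q_closed[of "(b \<otimes>\<^bsub>R\<^esub> a) \<odot>\<^bsub>M\<^esub> x"]
          by (simp add: hd dc fc hf coset(1) del: carrier_free_Abelian_group_iff mult_FactGroup)
      qed
      with zc show "z \<in> kernel A ?B h" by (simp add: kernel_def del: carrier_free_Abelian_group_iff)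
    qed
  qed
  then have "h (frag_of (x, u)) = \<one>\<^bsub>?B\<^esub>" using one pt_one_iff_S by (auto simp: kernel_def)
  then show ?thesis using hf[OF x M.R.one_closed] q_one[OF x] x by simp
qed

lemma pt_one_iff:
  assumes "x \<in> carrier M"
  shows "pt x = \<one>\<^bsub>T\<^esub> \<longleftrightarrow> x \<in> ideal_smult I M"
proof
  interpret T: group T by (rule group_T)
  show "pt x = \<one>\<^bsub>T\<^esub> \<Longrightarrow> x \<in> ideal_smult I M" by (rule pt_one_imp_ideal_smult[OF assms])
  assume "x \<in> ideal_smult I M"
  then show "pt x = \<one>\<^bsub>T\<^esub>"
  proof induction
    case zero
    show ?case by (rule pt_zero)
  next
    case (step a x y)
    have y: "y \<in> carrier M" using M.ideal_smult_closed[OF I.a_subset step(3)] .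
    have ax: "a \<odot>\<^bsub>M\<^esub> x \<in> carrier M" using step(1,2) I.Icarr by simp
    show ?case using pt_mult[OF y ax] pt_smult[OF step(1,2)] step(4) by simp
  qed
qed

lemma pt_eq:
  assumes "x \<in> carrier M" "y \<in> carrier M"
  shows "pt x = pt y \<longleftrightarrow> x \<ominus>\<^bsub>M\<^esub> y \<in> ideal_smult I M"
proof -
  interpret T: group T by (rule group_T)
  have d: "x \<ominus>\<^bsub>M\<^esub> y \<in> carrier M" using assms by simp
  have "(x \<ominus>\<^bsub>M\<^esub> y) \<oplus>\<^bsub>M\<^esub> y = x" using assms by (simp add: a_minus_def M.M.a_assoc M.M.l_neg)
  then have "pt x = pt (x \<ominus>\<^bsub>M\<^esub> y) \<otimes>\<^bsub>T\<^esub> pt y" using pt_mult[OF d assms(2)] by simp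
  then have "pt x = pt y \<longleftrightarrow> pt (x \<ominus>\<^bsub>M\<^esub> y) = \<one>\<^bsub>T\<^esub>"
    using T.r_cancel_one[OF pt_closed[OF assms(2)] pt_closed[OF d]] by simp
  then show ?thesis using pt_one_iff[OF d] by simp
qed

end

lemma tensor_map_pure_tensor:
  fixes R (structure)
  assumes "module R M" "module R N" "ideal I R" "ideal J R" "f \<in> module_hom R M N"
    and g: "g \<in> module_hom R (quotient_module R I) (quotient_module R J)" "g (I +>\<^bsub>R\<^esub> \<one>) = J +>\<^bsub>R\<^esub> \<one>"
  shows "tensor_map R N (quotient_module R J) f g (pure_tensor R M I x) = pure_tensor R N J (f x)"
proof -
  interpret M: module R M by fact
  show ?thesis
    unfolding pure_tensor_def
      tensor_map_coset[OF assms(1) M.R.quotient_module[OF assms(3)] assms(2) M.R.quotient_module[OF assms(4)] assms(5) g(1)]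
    by (simp add: g(2))
qed

lemma (in cring) quotient_proj_coset:
  assumes "ideal I R" "ideal J R" "I \<subseteq> J" "x \<in> carrier R"
  shows "quotient_proj R J (I +> x) = J +> x"
proof -
  interpret I: ideal I R by fact
  interpret J: ideal J R by fact
  have "J <+>\<^bsub>R\<^esub> (I +> x) = {j \<oplus> (i \<oplus> x) | i j. j \<in> J \<and> i \<in> I}"
    unfolding set_add_def' a_r_coset_def' by auto
  also have "\<dots> = {j \<oplus> x | j. j \<in> J}"
  proof (rule Set.set_eqI)
    have 1: "j \<oplus> (i \<oplus> x) = (j \<oplus> i) \<oplus> x" "j \<oplus> i \<in> J" if "j \<in> J" "i \<in> I" for i j
      using that assms(3,4) J.Icarr I.Icarr by (auto simp: a_assoc)
    have 2: "j \<oplus> x = j \<oplus> (\<zero> \<oplus> x)" for j using assms(4) by simp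
    fix y
    show "y \<in> {j \<oplus> (i \<oplus> x) | i j. j \<in> J \<and> i \<in> I} \<longleftrightarrow> y \<in> {j \<oplus> x | j. j \<in> J}"
    proof
      assume "y \<in> {j \<oplus> (i \<oplus> x) | i j. j \<in> J \<and> i \<in> I}"
      then obtain i j where "j \<in> J" "i \<in> I" "y = j \<oplus> (i \<oplus> x)" by blast
      then show "y \<in> {j \<oplus> x | j. j \<in> J}" using 1[of j i] by blast
    next
      assume "y \<in> {j \<oplus> x | j. j \<in> J}"
      then obtain j where "j \<in> J" "y = j \<oplus> (\<zero> \<oplus> x)" using 2 by blast
      then show "y \<in> {j \<oplus> (i \<oplus> x) | i j. j \<in> J \<and> i \<in> I}" using I.zero_closed by blast
    qed
  qed
  also have "\<dots> = J +> x" unfolding a_r_coset_def' by auto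
  finally show ?thesis unfolding quotient_proj_def .
qed

lemma (in cring) quotient_proj_hom:
  assumes "ideal I R" "ideal J R" "I \<subseteq> J"
  shows "quotient_proj R J \<in> module_hom R (quotient_module R I) (quotient_module R J)"
proof (rule module_homI)
  note p = quotient_proj_coset[OF assms] and c = quotient_module_carrier[OF assms(1)]
  note qI = quotient_module_coset[OF assms(1)] and qJ = quotient_module_coset[OF assms(2)]
  fix x assume "x \<in> carrier (quotient_module R I)"
  then obtain a where a: "a \<in> carrier R" "x = I +> a" using c by auto
  show "quotient_proj R J x \<in> carrier (quotient_module R J)" using a p qJ by simp
  show "quotient_proj R J (x \<oplus>\<^bsub>quotient_module R I\<^esub> y) = quotient_proj R J x \<oplus>\<^bsub>quotient_module R J\<^esub> quotient_proj R J y"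
    if "y \<in> carrier (quotient_module R I)" for y
  proof -
    obtain b where b: "b \<in> carrier R" "y = I +> b" using c \<open>y \<in> _\<close> by auto
    show ?thesis unfolding a(2) b(2) qI(2)[OF a(1) b(1)] p[OF a(1)] p[OF b(1)] qJ(2)[OF a(1) b(1)] using a b by (simp add: p)
  qed
  show "quotient_proj R J (r \<odot>\<^bsub>quotient_module R I\<^esub> x) = r \<odot>\<^bsub>quotient_module R J\<^esub> quotient_proj R J x"
    if r: "r \<in> carrier R" for r
    unfolding a(2) qI(3)[OF r a(1)] p[OF a(1)] qJ(3)[OF r a(1)] using a r by (simp add: p)
qed

section \<open>Tor with cyclic coefficients\<close>

locale complex_tensor_quotient = cring R + I: ideal I R for R (structure) and I +
  fixes F :: "nat \<Rightarrow> ('a, 'p) module" and d :: "nat \<Rightarrow> 'p \<Rightarrow> 'p"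
  assumes F_module: "module R (F i)" and d_hom: "d i \<in> module_hom R (F (Suc i)) (F i)"
    and d_d: "x \<in> carrier (F (Suc (Suc i))) \<Longrightarrow> d i (d (Suc i) x) = \<zero>\<^bsub>F i\<^esub>"
begin

abbreviation "Q \<equiv> quotient_module R I"
abbreviation "pt i \<equiv> pure_tensor R (F i) I"

lemma tensor_quotient: "tensor_quotient R (F i) I"
  by (intro tensor_quotient.intro F_module I.is_ideal)

lemmas pt_closed = tensor_quotient.pt_closed[OF tensor_quotient]
  and pt_mult = tensor_quotient.pt_mult[OF tensor_quotient]
  and pt_zero = tensor_quotient.pt_zero[OF tensor_quotient]
  and pt_eq = tensor_quotient.pt_eq[OF tensor_quotient]
  and pt_one_iff = tensor_quotient.pt_one_iff[OF tensor_quotient]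
  and carrier_T = tensor_quotient.carrier_T[OF tensor_quotient]

text \<open>The homology class of \<open>x \<otimes> 1\<close> in degree \<open>i + 1\<close>,
  written out as a coset of the boundaries. The index is that of the differential \<open>d i\<close>
  leaving this degree.\<close>

definition tor_class :: "nat \<Rightarrow> 'p \<Rightarrow> (('p \<times> 'a set) \<Rightarrow>\<^sub>0 int) set set" where
  "tor_class i x = (\<lambda>y. pt (Suc i) (d (Suc i) y \<oplus>\<^bsub>F (Suc i)\<^esub> x)) ` carrier (F (Suc (Suc i)))"

lemma differential_pt: "Tor_differential R F d Q i (pt (Suc i) x) = pt i (d i x)"
  unfolding Tor_differential_def
  by (rule tensor_map_pure_tensor[OF F_module F_module I.is_ideal I.is_ideal d_hom module_hom_ident refl])

lemma boundaries_eq: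
  "boundaries (\<lambda>j. tensor R (F j) Q) (Tor_differential R F d Q) (Suc i) = tor_class i \<zero>\<^bsub>F (Suc i)\<^esub>"
proof -
  interpret M: module R "F (Suc i)" by (rule F_module)
  have "pt (Suc i) (d (Suc i) y \<oplus>\<^bsub>F (Suc i)\<^esub> \<zero>\<^bsub>F (Suc i)\<^esub>) = pt (Suc i) (d (Suc i) y)"
    if "y \<in> carrier (F (Suc (Suc i)))" for y
    using module_hom_closed[OF d_hom that] by simp
  then show ?thesis
    unfolding boundaries_def carrier_T tor_class_def image_image differential_pt by auto
qed

text \<open>The kernel of \<open>pt\<close> is \<open>I F\<close>, so \<open>x \<otimes> 1\<close>
  is a cycle as soon as \<open>d x\<close> lies in \<open>I F\<close>, even when \<open>x\<close> is
  not a cycle of \<open>F\<close>. These \<open>x\<close> are the ones that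
  \<open>boundary_lift\<close> is about.\<close>

lemma cycles_eq:
  "cycles (\<lambda>j. tensor R (F j) Q) (Tor_differential R F d Q) (Suc i) =
     pt (Suc i) ` {x \<in> carrier (F (Suc i)). d i x \<in> ideal_smult I (F i)}"
proof -
  have "Tor_differential R F d Q i (pt (Suc i) x) = \<one>\<^bsub>tensor R (F i) Q\<^esub> \<longleftrightarrow> d i x \<in> ideal_smult I (F i)"
    if "x \<in> carrier (F (Suc i))" for x
    unfolding differential_pt by (rule pt_one_iff[OF module_hom_closed[OF d_hom that]])
  then show ?thesis unfolding cycles.simps kernel_def carrier_T by blast
qed

lemma tor_class_coset:
  assumes "x \<in> carrier (F (Suc i))"
  shows "tor_class i \<zero>\<^bsub>F (Suc i)\<^esub> #>\<^bsub>tensor R (F (Suc i)) Q\<lparr>carrier := Z\<rparr>\<^esub> pt (Suc i) x = tor_class i x"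
proof -
  interpret M: module R "F (Suc i)" by (rule F_module)
  have "pt (Suc i) (d (Suc i) y \<oplus>\<^bsub>F (Suc i)\<^esub> \<zero>\<^bsub>F (Suc i)\<^esub>) \<otimes>\<^bsub>tensor R (F (Suc i)) Q\<^esub> pt (Suc i) x =
     pt (Suc i) (d (Suc i) y \<oplus>\<^bsub>F (Suc i)\<^esub> x)" if "y \<in> carrier (F (Suc (Suc i)))" for y
    using module_hom_closed[OF d_hom that] pt_mult assms by simp
  then show ?thesis unfolding tor_class_def r_coset_def by auto
qed

lemma Tor_carrier:
  "carrier (Tor R F d Q (Suc i)) =
     tor_class i ` {x \<in> carrier (F (Suc i)). d i x \<in> ideal_smult I (F i)}"
  unfolding Tor_def homology_def FactGroup_def RCOSETS_def boundaries_eq cycles_eq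
  using tor_class_coset by auto

lemma Tor_one: "\<one>\<^bsub>Tor R F d Q (Suc i)\<^esub> = tor_class i \<zero>\<^bsub>F (Suc i)\<^esub>"
  unfolding Tor_def homology_def FactGroup_def boundaries_eq by simp

lemma tor_class_add:
  assumes "x \<in> carrier (F (Suc i))" "y \<in> carrier (F (Suc i))"
  shows "tor_class i x <#>\<^bsub>tensor R (F (Suc i)) Q\<^esub> tor_class i y = tor_class i (x \<oplus>\<^bsub>F (Suc i)\<^esub> y)"
proof -
  interpret M: module R "F (Suc i)" by (rule F_module)
  interpret M': module R "F (Suc (Suc i))" by (rule F_module)
  have *: "pt (Suc i) (d (Suc i) a \<oplus>\<^bsub>F (Suc i)\<^esub> x) \<otimes>\<^bsub>tensor R (F (Suc i)) Q\<^esub> pt (Suc i) (d (Suc i) b \<oplus>\<^bsub>F (Suc i)\<^esub> y)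
     = pt (Suc i) (d (Suc i) (a \<oplus>\<^bsub>F (Suc (Suc i))\<^esub> b) \<oplus>\<^bsub>F (Suc i)\<^esub> (x \<oplus>\<^bsub>F (Suc i)\<^esub> y))"
    if "a \<in> carrier (F (Suc (Suc i)))" "b \<in> carrier (F (Suc (Suc i)))" for a b
    using that assms module_hom_closed[OF d_hom that(1)] module_hom_closed[OF d_hom that(2)]
    by (simp add: pt_mult module_hom_add[OF d_hom] M.M.a_ac)
  show ?thesis
  proof
    show "tor_class i x <#>\<^bsub>tensor R (F (Suc i)) Q\<^esub> tor_class i y \<subseteq> tor_class i (x \<oplus>\<^bsub>F (Suc i)\<^esub> y)"
      unfolding set_mult_def tor_class_def using * by auto
    show "tor_class i (x \<oplus>\<^bsub>F (Suc i)\<^esub> y) \<subseteq> tor_class i x <#>\<^bsub>tensor R (F (Suc i)) Q\<^esub> tor_class i y"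
    proof
      fix z assume "z \<in> tor_class i (x \<oplus>\<^bsub>F (Suc i)\<^esub> y)"
      then obtain a where a: "a \<in> carrier (F (Suc (Suc i)))" "z = pt (Suc i) (d (Suc i) a \<oplus>\<^bsub>F (Suc i)\<^esub> (x \<oplus>\<^bsub>F (Suc i)\<^esub> y))"
        unfolding tor_class_def by blast
      then have "z = pt (Suc i) (d (Suc i) a \<oplus>\<^bsub>F (Suc i)\<^esub> x) \<otimes>\<^bsub>tensor R (F (Suc i)) Q\<^esub>
          pt (Suc i) (d (Suc i) \<zero>\<^bsub>F (Suc (Suc i))\<^esub> \<oplus>\<^bsub>F (Suc i)\<^esub> y)"
        using *[OF a(1) M'.M.zero_closed] by simp
      then show "z \<in> tor_class i x <#>\<^bsub>tensor R (F (Suc i)) Q\<^esub> tor_class i y"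
        unfolding set_mult_def tor_class_def using a(1) M'.M.zero_closed by blast
    qed
  qed
qed

lemma Tor_mult: "z \<otimes>\<^bsub>Tor R F d Q (Suc i)\<^esub> w = z <#>\<^bsub>tensor R (F (Suc i)) Q\<^esub> w"
  unfolding Tor_def homology_def by (simp add: set_mult_def)

text \<open>Membership of \<open>pt x\<close> among the boundaries is an equality of pure tensors,
  hence a congruence modulo \<open>I F\<close>.\<close>

lemma tor_class_eq_zero_iff:
  assumes x: "x \<in> carrier (F (Suc i))"
  shows "tor_class i x = tor_class i \<zero>\<^bsub>F (Suc i)\<^esub> \<longleftrightarrow>
    (\<exists>y\<in>carrier (F (Suc (Suc i))). x \<ominus>\<^bsub>F (Suc i)\<^esub> d (Suc i) y \<in> ideal_smult I (F (Suc i)))"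
proof
  interpret M: module R "F (Suc i)" by (rule F_module)
  interpret M': module R "F (Suc (Suc i))" by (rule F_module)
  {
    assume "tor_class i x = tor_class i \<zero>\<^bsub>F (Suc i)\<^esub>"
    moreover have "pt (Suc i) x \<in> tor_class i x"
      unfolding tor_class_def
      by (rule image_eqI[of _ _ "\<zero>\<^bsub>F (Suc (Suc i))\<^esub>"]) (use x module_hom_zero[OF F_module F_module d_hom] in auto)
    ultimately have "pt (Suc i) x \<in> tor_class i \<zero>\<^bsub>F (Suc i)\<^esub>" by simp
    then obtain y where y: "pt (Suc i) x = pt (Suc i) (d (Suc i) y \<oplus>\<^bsub>F (Suc i)\<^esub> \<zero>\<^bsub>F (Suc i)\<^esub>)"
      "y \<in> carrier (F (Suc (Suc i)))"
      unfolding tor_class_def by (rule imageE)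
    then have "pt (Suc i) x = pt (Suc i) (d (Suc i) y)" using module_hom_closed[OF d_hom y(2)] by simp
    then show "\<exists>y\<in>carrier (F (Suc (Suc i))). x \<ominus>\<^bsub>F (Suc i)\<^esub> d (Suc i) y \<in> ideal_smult I (F (Suc i))"
      using pt_eq[OF x module_hom_closed[OF d_hom y(2)]] y(2) by blast
  }
  assume "\<exists>y\<in>carrier (F (Suc (Suc i))). x \<ominus>\<^bsub>F (Suc i)\<^esub> d (Suc i) y \<in> ideal_smult I (F (Suc i))"
  then obtain y where y: "y \<in> carrier (F (Suc (Suc i)))" "x \<ominus>\<^bsub>F (Suc i)\<^esub> d (Suc i) y \<in> ideal_smult I (F (Suc i))" by blast
  note dy = module_hom_closed[OF d_hom y(1)]
  have xy: "pt (Suc i) x = pt (Suc i) (d (Suc i) y)" using pt_eq[OF x dy] y(2) by simp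
  \<comment> \<open>Stated for general representatives so that it gives both inclusions, with
    \<open>y\<close> in one direction and its negative in the other.\<close>
  have sub: "tor_class i w \<subseteq> tor_class i w'"
    if w: "w \<in> carrier (F (Suc i))" "w' \<in> carrier (F (Suc i))" and b: "b \<in> carrier (F (Suc (Suc i)))"
      and e: "pt (Suc i) w = pt (Suc i) (d (Suc i) b \<oplus>\<^bsub>F (Suc i)\<^esub> w')" for w w' b
  proof
    fix z assume "z \<in> tor_class i w"
    then obtain a where a: "a \<in> carrier (F (Suc (Suc i)))" "z = pt (Suc i) (d (Suc i) a \<oplus>\<^bsub>F (Suc i)\<^esub> w)"
      unfolding tor_class_def by blast
    note da = module_hom_closed[OF d_hom a(1)] and db = module_hom_closed[OF d_hom b]
    have "z = pt (Suc i) (d (Suc i) a) \<otimes>\<^bsub>tensor R (F (Suc i)) Q\<^esub> pt (Suc i) w"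
      unfolding a(2) using da w by (simp add: pt_mult)
    also have "\<dots> = pt (Suc i) (d (Suc i) (a \<oplus>\<^bsub>F (Suc (Suc i))\<^esub> b) \<oplus>\<^bsub>F (Suc i)\<^esub> w')"
      unfolding e using da db w a(1) b by (simp add: pt_mult module_hom_add[OF d_hom] M.M.a_assoc)
    finally show "z \<in> tor_class i w'" unfolding tor_class_def using a(1) b by blast
  qed
  have "pt (Suc i) \<zero>\<^bsub>F (Suc i)\<^esub> = pt (Suc i) (d (Suc i) (\<ominus>\<^bsub>F (Suc (Suc i))\<^esub> y) \<oplus>\<^bsub>F (Suc i)\<^esub> x)"
  proof -
    have "pt (Suc i) (\<ominus>\<^bsub>F (Suc i)\<^esub> d (Suc i) y \<oplus>\<^bsub>F (Suc i)\<^esub> x) =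
      pt (Suc i) (\<ominus>\<^bsub>F (Suc i)\<^esub> d (Suc i) y) \<otimes>\<^bsub>tensor R (F (Suc i)) Q\<^esub> pt (Suc i) (d (Suc i) y)"
      using dy x pt_mult[of "\<ominus>\<^bsub>F (Suc i)\<^esub> d (Suc i) y" i] by (simp add: xy[symmetric] pt_mult)
    also have "\<dots> = pt (Suc i) \<zero>\<^bsub>F (Suc i)\<^esub>" using dy by (simp add: pt_mult M.M.l_neg)
    finally show ?thesis by (simp add: module_hom_minus[OF F_module F_module d_hom y(1)])
  qed
  then have "tor_class i \<zero>\<^bsub>F (Suc i)\<^esub> \<subseteq> tor_class i x"
    by (rule sub[OF M.M.zero_closed x M'.M.a_inv_closed[OF y(1)]])
  moreover have "tor_class i x \<subseteq> tor_class i \<zero>\<^bsub>F (Suc i)\<^esub>"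
    by (rule sub[OF x M.M.zero_closed y(1)]) (use dy xy in simp)
  ultimately show "tor_class i x = tor_class i \<zero>\<^bsub>F (Suc i)\<^esub>" by blast
qed

end

text \<open>\<open>induced_map\<close> adds the boundaries to the image of a class; that image is
  already a full coset of the boundaries, so nothing changes.\<close>

lemma Tor_map_quotient_proj:
  fixes R (structure)
  assumes TI: "complex_tensor_quotient R I F d" and TJ: "complex_tensor_quotient R J F d" and IJ: "I \<subseteq> J"
    and x: "x \<in> carrier (F (Suc i))"
  shows "Tor_map R F d (quotient_module R J) (quotient_proj R J) (Suc i) (complex_tensor_quotient.tor_class R I F d i x) =
    complex_tensor_quotient.tor_class R J F d i x"
proof -
  interpret TI: complex_tensor_quotient R I F d by fact
  interpret TJ: complex_tensor_quotient R J F d by fact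
  interpret M: module R "F (Suc i)" by (rule TI.F_module)
  let ?f = "tensor_map R (F (Suc i)) TJ.Q (\<lambda>x. x) (quotient_proj R J)"
  have f: "?f (TI.pt (Suc i) y) = TJ.pt (Suc i) y" for y
    by (rule tensor_map_pure_tensor[OF TI.F_module TI.F_module TI.I.is_ideal TJ.I.is_ideal module_hom_ident
        TI.quotient_proj_hom[OF TI.I.is_ideal TJ.I.is_ideal IJ] TI.quotient_proj_coset[OF TI.I.is_ideal TJ.I.is_ideal IJ TI.one_closed]])
  have "?f ` TI.tor_class i x = TJ.tor_class i x"
    unfolding TI.tor_class_def TJ.tor_class_def image_image f ..
  then show ?thesis
    unfolding Tor_map_def homology_map_def induced_map_def TJ.boundaries_eq
    using TJ.tor_class_add[OF M.M.zero_closed x] x by simp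
qed

text \<open>The class of \<open>x\<close> dies with coefficients \<open>R / J\<close> when some
  \<open>x - d y\<close> lies in \<open>J F\<close>. By exactness the elements
  \<open>x - d y\<close> are precisely the \<open>w\<close> with \<open>d w = d x\<close>.\<close>

lemma Tor_map_quotient_proj_trivial_iff:
  fixes R (structure)
  assumes TI: "complex_tensor_quotient R I F d" and TJ: "complex_tensor_quotient R J F d" and IJ: "I \<subseteq> J"
    and exact: "\<And>x. \<lbrakk>x \<in> carrier (F (Suc i)); d i x = \<zero>\<^bsub>F i\<^esub>\<rbrakk> \<Longrightarrow> x \<in> d (Suc i) ` carrier (F (Suc (Suc i)))"
  shows "trivial_homomorphism (Tor R F d (quotient_module R I) (Suc i)) (Tor R F d (quotient_module R J) (Suc i))
      (Tor_map R F d (quotient_module R J) (quotient_proj R J) (Suc i)) \<longleftrightarrow> boundary_lift I J F d i"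
    (is "trivial_homomorphism ?X ?Y ?f \<longleftrightarrow> _")
proof -
  interpret TI: complex_tensor_quotient R I F d by fact
  interpret TJ: complex_tensor_quotient R J F d by fact
  interpret M: module R "F (Suc i)" by (rule TI.F_module)
  interpret M0: module R "F i" by (rule TI.F_module)
  let ?Z = "{x \<in> carrier (F (Suc i)). d i x \<in> ideal_smult I (F i)}"
  \<comment> \<open>\<open>trivial_homomorphism\<close> also demands a homomorphism. The
    construction of the map does not provide this, but a map that is constantly one is a
    homomorphism.\<close>
  have hom: "?f \<in> hom ?X ?Y" if f: "\<forall>z\<in>carrier ?X. ?f z = \<one>\<^bsub>?Y\<^esub>"
  proof (rule homI)
    have "\<one>\<^bsub>?Y\<^esub> \<in> carrier ?Y"
      unfolding TJ.Tor_one TJ.Tor_carrier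
      by (rule imageI) (use module_hom_zero[OF TI.F_module TI.F_module TI.d_hom] in \<open>simp add: ideal_smult.zero\<close>)
    then show "?f z \<in> carrier ?Y" if "z \<in> carrier ?X" for z using f that by simp
    fix z w assume zw: "z \<in> carrier ?X" "w \<in> carrier ?X"
    then obtain x y where xy: "x \<in> ?Z" "y \<in> ?Z" "z = TI.tor_class i x" "w = TI.tor_class i y"
      unfolding TI.Tor_carrier by blast
    have "x \<oplus>\<^bsub>F (Suc i)\<^esub> y \<in> ?Z"
      using xy(1,2) M0.ideal_smult_add[OF TI.I.a_subset] by (simp add: module_hom_add[OF TI.d_hom])
    moreover have "z \<otimes>\<^bsub>?X\<^esub> w = TI.tor_class i (x \<oplus>\<^bsub>F (Suc i)\<^esub> y)"
      unfolding TI.Tor_mult xy(3,4) by (rule TI.tor_class_add) (use xy in auto)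
    ultimately have "z \<otimes>\<^bsub>?X\<^esub> w \<in> carrier ?X" unfolding TI.Tor_carrier by blast
    moreover have "\<one>\<^bsub>?Y\<^esub> \<otimes>\<^bsub>?Y\<^esub> \<one>\<^bsub>?Y\<^esub> = \<one>\<^bsub>?Y\<^esub>"
      unfolding TJ.Tor_one TJ.Tor_mult using TJ.tor_class_add[OF M.M.zero_closed M.M.zero_closed] by simp
    ultimately show "?f (z \<otimes>\<^bsub>?X\<^esub> w) = ?f z \<otimes>\<^bsub>?Y\<^esub> ?f w" using f zw by simp
  qed
  have "trivial_homomorphism ?X ?Y ?f \<longleftrightarrow> (\<forall>z\<in>carrier ?X. ?f z = \<one>\<^bsub>?Y\<^esub>)"
    unfolding trivial_homomorphism_def using hom by blast
  also have "\<dots> \<longleftrightarrow> (\<forall>x\<in>?Z. TJ.tor_class i x = TJ.tor_class i \<zero>\<^bsub>F (Suc i)\<^esub>)"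
    unfolding TI.Tor_carrier TJ.Tor_one using Tor_map_quotient_proj[OF assms(1-3)] by simp
  also have "\<dots> \<longleftrightarrow> (\<forall>x\<in>?Z. \<exists>y\<in>carrier (F (Suc (Suc i))). x \<ominus>\<^bsub>F (Suc i)\<^esub> d (Suc i) y \<in> ideal_smult J (F (Suc i)))"
    using TJ.tor_class_eq_zero_iff by auto
  also have "\<dots> \<longleftrightarrow> (\<forall>x\<in>?Z. \<exists>w\<in>ideal_smult J (F (Suc i)). d i w = d i x)"
  proof (rule ball_cong[OF refl])
    fix x assume "x \<in> ?Z"
    then have x: "x \<in> carrier (F (Suc i))" by simp
    note dx = module_hom_closed[OF TI.d_hom x]
    show "(\<exists>y\<in>carrier (F (Suc (Suc i))). x \<ominus>\<^bsub>F (Suc i)\<^esub> d (Suc i) y \<in> ideal_smult J (F (Suc i))) \<longleftrightarrow>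
      (\<exists>w\<in>ideal_smult J (F (Suc i)). d i w = d i x)"
    proof
      assume "\<exists>y\<in>carrier (F (Suc (Suc i))). x \<ominus>\<^bsub>F (Suc i)\<^esub> d (Suc i) y \<in> ideal_smult J (F (Suc i))"
      then obtain y where y: "y \<in> carrier (F (Suc (Suc i)))" "x \<ominus>\<^bsub>F (Suc i)\<^esub> d (Suc i) y \<in> ideal_smult J (F (Suc i))" by blast
      note dy = module_hom_closed[OF TI.d_hom y(1)]
      have "d i (x \<ominus>\<^bsub>F (Suc i)\<^esub> d (Suc i) y) = d i x"
        unfolding a_minus_def using x dy dx
        by (simp add: module_hom_add[OF TI.d_hom] module_hom_minus[OF TI.F_module TI.F_module TI.d_hom] TI.d_d[OF y(1)])
      with y(2) show "\<exists>w\<in>ideal_smult J (F (Suc i)). d i w = d i x" by blast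
    next
      assume "\<exists>w\<in>ideal_smult J (F (Suc i)). d i w = d i x"
      then obtain w where w: "w \<in> ideal_smult J (F (Suc i))" "d i w = d i x" by blast
      have wc: "w \<in> carrier (F (Suc i))" by (rule M.ideal_smult_closed[OF TJ.I.a_subset w(1)])
      have "d i (x \<ominus>\<^bsub>F (Suc i)\<^esub> w) = \<zero>\<^bsub>F i\<^esub>"
        unfolding a_minus_def using x wc dx w(2)
        by (simp add: module_hom_add[OF TI.d_hom] module_hom_minus[OF TI.F_module TI.F_module TI.d_hom] M0.M.r_neg)
      then obtain y where y: "y \<in> carrier (F (Suc (Suc i)))" "x \<ominus>\<^bsub>F (Suc i)\<^esub> w = d (Suc i) y"
        using exact[of "x \<ominus>\<^bsub>F (Suc i)\<^esub> w"] x wc by auto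
      have "x \<ominus>\<^bsub>F (Suc i)\<^esub> d (Suc i) y = w"
        unfolding y(2)[symmetric] a_minus_def using x wc
        by (simp add: M.M.minus_add M.M.a_assoc[symmetric] M.M.r_neg)
      then show "\<exists>y\<in>carrier (F (Suc (Suc i))). x \<ominus>\<^bsub>F (Suc i)\<^esub> d (Suc i) y \<in> ideal_smult J (F (Suc i))"
        using y(1) w(1) by auto
    qed
  qed
  also have "\<dots> \<longleftrightarrow> boundary_lift I J F d i" unfolding boundary_lift_def by auto
  finally show ?thesis .
qed

theorem theorem7p1:
  fixes R :: "('a, 'b) ring_scheme" and m :: "'a set" and n :: nat
    and F :: "nat \<Rightarrow> ('a, 'p) module" and d :: "nat \<Rightarrow> 'p \<Rightarrow> 'p" and \<epsilon> :: "'p \<Rightarrow> 'a set"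
  assumes "artinian_ring R" and "local_ring R m"
    and "m \<noteq> {\<zero>\<^bsub>R\<^esub>}"
    and "n \<ge> 1" and "ideal_power R m (n + 1) = {\<zero>\<^bsub>R\<^esub>}"
    and "free_resolution R (quotient_module R m) F d \<epsilon>"
    and "\<exists>N. \<forall>i\<ge>N. nu_zero R m F d (n - 1) i"
  shows "\<forall>i>0. nu_zero R m F d (n - 1) i"
proof -
  interpret local_ring R m by fact
  have nil: "nilpotent_local_ring R m (n + 1)"
    using assms(3,5) by (intro nilpotent_local_ring.intro assms(2) nilpotent_local_ring_axioms.intro)
  let ?I = "ideal_power R m n" and ?J = "ideal_power R m (n - 1)"
  have idl: "ideal (ideal_power R m s) R" for s by (rule ideal_power_ideal[OF is_ideal])
  have Suc: "Suc (n - 1) = n" using assms(4) by simp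
  have IJ: "?I \<subseteq> ?J" using ideal_power_Suc_subset[OF is_ideal, of "n - 1"] unfolding Suc .
  have idc: "ideal_power R m s \<subseteq> carrier R" for s
    using additive_subgroup.a_subset[OF ideal.axioms(1)[OF idl]] .
  note Ic = idc[of n] and Jc = idc[of "n - 1"]
  \<comment> \<open>Here \<open>m^(n+1) = 0\<close> enters in the form \<open>m^n m = 0\<close>,
    which turns the multiples by \<open>I\<close> of elements of a minimal complex into
    cycles.\<close>
  have ann: "t \<otimes>\<^bsub>R\<^esub> a = \<zero>\<^bsub>R\<^esub>" if "t \<in> ?I" "a \<in> m" for t a
  proof -
    have "a \<otimes>\<^bsub>R\<^esub> t \<in> ideal_power R m (n + 1)" using ideal_prod.prod[OF that(2,1), of R] by simp
    then show ?thesis using that assms(5) Ic a_subset m_comm[of a t] by auto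
  qed
  have k: "module R (quotient_module R m)" by (rule quotient_module[OF is_ideal])
  note FD = free_resolutionD[OF assms(6)]
  have TI: "complex_tensor_quotient R (ideal_power R m s) F d" for s
    by (intro complex_tensor_quotient.intro complex_tensor_quotient_axioms.intro cring_axioms idl FD(2,3,8))
  \<comment> \<open>Degree \<open>i + 1\<close> of \<open>Tor\<close> corresponds to the
    differential \<open>d i\<close>, so lifting for all \<open>i\<close> covers exactly the positive
    degrees.\<close>
  have nu: "nu_zero R m F d (n - 1) (Suc i) \<longleftrightarrow> boundary_lift ?I ?J F d i" for i
    unfolding nu_zero_def nu_def Suc by (rule Tor_map_quotient_proj_trivial_iff[OF TI TI IJ FD(7)])
  obtain r :: "nat \<Rightarrow> nat" and g and \<eta> where G: "r 0 = 1" "\<And>i. r i > 0"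
    "g 0 ` carrier (vec_module R {..<r 1}) = {x \<in> carrier (vec_module R {..<r 0}). x 0 \<in> m}"
    "free_resolution R (quotient_module R m) (\<lambda>i. vec_module R {..<r i}) g \<eta>"
    "\<And>i x k. x \<in> carrier (vec_module R {..<r (Suc i)}) \<Longrightarrow> g i x k \<in> m"
    by (rule minimal_free_resolution_exists[OF nil assms(1)]) blast
  interpret G: minimal_free_resolution R m "n + 1" r g \<eta>
    by (intro minimal_free_resolution.intro nil minimal_free_resolution_axioms.intro G)
  obtain N where N: "\<And>i. i \<ge> N \<Longrightarrow> nu_zero R m F d (n - 1) i" using assms(7) by blast
  \<comment> \<open>The vanishing in high degrees passes from the given resolution to the minimal
    one; after the elimination it passes back in all degrees.\<close>
  have "boundary_lift ?I ?J (\<lambda>i. vec_module R {..<r i}) g j" if "j \<ge> N" for j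
    by (rule boundary_lift_transfer[OF k G(4) assms(6) IJ Jc]) (use nu[of j] N[of "Suc j"] that in simp)
  from G.boundary_lift_all[OF Ic ann Jc this]
  have "boundary_lift ?I ?J F d i" for i
    by (rule boundary_lift_transfer[OF k assms(6) G(4) IJ Jc])
  then show ?thesis using nu by (metis gr0_conv_Suc)
qed

end
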